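(* Let $K\ge0$ and let $\delta:[0,T]\to\mathbb R^+$ be a continuous function satisfying: (i) $s+\delta(s)\le T+K$ for all $s\in[0,T]$; (ii) there is a constant $L\ge0$ such that for all $t\in[0,T]$ and all nonnegative integrable $g(\cdot)$, $\int_t^Tg(s+\delta(s))\,ds\le L\int_t^{T+K}g(s)\,ds$. For $j=1,2$ suppose that for all $s\in[0,T]$, $f_j(s,\omega,y,z,\theta):\Omega\times\mathbb R\times\mathbb R^d\times L^2(\mathscr F_r)\to L^2(\mathscr F_s)$, where $r\in[s,T+K]$, and that: (H1) there is a constant $C>0$ such that for all $s\in[0,T]$, $y,y'\in\mathbb R$, $z,z'\in\mathbb R^d$, $\theta_\cdot,\theta'_\cdot\in L^2_{\mathscr F}(s,T+K)$, $r\in[s,T+K]$, $$|f_j(s,y,z,\theta_r)-f_j(s,y',z',\theta'_r)|\le C\big(|y-y'|+|z-z'|+E^{\mathscr F_s}[|\theta_r-\theta'_r|]\big);$$ (H2) $E[\int_0^T|f_j(s,0,0,0)|^2ds]<\infty$. Let $\xi^{(1)}_\cdot,\xi^{(2)}_\cdot\in S^2_{\mathscr F}(T,T+K)$, and let $(Y^{(j)}_\cdot,Z^{(j)}_\cdot)$, $j=1,2$, be the solutions of the one-dimensional anticipated backward stochastic differential equations $$\begin{cases}-dY^{(j)}_t=f_j(t,Y^{(j)}_t,Z^{(j)}_t,Y^{(j)}_{t+\delta(t)})\,dt-Z^{(j)}_t\,dW_t,& 0\le t\le T;\\ Y^{(j)}_t=\xi^{(j)}_t,& T\le t\le T+K.\end{cases}$$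 Assume that for all $t\in[0,T]$, $y\in\mathbb R$, $z\in\mathbb R^d$, $f_2(t,y,z,\cdot)$ is increasing, that is, $f_2(t,y,z,\theta_r)\ge f_2(t,y,z,\theta'_r)$ whenever $\theta_r\ge\theta'_r$, $\theta_\cdot,\theta'_\cdot\in L^2_{\mathscr F}(t,T+K)$, $r\in[t,T+K]$. If $\xi^{(1)}_s\ge\xi^{(2)}_s$ for $s\in[T,T+K]$, and $f_1(t,y,z,\theta_r)\ge f_2(t,y,z,\theta_r)$ for all $t\in[0,T]$, $y\in\mathbb R$, $z\in\mathbb R^d$, $\theta_\cdot\in L^2_{\mathscr F}(t,T+K)$, $r\in[t,T+K]$, then $$Y^{(1)}_t\ge Y^{(2)}_t,\quad\text{a.e., a.s.}$$
   Context: $(\Omega,\mathscr F,P,(\mathscr F_t)_{t\ge0})$ is a complete stochastic basis such that $\mathscr F_0$ contains all $P$-null elements of $\mathscr F$, and the filtration is generated by a $d$-dimensional standard Brownian motion $W=(W_t)_{t\ge0}$. $T>0$ is fixed. $E^{\mathscr F_s}[\cdot]$ denotes conditional expectation given $\mathscr F_s$. The argument $\omega$ of $f_j$ is suppressed; inequalities between random variables are understood almost surely; "a.e., a.s." means for almost every time $t$, almost surely. $L^2(\mathscr F_r)$ is the set of real $\mathscr F_r$-measurable random variables $\xi$ with $E[|\xi|^2]<\infty$. For $a\le b$: $L^2_{\mathscr F}(a,b;\mathbb R^m)$ is the set of $\mathbb R^m$-valued $\mathscr F_t$-adapted processes $\varphi$ on $[a,b]$ with $E[\int_a^b|\varphi_t|^2dt]<\infty$;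 $S^2_{\mathscr F}(a,b;\mathbb R^m)$ is the set of continuous processes in it with $E[\sup_{a\le t\le b}|\varphi_t|^2]<\infty$; when $m=1$ the target space is omitted. A solution is a pair of $\mathscr F_t$-adapted processes $(Y_\cdot,Z_\cdot)\in S^2_{\mathscr F}(0,T+K)\times L^2_{\mathscr F}(0,T;\mathbb R^d)$ satisfying the equation; $Z$ takes values in row vectors.
   Formalization: In (H1) the exceptional null set is required not to depend on y, y', z, z' (it may depend on s, r, θ, θ'); if it may depend on y the claim fails, e.g. f_2=0, f_1(t,y)=-1 when t>0 and y=W_t-(T-t), else 0, with ξ=W_T. *)

theory Defs
  imports "HOL-Probability.Probability"
begin

text \<open>Standard \<open>d\<close>-dimensional Brownian motion, with \<open>d = CARD('d)\<close>. Paths are continuous and start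
  at 0 almost surely.\<close>

definition standard_brownian_motion :: "'a measure \<Rightarrow> (real \<Rightarrow> 'a \<Rightarrow> real ^ 'd) \<Rightarrow> bool" where
  "standard_brownian_motion M W \<longleftrightarrow>
     (\<forall>t\<ge>0. W t \<in> borel_measurable M) \<and>
     (AE \<omega> in M. W 0 \<omega> = 0) \<and>
     (AE \<omega> in M. continuous_on {0..} (\<lambda>t. W t \<omega>)) \<and>
     (\<forall>(t :: nat \<Rightarrow> real) n. 0 \<le> t 0 \<longrightarrow> mono t \<longrightarrow>
        prob_space.indep_vars M (\<lambda>_. borel) (\<lambda>i \<omega>. W (t (Suc i)) \<omega> - W (t i) \<omega>) {..<n}) \<and>
     (\<forall>s t. 0 \<le> s \<longrightarrow> s < t \<longrightarrow>
        prob_space.indep_vars M (\<lambda>_. borel) (\<lambda>i \<omega>. (W t \<omega> - W s \<omega>) $ i) UNIV \<and>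
        (\<forall>i. distributed M lborel (\<lambda>\<omega>. (W t \<omega> - W s \<omega>) $ i) (normal_density 0 (sqrt (t - s)))))"

text \<open>The filtration generated by \<open>W\<close>, completed by the null sets of \<open>M\<close>. Only the space and the
  sets of the resulting measure are meaningful.\<close>

definition brownian_filtration :: "'a measure \<Rightarrow> (real \<Rightarrow> 'a \<Rightarrow> real ^ 'd) \<Rightarrow> real \<Rightarrow> 'a measure" where
  "brownian_filtration M W t =
     sigma (space M) ({W s -` A \<inter> space M | s A. s \<in> {0..t} \<and> A \<in> sets borel} \<union> null_sets M)"

definition measurable_process :: "'a measure \<Rightarrow> real \<Rightarrow> real \<Rightarrow> (real \<Rightarrow> 'a \<Rightarrow> 'b::euclidean_space) \<Rightarrow> bool" where
  "measurable_process M a b \<phi> \<longleftrightarrow>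
     (\<lambda>(t, \<omega>). \<phi> t \<omega>) \<in> borel_measurable (restrict_space borel {a..b} \<Otimes>\<^sub>M M)"

definition adapted_process :: "(real \<Rightarrow> 'a measure) \<Rightarrow> real \<Rightarrow> real \<Rightarrow> (real \<Rightarrow> 'a \<Rightarrow> 'b::euclidean_space) \<Rightarrow> bool" where
  "adapted_process F a b \<phi> \<longleftrightarrow> (\<forall>t\<in>{a..b}. \<phi> t \<in> borel_measurable (F t))"

text \<open>\<open>L2_rv M (F r)\<close> is $L^2(\mathscr F_r)$; random variables and processes are represented by
  functions, not by equivalence classes.\<close>

definition L2_rv :: "'a measure \<Rightarrow> 'a measure \<Rightarrow> ('a \<Rightarrow> real) set" where
  "L2_rv M G = {\<xi>. \<xi> \<in> borel_measurable G \<and> integrable M (\<lambda>\<omega>. (\<xi> \<omega>)\<^sup>2)}"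

definition L2_process ::
  "'a measure \<Rightarrow> (real \<Rightarrow> 'a measure) \<Rightarrow> real \<Rightarrow> real \<Rightarrow> (real \<Rightarrow> 'a \<Rightarrow> 'b::euclidean_space) set" where
  "L2_process M F a b =
     {\<phi>. adapted_process F a b \<phi> \<and> measurable_process M a b \<phi> \<and>
        (\<integral>\<^sup>+\<omega>. (\<integral>\<^sup>+t\<in>{a..b}. ennreal ((norm (\<phi> t \<omega>))\<^sup>2) \<partial>lborel) \<partial>M) < \<infinity>}"

definition S2_process ::
  "'a measure \<Rightarrow> (real \<Rightarrow> 'a measure) \<Rightarrow> real \<Rightarrow> real \<Rightarrow> (real \<Rightarrow> 'a \<Rightarrow> 'b::euclidean_space) set" where
  "S2_process M F a b =
     {\<phi> \<in> L2_process M F a b. (AE \<omega> in M. continuous_on {a..b} (\<lambda>t. \<phi> t \<omega>)) \<and>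
        (\<integral>\<^sup>+\<omega>. (SUP t\<in>{a..b}. ennreal ((norm (\<phi> t \<omega>))\<^sup>2)) \<partial>M) < \<infinity>}"

text \<open>Ito integral on \<open>{0..T}\<close>. A simple integrand is given by a partition \<open>\<tau> 0, \<dots>, \<tau> n\<close> of
  \<open>{0..T}\<close> and bounded vectors \<open>H i\<close>, measurable at time \<open>\<tau> i\<close>, held on \<open>{\<tau> i<..\<tau> (Suc i)}\<close>; the
  integral of a general integrand is the mean-square limit of integrals of simple ones.\<close>

definition simple_integrand ::
  "'a measure \<Rightarrow> (real \<Rightarrow> 'a measure) \<Rightarrow> real \<Rightarrow> nat \<Rightarrow> (nat \<Rightarrow> real) \<Rightarrow> (nat \<Rightarrow> 'a \<Rightarrow> real ^ 'd) \<Rightarrow> bool" where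
  "simple_integrand M F T n \<tau> H \<longleftrightarrow>
     \<tau> 0 = 0 \<and> \<tau> n = T \<and> (\<forall>i<n. \<tau> i < \<tau> (Suc i)) \<and>
     (\<forall>i<n. H i \<in> borel_measurable (F (\<tau> i)) \<and> (\<exists>B. \<forall>\<omega>\<in>space M. norm (H i \<omega>) \<le> B))"

definition simple_process ::
  "nat \<Rightarrow> (nat \<Rightarrow> real) \<Rightarrow> (nat \<Rightarrow> 'a \<Rightarrow> real ^ 'd) \<Rightarrow> real \<Rightarrow> 'a \<Rightarrow> real ^ 'd" where
  "simple_process n \<tau> H t \<omega> = (\<Sum>i<n. indicator {\<tau> i<..\<tau> (Suc i)} t *\<^sub>R H i \<omega>)"

definition simple_integral ::
  "(real \<Rightarrow> 'a \<Rightarrow> real ^ 'd) \<Rightarrow> nat \<Rightarrow> (nat \<Rightarrow> real) \<Rightarrow> (nat \<Rightarrow> 'a \<Rightarrow> real ^ 'd) \<Rightarrow> real \<Rightarrow> 'a \<Rightarrow> real" where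
  "simple_integral W n \<tau> H t \<omega> =
     (\<Sum>i<n. H i \<omega> \<bullet> (W (min t (\<tau> (Suc i))) \<omega> - W (min t (\<tau> i)) \<omega>))"

text \<open>\<open>I\<close> is the adapted, almost surely continuous version of $\int_0^t Z_s dW_s$, \<open>t \<in> {0..T}\<close>; it is
  unique up to indistinguishability.\<close>

definition is_ito_integral ::
  "'a measure \<Rightarrow> (real \<Rightarrow> 'a measure) \<Rightarrow> (real \<Rightarrow> 'a \<Rightarrow> real ^ 'd) \<Rightarrow> real \<Rightarrow>
     (real \<Rightarrow> 'a \<Rightarrow> real ^ 'd) \<Rightarrow> (real \<Rightarrow> 'a \<Rightarrow> real) \<Rightarrow> bool" where
  "is_ito_integral M F W T Z I \<longleftrightarrow>
     adapted_process F 0 T I \<and>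
     (AE \<omega> in M. continuous_on {0..T} (\<lambda>t. I t \<omega>)) \<and>
     (\<exists>n \<tau> H. (\<forall>k. simple_integrand M F T (n k) (\<tau> k) (H k)) \<and>
        (\<lambda>k. \<integral>\<^sup>+\<omega>. (\<integral>\<^sup>+t\<in>{0..T}. ennreal ((norm (Z t \<omega> - simple_process (n k) (\<tau> k) (H k) t \<omega>))\<^sup>2)
                \<partial>lborel) \<partial>M) \<longlonglongrightarrow> 0 \<and>
        (\<forall>t\<in>{0..T}. (\<lambda>k. \<integral>\<^sup>+\<omega>. ennreal ((I t \<omega> - simple_integral W (n k) (\<tau> k) (H k) t \<omega>)\<^sup>2) \<partial>M)
           \<longlonglongrightarrow> 0))"

text \<open>A generator is a function \<open>f s y z \<theta>\<close>, where \<open>\<theta>\<close> is a whole random variable and the value is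
  again a random variable.\<close>

type_synonym ('a, 'd) generator = "real \<Rightarrow> real \<Rightarrow> real ^ 'd \<Rightarrow> ('a \<Rightarrow> real) \<Rightarrow> 'a \<Rightarrow> real"

definition generator_maps ::
  "'a measure \<Rightarrow> (real \<Rightarrow> 'a measure) \<Rightarrow> real \<Rightarrow> real \<Rightarrow> ('a, 'd::finite) generator \<Rightarrow> bool" where
  "generator_maps M F T K f \<longleftrightarrow>
     (\<forall>s\<in>{0..T}. \<forall>r\<in>{s..T + K}. \<forall>y z. \<forall>\<theta>\<in>L2_rv M (F r). f s y z \<theta> \<in> L2_rv M (F s))"

text \<open>The arguments $\theta_r$ a generator is applied to. An element of $L^2_{\mathscr F}(s,T+K)$ need
  not be square integrable at every single time, so membership of $\theta_r$ in the domain
  $L^2(\mathscr F_r)$ of the generator is required separately.\<close>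

definition anticipated_args ::
  "'a measure \<Rightarrow> (real \<Rightarrow> 'a measure) \<Rightarrow> real \<Rightarrow> real \<Rightarrow> real \<Rightarrow> (real \<Rightarrow> 'a \<Rightarrow> real) set" where
  "anticipated_args M F s r U = {\<theta> \<in> L2_process M F s U. \<theta> r \<in> L2_rv M (F r)}"

text \<open>The exceptional null set of the Lipschitz condition may depend on \<open>s\<close>, \<open>r\<close>, \<open>\<theta>\<close>, \<open>\<theta>'\<close>, but not on
  \<open>y\<close>, \<open>z\<close>, \<open>y'\<close>, \<open>z'\<close>: the equation substitutes the random values $Y_t(\omega)$, $Z_t(\omega)$ for
  \<open>y\<close>, \<open>z\<close>.\<close>

definition generator_lipschitz ::
  "'a measure \<Rightarrow> (real \<Rightarrow> 'a measure) \<Rightarrow> real \<Rightarrow> real \<Rightarrow> ('a, 'd::finite) generator \<Rightarrow> bool" where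
  "generator_lipschitz M F T K f \<longleftrightarrow>
     (\<exists>C>0. \<forall>s\<in>{0..T}. \<forall>r\<in>{s..T + K}.
        \<forall>\<theta>\<in>anticipated_args M F s r (T + K). \<forall>\<theta>'\<in>anticipated_args M F s r (T + K).
          AE \<omega> in M. \<forall>y y' z z'.
            \<bar>f s y z (\<theta> r) \<omega> - f s y' z' (\<theta>' r) \<omega>\<bar>
              \<le> C * (\<bar>y - y'\<bar> + norm (z - z') + real_cond_exp M (F s) (\<lambda>\<omega>. \<bar>\<theta> r \<omega> - \<theta>' r \<omega>\<bar>) \<omega>))"

definition generator_square_integrable ::
  "'a measure \<Rightarrow> (real \<Rightarrow> 'a measure) \<Rightarrow> real \<Rightarrow> ('a, 'd::finite) generator \<Rightarrow> bool" where
  "generator_square_integrable M F T f \<longleftrightarrow> (\<lambda>s. f s 0 0 (\<lambda>_. 0)) \<in> L2_process M F 0 T"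

definition generator_increasing ::
  "'a measure \<Rightarrow> (real \<Rightarrow> 'a measure) \<Rightarrow> real \<Rightarrow> real \<Rightarrow> ('a, 'd::finite) generator \<Rightarrow> bool" where
  "generator_increasing M F T K f \<longleftrightarrow>
     (\<forall>t\<in>{0..T}. \<forall>y z. \<forall>r\<in>{t..T + K}.
        \<forall>\<theta>\<in>anticipated_args M F t r (T + K). \<forall>\<theta>'\<in>anticipated_args M F t r (T + K).
          (AE \<omega> in M. \<theta> r \<omega> \<ge> \<theta>' r \<omega>) \<longrightarrow> (AE \<omega> in M. f t y z (\<theta> r) \<omega> \<ge> f t y z (\<theta>' r) \<omega>))"

text \<open>Solutions of the equation, in integrated form:
  $Y_t=\xi_T+\int_t^T f(s,Y_s,Z_s,Y_{s+\delta(s)}) ds-\int_t^T Z_s dW_s$. The drift is required to be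
  a measurable process with integrable paths, so that its time integral makes sense.\<close>

definition absde_drift ::
  "('a, 'd::finite) generator \<Rightarrow> (real \<Rightarrow> real) \<Rightarrow> (real \<Rightarrow> 'a \<Rightarrow> real) \<Rightarrow> (real \<Rightarrow> 'a \<Rightarrow> real ^ 'd) \<Rightarrow>
     real \<Rightarrow> 'a \<Rightarrow> real" where
  "absde_drift f \<delta> Y Z t \<omega> = f t (Y t \<omega>) (Z t \<omega>) (Y (t + \<delta> t)) \<omega>"

definition absde_solution ::
  "'a measure \<Rightarrow> (real \<Rightarrow> 'a measure) \<Rightarrow> (real \<Rightarrow> 'a \<Rightarrow> real ^ 'd) \<Rightarrow> real \<Rightarrow> real \<Rightarrow> (real \<Rightarrow> real) \<Rightarrow>
     ('a, 'd::finite) generator \<Rightarrow> (real \<Rightarrow> 'a \<Rightarrow> real) \<Rightarrow>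
     (real \<Rightarrow> 'a \<Rightarrow> real) \<Rightarrow> (real \<Rightarrow> 'a \<Rightarrow> real ^ 'd) \<Rightarrow> bool" where
  "absde_solution M F W T K \<delta> f \<xi> Y Z \<longleftrightarrow>
     Y \<in> S2_process M F 0 (T + K) \<and> Z \<in> L2_process M F 0 T \<and>
     measurable_process M 0 T (absde_drift f \<delta> Y Z) \<and>
     (AE \<omega> in M. set_integrable lborel {0..T} (\<lambda>s. absde_drift f \<delta> Y Z s \<omega>)) \<and>
     (\<exists>I. is_ito_integral M F W T Z I \<and>
        (AE \<omega> in M. \<forall>t\<in>{0..T}.
           Y t \<omega> = \<xi> T \<omega> + (LINT s:{t..T}|lborel. absde_drift f \<delta> Y Z s \<omega>) - (I T \<omega> - I t \<omega>))) \<and>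
     (AE \<omega> in M. \<forall>t\<in>{T..T + K}. Y t \<omega> = \<xi> t \<omega>)"

text \<open>Conditions (i) and (ii) on the anticipation time \<open>\<delta>\<close>.\<close>

definition anticipation_time :: "real \<Rightarrow> real \<Rightarrow> (real \<Rightarrow> real) \<Rightarrow> bool" where
  "anticipation_time T K \<delta> \<longleftrightarrow>
     continuous_on {0..T} \<delta> \<and> (\<forall>s\<in>{0..T}. 0 \<le> \<delta> s \<and> s + \<delta> s \<le> T + K) \<and>
     (\<exists>L::real. 0 \<le> L \<and> (\<forall>t\<in>{0..T}. \<forall>g :: real \<Rightarrow> real.
        (\<forall>s\<in>{0..T + K}. 0 \<le> g s) \<longrightarrow> set_integrable lborel {0..T + K} g \<longrightarrow>
        (\<integral>\<^sup>+s\<in>{t..T}. ennreal (g (s + \<delta> s)) \<partial>lborel)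
          \<le> ennreal L * (\<integral>\<^sup>+s\<in>{t..T + K}. ennreal (g s) \<partial>lborel)))"

end

theory Submission
  imports Defs
begin

text \<open>
  Let $X = Y^{(2)} - Y^{(1)}$ and let $\varphi$ be a convex $C^2$ penalty vanishing exactly on the
  nonpositive reals. Ito's formula for $\varphi(X)$ in expectation, together with the pointwise bound
  $f_2(Y^{(2)}) - f_1(Y^{(1)}) \le C(|X_s| + |Z^{(2)}_s - Z^{(1)}_s| + E^{\mathscr F_s}[X_{s+\delta(s)}^+])$
  (compare $f_1$ with $f_2$, then use monotonicity at the maximum of $Y^{(1)}$ and $Y^{(2)}$, then the Lipschitz
  condition) and absorption of the $Z$-term into the second-order term, gives
  $u(t) \le c \int_t^T (u(s) + u(s + \delta(s)))\,ds$ for $u(s) = E[\varphi(X_s)]$. The conditional expectation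
  disappears because $\varphi'(X_s)$ is $\mathscr F_s$-measurable. Condition (ii) and Gronwall's inequality then force
  $u = 0$.

  Only an inequality in expectation is needed from stochastic calculus. For integrands that are
  constant in time between breakpoints it follows from a second-order Taylor expansion over an interval
  of length $r$, with an error of $\sqrt r$ times an additive function of the interval, which disappears
  under equal subdivision. Once the $Z$-term has been absorbed, no second derivative is left, and the
  inequality passes to the limit along the simple integrands by convergence in $L^2$ alone.
\<close>

section \<open>A smooth penalty for positivity\<close>

text \<open>Asking for an inequality instead of Ito's formula pays off at large increments: there
  the Taylor remainder is replaced by the convexity bound, so the drift, which has second moments
  only, never meets a cube. The error order \<open>sqrt r\<close> comes from Young's inequality with
  weight \<open>sqrt r\<close>: the drift increment has second moment at most r times the integral
  of E h^2, the Brownian part has fourth moment of order r^2, and either one divided by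
  \<open>sqrt r\<close> is still \<open>sqrt r\<close> times something additive.

  Two gaps separate the hypotheses from this calculation. The drift of a solution is only assumed to
  have integrable paths; its second moment has to be recovered from the Lipschitz condition. And for
  fixed y and z the order and monotonicity of the generators hold off a null set that may depend on
  y and z, whereas the equation inserts random values; the Lipschitz condition and a countable dense
  set repair this. Gronwall closes because u vanishes on [T, T + K], so that the integral over
  [t, T + K] in condition (ii) shrinks to [t, T].\<close>

text \<open>\<open>pen\<close> is convex and of class $C^2$, with derivatives \<open>pen1\<close> and \<open>pen2\<close>; it grows like $x^3$ near
  the origin and like $x^2$ at infinity. The cubic part reconciles \<open>pen1\<^sup>2 \<le> 2 * pen * pen2\<close> with a
  Lipschitz second derivative (that of $(x^+)^2$ jumps at 0), and the quadratic growth keeps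
  everything within second moments.\<close>

definition pen :: "real \<Rightarrow> real" where
  "pen x = (max x 0) ^ 3 - (max (x - 1) 0) ^ 3"

definition pen1 :: "real \<Rightarrow> real" where
  "pen1 x = 3 * ((max x 0)\<^sup>2 - (max (x - 1) 0)\<^sup>2)"

definition pen2 :: "real \<Rightarrow> real" where
  "pen2 x = 6 * (max x 0 - max (x - 1) 0)"

lemma pen_le_0: "x \<le> 0 \<Longrightarrow> pen x = 0 \<and> pen1 x = 0 \<and> pen2 x = 0"
  and pen_01: "0 \<le> x \<Longrightarrow> x \<le> 1 \<Longrightarrow> pen x = x ^ 3 \<and> pen1 x = 3 * x\<^sup>2 \<and> pen2 x = 6 * x"
  and pen_ge_1: "1 \<le> x \<Longrightarrow> pen x = 3 * x\<^sup>2 - 3 * x + 1 \<and> pen1 x = 6 * x - 3 \<and> pen2 x = 6"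
  by (auto simp: pen_def pen1_def pen2_def max_def power2_eq_square power3_eq_cube algebra_simps)

lemma pen_cases:
  obtains "x \<le> 0" "pen x = 0" "pen1 x = 0" "pen2 x = 0"
  | "0 < x" "x < 1" "pen x = x ^ 3" "pen1 x = 3 * x\<^sup>2" "pen2 x = 6 * x"
  | "1 \<le> x" "pen x = 3 * x\<^sup>2 - 3 * x + 1" "pen1 x = 6 * x - 3" "pen2 x = 6"
  using pen_le_0[of x] pen_01[of x] pen_ge_1[of x] by (metis less_eq_real_def not_le)

lemma pen1_nonneg: "0 \<le> pen1 x"
  by (cases x rule: pen_cases) auto

lemma pen2_bounds: "0 \<le> pen2 x" "pen2 x \<le> 6"
  by (cases x rule: pen_cases; simp)+

lemma pen2_lipschitz: "\<bar>pen2 b - pen2 a\<bar> \<le> 6 * \<bar>b - a\<bar>"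
  by (simp add: pen2_def max_def abs_if)

text \<open>These are the bounds 0 \<le> \<open>pen2\<close> \<le> 6 on the derivative of
  \<open>pen1\<close>, integrated by hand over the three branches.\<close>

lemma pen1_diff_bound:
  assumes "a \<le> b" shows "0 \<le> pen1 b - pen1 a" "pen1 b - pen1 a \<le> 6 * (b - a)"
proof -
  have sq: "b\<^sup>2 - a\<^sup>2 = (b - a) * (b + a)" by (simp add: power2_eq_square algebra_simps)
  have "0 \<le> pen1 b - pen1 a \<and> pen1 b - pen1 a \<le> 6 * (b - a)"
  proof (cases a rule: pen_cases)
    case 1
    show ?thesis
    proof (cases b rule: pen_cases)
      case 2
      have "3 * (b * b) \<le> 6 * (b - a)"
      proof -
        have "b * b \<le> b" using mult_left_le[of b b] 2(1,2) by simp
        then have "3 * (b * b) \<le> 6 * b" using 2(1) by auto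
        then show ?thesis using 1(1) by (simp add: algebra_simps)
      qed
      then show ?thesis unfolding 1 2 power2_eq_square by simp
    qed (use 1 assms in auto)
  next
    case 2
    show ?thesis
    proof (cases b rule: pen_cases)
      case b: 2
      have "(b - a) * (b + a) \<le> (b - a) * 2"
        by (rule mult_left_mono) (use 2 b assms in auto)
      moreover have "0 \<le> (b - a) * (b + a)" using 2 b assms by simp
      ultimately show ?thesis using 2 b sq by (simp add: power2_eq_square)
    next
      case b: 3
      have "0 \<le> (1 - a)\<^sup>2" by simp
      moreover have "a * a \<le> 1" using 2 by (simp add: mult_le_one)
      ultimately show ?thesis using 2 b by (simp add: power2_eq_square algebra_simps)
    qed (use 2 assms in auto)
  next
    case 3
    then show ?thesis
      by (cases b rule: pen_cases) (use assms in auto)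
  qed
  then show "0 \<le> pen1 b - pen1 a" "pen1 b - pen1 a \<le> 6 * (b - a)" by auto
qed

lemma pen1_mono: "a \<le> b \<Longrightarrow> pen1 a \<le> pen1 b"
  using pen1_diff_bound(1)[of a b] by simp

lemma pen1_lipschitz: "\<bar>pen1 b - pen1 a\<bar> \<le> 6 * \<bar>b - a\<bar>"
  using pen1_diff_bound[of a b] pen1_diff_bound[of b a] by (cases "a \<le> b") auto

lemma pen1_le: "pen1 x \<le> 6 * \<bar>x\<bar>"
  using pen1_lipschitz[of x 0] pen_le_0[of 0] by simp

lemma pen_nonneg: "0 \<le> pen x"
proof (cases x rule: pen_cases)
  case 3
  have "0 \<le> 3 * x * (x - 1)" using 3 by simp
  then show ?thesis unfolding 3 by (simp add: power2_eq_square algebra_simps)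
qed auto

lemma pen_le: "pen x \<le> 3 * x\<^sup>2"
proof (cases x rule: pen_cases)
  case 2
  have "x * x\<^sup>2 \<le> 1 * x\<^sup>2" by (rule mult_right_mono) (use 2 in auto)
  then have "x ^ 3 \<le> x\<^sup>2" by (simp add: power3_eq_cube power2_eq_square)
  moreover have "0 \<le> x\<^sup>2" by simp
  ultimately have "x ^ 3 \<le> 3 * x\<^sup>2" by linarith
  then show ?thesis using 2 by simp
qed auto

lemma pen_eq_0_iff: "pen x = 0 \<longleftrightarrow> x \<le> 0"
proof (cases x rule: pen_cases)
  case 3
  have "0 \<le> 3 * x * (x - 1)" using 3 by simp
  then have "1 \<le> pen x" unfolding 3 by (simp add: power2_eq_square algebra_simps)
  then show ?thesis using 3 by simp
qed auto

text \<open>The penalty is (x^+)^3 minus its shift by 1. The Taylor remainder of (x^+)^3 is at most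
  |b - a|^3, and there are two of them.\<close>

lemma pen_taylor_cubic: "\<bar>pen b - pen a - pen1 a * (b - a) - pen2 a / 2 * (b - a)\<^sup>2\<bar> \<le> 2 * \<bar>b - a\<bar> ^ 3"
proof -
  define R where "R a b = (max b 0) ^ 3 - (max a 0) ^ 3 - 3 * (max a 0)\<^sup>2 * (b - a) - 3 * max a 0 * (b - a)\<^sup>2"
    for a b :: real
  have R: "\<bar>R a b\<bar> \<le> \<bar>b - a\<bar> ^ 3" for a b
  proof -
    have cube: "\<bar>x\<bar> ^ 3 \<le> \<bar>y\<bar> ^ 3" if "\<bar>x\<bar> \<le> \<bar>y\<bar>" for x y :: real
      by (rule power_mono) (use that in auto)
    consider "a \<ge> 0" "b \<ge> 0" | "a \<ge> 0" "b < 0" | "a < 0" by linarith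
    then show ?thesis
    proof cases
      case 1
      then have "R a b = (b - a) ^ 3"
        by (simp add: R_def power2_eq_square power3_eq_cube algebra_simps)
      then show ?thesis by (simp add: power_abs)
    next
      case 2
      \<comment> \<open>The polynomial x^3 would leave the remainder (b - a)^3; replacing its value
        at the negative b by 0 adds |b|^3.\<close>
      then have "R a b = \<bar>b\<bar> ^ 3 - \<bar>b - a\<bar> ^ 3"
        by (simp add: R_def power2_eq_square power3_eq_cube algebra_simps)
      moreover have "\<bar>b\<bar> ^ 3 \<le> \<bar>b - a\<bar> ^ 3" by (rule cube) (use 2 in auto)
      moreover have "0 \<le> \<bar>b\<bar> ^ 3" by simp
      ultimately show ?thesis by linarith
    next
      case 3
      then have "R a b = (max b 0) ^ 3" by (simp add: R_def)
      also have "\<bar>\<dots>\<bar> = \<bar>max b 0\<bar> ^ 3" by (simp add: power_abs)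
      finally show ?thesis using cube[of "max b 0" "b - a"] 3 by (cases "b \<ge> 0") auto
    qed
  qed
  have "pen b - pen a - pen1 a * (b - a) - pen2 a / 2 * (b - a)\<^sup>2 = R a b - R (a - 1) (b - 1)"
    by (simp add: pen_def pen1_def pen2_def R_def field_simps)
  then show ?thesis using R[of a b] R[of "a - 1" "b - 1"] by simp
qed

text \<open>Convexity, verified branch by branch: the gap above the tangent is each time an explicit
  expression whose sign can be read off.\<close>

lemma pen_tangent: "pen a + pen1 a * (b - a) \<le> pen b"
proof (cases a rule: pen_cases)
  case 1
  then show ?thesis using pen_nonneg by simp
next
  case a: 2
  have a3: "0 \<le> a ^ 3" "a ^ 3 = a * a * a" using a by (auto simp: power3_eq_cube)
  show ?thesis
  proof (cases b rule: pen_cases)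
    case 1
    have "3 * a\<^sup>2 * b \<le> 0" using 1 by (simp add: mult_nonneg_nonpos)
    then show ?thesis using a 1 a3 by (simp add: power2_eq_square algebra_simps)
  next
    case 2
    have "0 \<le> (b - a)\<^sup>2 * (b + 2 * a)" using a 2 by simp
    then show ?thesis using a 2 by (simp add: power2_eq_square power3_eq_cube algebra_simps)
  next
    case 3
    have "a * a \<le> 1" using a by (simp add: mult_le_one)
    \<comment> \<open>The first summand is the gap at \<open>b = 1\<close>, the second its growth
      from 1 to b.\<close>
    then have "0 \<le> (1 - a)\<^sup>2 * (1 + 2 * a) + (b - 1) * (3 * b - 3 * (a * a))"
      using a 3 by (intro add_nonneg_nonneg mult_nonneg_nonneg) auto
    then show ?thesis using a 3 by (simp add: power2_eq_square power3_eq_cube algebra_simps)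
  qed
next
  case a: 3
  have sq: "1 \<le> a * a" using a by (simp add: mult_ge1_I)
  show ?thesis
  proof (cases b rule: pen_cases)
    case 1
    have "(6 * a - 3) * b \<le> 0" using 1 a by (simp add: mult_nonneg_nonpos)
    moreover have "(6 * a - 3) * b = 6 * (a * b) - 3 * b" by (simp add: algebra_simps)
    ultimately show ?thesis using sq unfolding a(2-4) 1(2-4) by (simp add: power2_eq_square algebra_simps)
  next
    case 2
    have "(1 - b)\<^sup>2 * (1 - b) \<le> (1 - b)\<^sup>2 * 1" by (rule mult_left_mono) (use 2 in auto)
    moreover have "(1 - b)\<^sup>2 \<le> (a - b)\<^sup>2" by (rule power_mono) (use a 2 in auto)
    moreover have "0 \<le> (a - b)\<^sup>2" "(1 - b) ^ 3 = (1 - b)\<^sup>2 * (1 - b)"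
      by (simp_all add: power3_eq_cube power2_eq_square)
    \<comment> \<open>On (0, 1) the cube equals the quadratic branch 3 b^2 - 3 b + 1 minus (1 -
      b)^3, and the quadratic branch lies above its tangent at a by 3 (a - b)^2.\<close>
    ultimately have "0 \<le> 3 * (a - b)\<^sup>2 - (1 - b) ^ 3" by linarith
    then show ?thesis unfolding a 2 by (simp add: power2_eq_square power3_eq_cube algebra_simps)
  next
    case 3
    have "0 \<le> 3 * (b - a)\<^sup>2" by simp
    then show ?thesis unfolding a 3 by (simp add: power2_eq_square algebra_simps)
  qed
qed

text \<open>For |d| \<le> 1 this is the cubic remainder. For larger d convexity suffices, because
  \<open>pen2\<close> \<le> 6 lets the subtracted 3 d^2 outweigh the second-order term. The
  truncation keeps the error quadratic in d, within reach of second moments.\<close>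

lemma pen_taylor:
  "pen a + pen1 a * d + pen2 a / 2 * d\<^sup>2 - 3 * (d\<^sup>2 * min 1 \<bar>d\<bar>) \<le> pen (a + d)"
proof (cases "\<bar>d\<bar> \<le> 1")
  case True
  have "2 * \<bar>d\<bar> ^ 3 \<le> 3 * (d\<^sup>2 * min 1 \<bar>d\<bar>)"
    using True mult_nonneg_nonneg[of "d * d" "\<bar>d\<bar>"]
    by (simp add: min_def power3_eq_cube power2_eq_square abs_mult mult.assoc)
  then show ?thesis using pen_taylor_cubic[of "a + d" a] by (simp add: abs_le_iff)
next
  case False
  have "pen2 a / 2 * d\<^sup>2 \<le> 3 * d\<^sup>2" by (rule mult_right_mono) (use pen2_bounds[of a] in auto)
  then show ?thesis using pen_tangent[of a "a + d"] False by (simp add: min_def)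
qed

text \<open>The tangents at a and at b enclose the difference, and \<open>pen1\<close> grows at most
  linearly. The bound serves to pass to L^2 limits in expectations of \<open>pen\<close>.\<close>

lemma pen_diff: "\<bar>pen b - pen a\<bar> \<le> 12 * \<bar>a\<bar> * \<bar>b - a\<bar> + 6 * (b - a)\<^sup>2"
proof -
  have t1: "\<bar>pen1 x * (b - a)\<bar> \<le> 6 * \<bar>x\<bar> * \<bar>b - a\<bar>" for x
    using mult_right_mono[OF pen1_le[of x], of "\<bar>b - a\<bar>"] pen1_nonneg[of x] by (simp add: abs_mult)
  have "\<bar>b\<bar> * \<bar>b - a\<bar> \<le> (\<bar>a\<bar> + \<bar>b - a\<bar>) * \<bar>b - a\<bar>" by (rule mult_right_mono) auto
  then have "\<bar>b\<bar> * \<bar>b - a\<bar> \<le> \<bar>a\<bar> * \<bar>b - a\<bar> + (b - a)\<^sup>2"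
    by (simp add: algebra_simps power2_eq_square)
  moreover have "0 \<le> \<bar>a\<bar> * \<bar>b - a\<bar>" "0 \<le> (b - a)\<^sup>2" by auto
  moreover have "pen1 b * (a - b) = - (pen1 b * (b - a))" by (simp add: algebra_simps)
  ultimately show ?thesis
    using pen_tangent[of a b] pen_tangent[of b a] t1[of a] t1[of b] by linarith
qed

text \<open>Completes the square in \<open>pen2 x * z\<close>; what is left over has the right sign
  because \<open>pen1\<^sup>2 \<le> 2 * pen * pen2\<close>. With C the Lipschitz constant and z the
  norm of the martingale integrand, this absorbs the Z-term.\<close>

lemma pen_young: "C * pen1 x * z \<le> pen2 x / 2 * z\<^sup>2 + C\<^sup>2 * pen x"
proof -
  have *: "(pen1 x)\<^sup>2 \<le> 2 * pen x * pen2 x"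
  proof (cases x rule: pen_cases)
    case 3
    have "0 \<le> x * (x - 1)" using 3 by simp
    then show ?thesis unfolding 3 by (simp add: power2_eq_square algebra_simps)
  qed (auto simp: power2_eq_square power3_eq_cube)
  show ?thesis
  proof (cases "x \<le> 0")
    case True
    then show ?thesis using pen_le_0[of x] by simp
  next
    case False
    then have p: "0 < pen2 x" by (cases x rule: pen_cases) auto
    have "0 \<le> (pen2 x * z - C * pen1 x)\<^sup>2 + C\<^sup>2 * (2 * pen x * pen2 x - (pen1 x)\<^sup>2)"
      using * by simp
    also have "\<dots> = 2 * pen2 x * (pen2 x / 2 * z\<^sup>2 + C\<^sup>2 * pen x - C * pen1 x * z)"
      by (simp add: power2_eq_square algebra_simps)
    finally show ?thesis using p by (simp add: zero_le_mult_iff)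
  qed
qed

lemma pen1_mult_self: "pen1 x * x \<le> 3 * pen x"
proof (cases x rule: pen_cases)
  case 3
  have "0 \<le> 3 * (x - 1)\<^sup>2" by simp
  then show ?thesis unfolding 3 by (simp add: power2_eq_square algebra_simps)
qed (auto simp: power2_eq_square power3_eq_cube)

lemma pen1_mult_abs: "pen1 x * \<bar>x\<bar> \<le> 3 * pen x"
  using pen1_mult_self[of x] pen_le_0[of x] by (cases "x \<le> 0") auto

text \<open>Since \<open>pen1\<close> is monotone, the smaller of x and y may be replaced by the
  larger, where \<open>pen1_mult_self\<close> applies. Later y is the positive part of the
  anticipated difference.\<close>

lemma pen1_mult: "0 \<le> y \<Longrightarrow> pen1 x * y \<le> 3 * pen x + 3 * pen y"
proof (cases "x \<le> y")
  case True
  assume "0 \<le> y"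
  then have "pen1 x * y \<le> pen1 y * y" by (intro mult_right_mono pen1_mono True)
  then show ?thesis using pen1_mult_self[of y] pen_nonneg[of x] by simp
next
  case False
  have "pen1 x * y \<le> pen1 x * x" using False by (intro mult_left_mono pen1_nonneg) auto
  then show ?thesis using pen1_mult_self[of x] pen_nonneg[of y] by simp
qed

lemma pen_measurable [measurable]:
  "pen \<in> borel_measurable borel" "pen1 \<in> borel_measurable borel" "pen2 \<in> borel_measurable borel"
  unfolding pen_def[abs_def] pen1_def[abs_def] pen2_def[abs_def] by measurable

section \<open>Real-variable lemmas\<close>

text \<open>After weighting by exp(-l (T - t)) the integral operator at least halves suprema, so the
  weighted supremum S satisfies S \<le> S/2. The hypothesis uses extended nonnegative integrals
  because condition (ii) delivers the estimate in that form.\<close>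

lemma gronwall_zero:
  fixes u :: "real \<Rightarrow> real"
  assumes u: "\<And>t. t \<in> {0..T} \<Longrightarrow> 0 \<le> u t \<and> u t \<le> B" and c: "0 \<le> c"
    and le: "\<And>t. t \<in> {0..T} \<Longrightarrow> ennreal (u t) \<le> ennreal c * (\<integral>\<^sup>+s\<in>{t..T}. ennreal (u s) \<partial>lborel)"
    and t: "t \<in> {0..T}"
  shows "u t = 0"
proof -
  \<comment> \<open>Any positive l with c / l \<le> 1/2 would do; adding 1 keeps l positive when c =
    0.\<close>
  define l where "l = 2 * c + 1"
  have l: "0 < l" "c \<le> l / 2" using c by (auto simp: l_def)
  define v where "v t = u t * exp (- (l * (T - t)))" for t
  define S where "S = (SUP t\<in>{0..T}. v t)"
  have bdd: "bdd_above (v ` {0..T})"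
  proof (rule bdd_aboveI2[where M = B])
    fix t assume t: "t \<in> {0..T}"
    have "u t * exp (- (l * (T - t))) \<le> u t * 1"
      using u[OF t] t l by (intro mult_left_mono) auto
    then show "v t \<le> B" using u[OF t] by (simp add: v_def)
  qed
  have vS: "v s \<le> S" if "s \<in> {0..T}" for s
    unfolding S_def using that bdd by (intro cSUP_upper)
  have uS: "u s \<le> S * exp (l * (T - s))" if "s \<in> {0..T}" for s
    using mult_right_mono[OF vS[OF that], of "exp (l * (T - s))"] by (simp add: v_def mult.assoc flip: exp_add)
  have v0: "0 \<le> v s" if "s \<in> {0..T}" for s using u[OF that] by (simp add: v_def)
  have S0: "0 \<le> S" using v0[OF t] vS[OF t] by simp
  have half: "v t \<le> S / 2" if t: "t \<in> {0..T}" for t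
  proof -
    have "(\<integral>\<^sup>+s\<in>{t..T}. ennreal (u s) \<partial>lborel)
        \<le> (\<integral>\<^sup>+s\<in>{t..T}. ennreal (S * exp (l * (T - s))) \<partial>lborel)"
    proof (rule nn_integral_mono)
      fix s
      show "ennreal (u s) * indicator {t..T} s \<le> ennreal (S * exp (l * (T - s))) * indicator {t..T} s"
        using uS[of s] t by (auto split: split_indicator intro!: ennreal_leI)
    qed
    also have "\<dots> = ennreal ((- S / l * exp (l * (T - T))) - (- S / l * exp (l * (T - t))))"
      by (rule nn_integral_FTC_Icc) (use l S0 t in \<open>auto intro!: derivative_eq_intros\<close>)
    finally have "ennreal (u t) \<le> ennreal c * ennreal ((- S / l * exp (l * (T - T))) - (- S / l * exp (l * (T - t))))"
      using le[OF t] by (meson mult_left_mono order_trans zero_le)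
    also have "\<dots> \<le> ennreal c * ennreal (S / l * exp (l * (T - t)))"
      using S0 l by (intro mult_left_mono ennreal_leI) auto
    also have "\<dots> = ennreal (c * (S / l * exp (l * (T - t))))"
      using c by (subst ennreal_mult') auto
    finally have "u t \<le> c * (S / l * exp (l * (T - t)))"
      using S0 l c by (subst (asm) ennreal_le_iff) auto
    also have "\<dots> \<le> l / 2 * (S / l * exp (l * (T - t)))"
      using l S0 by (intro mult_right_mono) auto
    also have "\<dots> = S / 2 * exp (l * (T - t))" using l by simp
    finally have "v t \<le> S / 2 * exp (l * (T - t)) * exp (- (l * (T - t)))"
      unfolding v_def by (rule mult_right_mono) auto
    then show ?thesis by (simp add: mult.assoc flip: exp_add)
  qed
  have "S \<le> S / 2" unfolding S_def by (rule cSUP_least) (use t half in \<open>auto simp: S_def\<close>)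
  then have "S = 0" using S0 by simp
  then have "v t = 0" using v0[OF t] vS[OF t] by simp
  then show ?thesis by (simp add: v_def)
qed

text \<open>All n equal pieces share the factor \<open>sqrt ((b - a) / n)\<close>, so the errors
  telescope in \<Gamma> and the factor tends to 0. The restriction to lengths at most 1 is met as
  soon as n \<ge> b - a.\<close>

lemma mono_of_small_error:
  fixes \<Phi> \<Gamma> :: "real \<Rightarrow> real"
  assumes le: "\<And>c d. a \<le> c \<Longrightarrow> c < d \<Longrightarrow> d \<le> b \<Longrightarrow> d - c \<le> 1 \<Longrightarrow>
      - (C * sqrt (d - c) * (\<Gamma> d - \<Gamma> c)) \<le> \<Phi> d - \<Phi> c"
    and ab: "a < b"
  shows "\<Phi> a \<le> \<Phi> b"
proof -
  have bound: "- (C * sqrt ((b - a) / n) * (\<Gamma> b - \<Gamma> a)) \<le> \<Phi> b - \<Phi> a"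
    if n: "b - a \<le> real n" for n
  proof -
    define r where "r = (b - a) / n"
    define p where "p i = a + r * real i" for i
    have n0: "0 < real n" using n ab by linarith
    have r: "0 < r" "r \<le> 1" using n n0 ab by (auto simp: r_def)
    have pn: "p n = b" "p 0 = a" using n0 by (auto simp: p_def r_def)
    have "(\<Sum>i<n. - (C * sqrt r * (\<Gamma> (p (Suc i)) - \<Gamma> (p i)))) \<le> (\<Sum>i<n. \<Phi> (p (Suc i)) - \<Phi> (p i))"
    proof (rule sum_mono)
      fix i assume "i \<in> {..<n}"
      then have "r * real (Suc i) \<le> r * real n" using r by (intro mult_left_mono) auto
      then have "p (Suc i) \<le> b" using pn by (simp add: p_def)
      moreover have "p (Suc i) - p i = r" by (simp add: p_def algebra_simps)
      ultimately show "- (C * sqrt r * (\<Gamma> (p (Suc i)) - \<Gamma> (p i))) \<le> \<Phi> (p (Suc i)) - \<Phi> (p i)"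
        using le[of "p i" "p (Suc i)"] r by (auto simp: p_def algebra_simps)
    qed
    also have "(\<Sum>i<n. \<Phi> (p (Suc i)) - \<Phi> (p i)) = \<Phi> b - \<Phi> a"
      by (subst sum_lessThan_telescope[of "\<lambda>i. \<Phi> (p i)"]) (simp add: pn)
    also have "(\<Sum>i<n. - (C * sqrt r * (\<Gamma> (p (Suc i)) - \<Gamma> (p i)))) = - (C * sqrt r * (\<Gamma> b - \<Gamma> a))"
      by (simp add: sum_negf sum_lessThan_telescope[of "\<lambda>i. \<Gamma> (p i)"] pn flip: sum_distrib_left)
    finally show ?thesis by (simp add: r_def)
  qed
  have "(\<lambda>n. - (C * sqrt ((b - a) / real n) * (\<Gamma> b - \<Gamma> a))) \<longlonglongrightarrow> - (C * sqrt 0 * (\<Gamma> b - \<Gamma> a))"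
    by (intro tendsto_intros real_tendsto_divide_at_top[OF tendsto_const] filterlim_real_sequentially)
  moreover have "\<forall>\<^sub>F n in sequentially. - (C * sqrt ((b - a) / real n) * (\<Gamma> b - \<Gamma> a)) \<le> \<Phi> b - \<Phi> a"
    using eventually_ge_at_top[of "nat \<lceil>b - a\<rceil>"] by eventually_elim (intro bound, linarith)
  ultimately have "- (C * sqrt 0 * (\<Gamma> b - \<Gamma> a)) \<le> \<Phi> b - \<Phi> a"
    by (rule tendsto_upperbound) simp
  then show ?thesis by simp
qed

text \<open>Induction on the breakpoints with the end points left general: an interval with the new
  breakpoint inside is cut there, and each half has fewer breakpoints.\<close>

lemma mono_through_breakpoints:
  fixes \<Phi> :: "real \<Rightarrow> real"
  assumes "finite P" "a \<le> b"
    and step: "\<And>c d. a \<le> c \<Longrightarrow> c < d \<Longrightarrow> d \<le> b \<Longrightarrow> P \<inter> {c<..<d} = {} \<Longrightarrow> \<Phi> c \<le> \<Phi> d"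
  shows "\<Phi> a \<le> \<Phi> b"
  using assms
proof (induction P arbitrary: a b rule: finite_induct)
  case empty
  then show ?case by (cases "a = b") (auto intro: empty.prems(2))
next
  case (insert p P)
  have "\<Phi> c \<le> \<Phi> d" if *: "a \<le> c" "c < d" "d \<le> b" "P \<inter> {c<..<d} = {}" for c d
  proof (cases "p \<in> {c<..<d}")
    case True
    then have "\<Phi> c \<le> \<Phi> p" "\<Phi> p \<le> \<Phi> d" using * by (auto intro!: insert.prems(2))
    then show ?thesis by simp
  next
    case False
    then show ?thesis using * by (auto intro!: insert.prems(2))
  qed
  then show ?case using insert.IH[of a b] insert.prems(1) by blast
qed

section \<open>Square-integrable functions\<close>

definition square_integrable :: "'b measure \<Rightarrow> ('b \<Rightarrow> real) \<Rightarrow> bool" where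
  "square_integrable N f \<longleftrightarrow> f \<in> borel_measurable N \<and> integrable N (\<lambda>x. (f x)\<^sup>2)"

lemma square_integrable_measurable [measurable_dest]:
  "square_integrable N f \<Longrightarrow> f \<in> borel_measurable N"
  by (simp add: square_integrable_def)

lemma square_integrableD: "square_integrable N f \<Longrightarrow> integrable N (\<lambda>x. (f x)\<^sup>2)"
  by (simp add: square_integrable_def)

lemma square_integrable_bound:
  assumes "square_integrable N g" "f \<in> borel_measurable N" "AE x in N. \<bar>f x\<bar> \<le> \<bar>g x\<bar>"
  shows "square_integrable N f"
proof -
  have "integrable N (\<lambda>x. (f x)\<^sup>2)"
  proof (rule Bochner_Integration.integrable_bound)
    show "integrable N (\<lambda>x. (g x)\<^sup>2)" using assms(1) by (rule square_integrableD)
    show "AE x in N. norm ((f x)\<^sup>2) \<le> norm ((g x)\<^sup>2)"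
      using assms(3) by eventually_elim (simp add: abs_le_square_iff)
  qed (use assms in measurable)
  then show ?thesis using assms(2) by (simp add: square_integrable_def)
qed

lemma integrable_mult_square_integrable:
  assumes "square_integrable N f" "square_integrable N g"
  shows "integrable N (\<lambda>x. f x * g x)"
proof (rule Bochner_Integration.integrable_bound)
  show "integrable N (\<lambda>x. (f x)\<^sup>2 + (g x)\<^sup>2)"
    using assms by (intro Bochner_Integration.integrable_add square_integrableD)
  have "\<bar>a * b\<bar> \<le> a\<^sup>2 + b\<^sup>2" for a b :: real
  proof -
    have "2 * (\<bar>a\<bar> * \<bar>b\<bar>) \<le> \<bar>a\<bar>\<^sup>2 + \<bar>b\<bar>\<^sup>2" using sum_squares_bound[of "\<bar>a\<bar>" "\<bar>b\<bar>"] by simp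
    moreover have "0 \<le> \<bar>a * b\<bar>" by simp
    ultimately show ?thesis unfolding abs_mult power2_abs by linarith
  qed
  then show "AE x in N. norm (f x * g x) \<le> norm ((f x)\<^sup>2 + (g x)\<^sup>2)" by simp
qed (use assms in measurable)

lemma square_integrable_add:
  assumes "square_integrable N f" "square_integrable N g"
  shows "square_integrable N (\<lambda>x. f x + g x)"
  unfolding square_integrable_def power2_sum
  using assms integrable_mult_square_integrable[OF assms]
  by (auto simp: square_integrable_def mult.assoc)

lemma square_integrable_cmult: "square_integrable N f \<Longrightarrow> square_integrable N (\<lambda>x. c * f x)"
  by (auto simp: square_integrable_def power_mult_distrib)

lemma square_integrable_uminus: "square_integrable N f \<Longrightarrow> square_integrable N (\<lambda>x. - f x)"
  by (auto simp: square_integrable_def)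

lemma square_integrable_diff:
  "square_integrable N f \<Longrightarrow> square_integrable N g \<Longrightarrow> square_integrable N (\<lambda>x. f x - g x)"
  using square_integrable_add[of N f "\<lambda>x. - g x"] by (simp add: square_integrable_uminus)

lemma square_integrable_abs: "square_integrable N f \<Longrightarrow> square_integrable N (\<lambda>x. \<bar>f x\<bar>)"
  by (auto simp: square_integrable_def)

lemma square_integrable_zero [simp]: "square_integrable N (\<lambda>x. 0)"
  by (simp add: square_integrable_def)

lemma (in finite_measure) square_integrable_const: "square_integrable M (\<lambda>x. c)"
  by (simp add: square_integrable_def)

lemma (in finite_measure) square_integrable_integrable:
  "square_integrable M f \<Longrightarrow> integrable M f"
  using integrable_mult_square_integrable[OF _ square_integrable_const[of 1], of f] by simp

lemma (in finite_measure) square_integrable_bounded: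
  assumes "f \<in> borel_measurable M" "AE x in M. \<bar>f x\<bar> \<le> B"
  shows "square_integrable M f"
proof (rule square_integrable_bound[OF square_integrable_const])
  show "AE x in M. \<bar>f x\<bar> \<le> \<bar>B\<bar>" using assms(2) by eventually_elim simp
qed fact

text \<open>Cauchy-Schwarz, from the quadratic a - 2 l c + l^2 b in l, which is nonnegative as the
  integral of (f - l g)^2.\<close>

lemma integral_mult_bound:
  assumes "square_integrable N f" "square_integrable N g"
  shows "\<bar>\<integral>x. f x * g x \<partial>N\<bar> \<le> sqrt (\<integral>x. (f x)\<^sup>2 \<partial>N) * sqrt (\<integral>x. (g x)\<^sup>2 \<partial>N)"
proof -
  define a b c where "a = (\<integral>x. (f x)\<^sup>2 \<partial>N)" and "b = (\<integral>x. (g x)\<^sup>2 \<partial>N)" and "c = (\<integral>x. f x * g x \<partial>N)"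
  note i = square_integrableD[OF assms(1)] square_integrableD[OF assms(2)]
    integrable_mult_square_integrable[OF assms]
  have a0: "0 \<le> a" and b0: "0 \<le> b" by (simp_all add: a_def b_def)
  have quad: "0 \<le> a - 2 * l * c + l\<^sup>2 * b" for l
  proof -
    have "0 \<le> (\<integral>x. (f x - l * g x)\<^sup>2 \<partial>N)" by simp
    also have "(\<lambda>x. (f x - l * g x)\<^sup>2) = (\<lambda>x. (f x)\<^sup>2 - (2 * l) * (f x * g x) + l\<^sup>2 * (g x)\<^sup>2)"
      by (simp add: power2_eq_square algebra_simps)
    also have "(\<integral>x. \<dots> x \<partial>N) = a - 2 * l * c + l\<^sup>2 * b"
      using i by (simp add: a_def b_def c_def)
    finally show ?thesis .
  qed
  have "c\<^sup>2 \<le> a * b"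
  proof (cases "b = 0")
    case True
    have "c = 0"
    proof (rule ccontr)
      assume "c \<noteq> 0"
      \<comment> \<open>With b = 0 this choice of l gives the quadratic the value -1.\<close>
      then show False using quad[of "(a + 1) / (2 * c)"] True by simp
    qed
    then show ?thesis using True by simp
  next
    case False
    then have "0 < b" using b0 by simp
    then show ?thesis using quad[of "c / b"] by (simp add: power2_eq_square field_simps)
  qed
  then have "sqrt (c\<^sup>2) \<le> sqrt (a * b)" by (rule real_sqrt_le_mono)
  then show ?thesis by (simp add: a_def b_def c_def real_sqrt_mult)
qed

definition L2_tendsto :: "'b measure \<Rightarrow> (nat \<Rightarrow> 'b \<Rightarrow> real) \<Rightarrow> ('b \<Rightarrow> real) \<Rightarrow> bool" where
  "L2_tendsto N fs f \<longleftrightarrow> (\<forall>k. square_integrable N (fs k)) \<and> square_integrable N f \<and>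
     (\<lambda>k. \<integral>x. (fs k x - f x)\<^sup>2 \<partial>N) \<longlonglongrightarrow> 0"

lemma L2_tendsto_const: "square_integrable N f \<Longrightarrow> L2_tendsto N (\<lambda>_. f) f"
  by (simp add: L2_tendsto_def)

text \<open>Carries convergence over to Lipschitz images, here \<open>pen1\<close> and norms of
  vector-valued integrands.\<close>

lemma L2_tendsto_dominated:
  assumes fs: "L2_tendsto N fs f" and g: "square_integrable N g" and gs: "\<And>k. gs k \<in> borel_measurable N"
    and le: "\<And>k. AE x in N. \<bar>gs k x - g x\<bar> \<le> c * \<bar>fs k x - f x\<bar>"
  shows "L2_tendsto N gs g"
proof -
  have d: "square_integrable N (\<lambda>x. c * (fs k x - f x))" for k
    using fs by (intro square_integrable_cmult square_integrable_diff) (auto simp: L2_tendsto_def)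
  have dg: "square_integrable N (\<lambda>x. gs k x - g x)" for k
  proof (rule square_integrable_bound[OF d])
    show "AE x in N. \<bar>gs k x - g x\<bar> \<le> \<bar>c * (fs k x - f x)\<bar>"
      using le[of k] by eventually_elim (rule order_trans, assumption, auto simp: abs_mult intro: mult_right_mono)
  qed (use g gs[of k] in measurable)
  have "square_integrable N (gs k)" for k
    using square_integrable_add[OF dg[of k] g] by simp
  moreover have "(\<lambda>k. \<integral>x. (gs k x - g x)\<^sup>2 \<partial>N) \<longlonglongrightarrow> 0"
  proof (rule tendsto_sandwich[OF _ _ tendsto_const])
    have "(\<lambda>k. c\<^sup>2 * (\<integral>x. (fs k x - f x)\<^sup>2 \<partial>N)) \<longlonglongrightarrow> c\<^sup>2 * 0"
      using fs by (intro tendsto_intros) (simp add: L2_tendsto_def)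
    then show "(\<lambda>k. \<integral>x. (c * (fs k x - f x))\<^sup>2 \<partial>N) \<longlonglongrightarrow> 0" by (simp add: power_mult_distrib)
    show "\<forall>\<^sub>F k in sequentially. (\<integral>x. (gs k x - g x)\<^sup>2 \<partial>N) \<le> (\<integral>x. (c * (fs k x - f x))\<^sup>2 \<partial>N)"
    proof (rule eventuallyI, rule integral_mono_AE)
      fix k
      show "integrable N (\<lambda>x. (gs k x - g x)\<^sup>2)" "integrable N (\<lambda>x. (c * (fs k x - f x))\<^sup>2)"
        by (intro square_integrableD d dg)+
      show "AE x in N. (gs k x - g x)\<^sup>2 \<le> (c * (fs k x - f x))\<^sup>2"
        using le[of k]
      proof eventually_elim
        case (elim x)
        then have "\<bar>gs k x - g x\<bar> \<le> \<bar>c * (fs k x - f x)\<bar>"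
          by (rule order_trans) (auto simp: abs_mult intro: mult_right_mono)
        then show ?case by (simp add: abs_le_square_iff)
      qed
    qed
  qed (simp add: eventuallyI)
  ultimately show ?thesis using g by (simp add: L2_tendsto_def)
qed

lemma L2_tendsto_diff:
  assumes "L2_tendsto N fs f" "L2_tendsto N gs g"
  shows "L2_tendsto N (\<lambda>k x. fs k x - gs k x) (\<lambda>x. f x - g x)"
proof -
  have d: "square_integrable N (\<lambda>x. fs k x - f x)" "square_integrable N (\<lambda>x. gs k x - g x)" for k
    using assms by (auto simp: L2_tendsto_def intro: square_integrable_diff)
  have "(\<lambda>k. \<integral>x. (fs k x - gs k x - (f x - g x))\<^sup>2 \<partial>N) \<longlonglongrightarrow> 0"
  proof (rule tendsto_sandwich[OF _ _ tendsto_const])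
    have "(\<lambda>k. 2 * (\<integral>x. (fs k x - f x)\<^sup>2 \<partial>N) + 2 * (\<integral>x. (gs k x - g x)\<^sup>2 \<partial>N)) \<longlonglongrightarrow> 2 * 0 + 2 * 0"
      using assms by (intro tendsto_intros) (simp_all add: L2_tendsto_def)
    then show "(\<lambda>k. \<integral>x. 2 * (fs k x - f x)\<^sup>2 + 2 * (gs k x - g x)\<^sup>2 \<partial>N) \<longlonglongrightarrow> 0"
      using d[THEN square_integrableD] by simp
    show "\<forall>\<^sub>F k in sequentially. (\<integral>x. (fs k x - gs k x - (f x - g x))\<^sup>2 \<partial>N)
        \<le> (\<integral>x. 2 * (fs k x - f x)\<^sup>2 + 2 * (gs k x - g x)\<^sup>2 \<partial>N)"
    proof (intro always_eventually allI integral_mono)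
      fix k
      have "square_integrable N (\<lambda>x. fs k x - f x - (gs k x - g x))"
        by (intro square_integrable_diff d)
      then show "integrable N (\<lambda>x. (fs k x - gs k x - (f x - g x))\<^sup>2)"
        by (simp add: square_integrable_def algebra_simps)
      show "integrable N (\<lambda>x. 2 * (fs k x - f x)\<^sup>2 + 2 * (gs k x - g x)\<^sup>2)"
        using d[of k, THEN square_integrableD] by simp
      fix x
      have "0 \<le> ((fs k x - f x) + (gs k x - g x))\<^sup>2" by simp
      then show "(fs k x - gs k x - (f x - g x))\<^sup>2 \<le> 2 * (fs k x - f x)\<^sup>2 + 2 * (gs k x - g x)\<^sup>2"
        by (simp add: power2_eq_square algebra_simps)
    qed
  qed (simp add: eventuallyI)
  then show ?thesis using assms by (auto simp: L2_tendsto_def intro: square_integrable_diff)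
qed

lemma L2_tendsto_bounded:
  assumes "L2_tendsto N fs f"
  obtains B where "\<And>k. (\<integral>x. (fs k x)\<^sup>2 \<partial>N) \<le> B"
proof -
  have f: "square_integrable N f" and d: "square_integrable N (\<lambda>x. fs k x - f x)"
    and fk: "square_integrable N (fs k)" for k
    using assms by (auto simp: L2_tendsto_def intro: square_integrable_diff)
  have "Bseq (\<lambda>k. \<integral>x. (fs k x - f x)\<^sup>2 \<partial>N)"
    using assms by (auto simp: L2_tendsto_def intro: convergent_imp_Bseq convergentI)
  then obtain B where B: "\<And>k. norm (\<integral>x. (fs k x - f x)\<^sup>2 \<partial>N) \<le> B"
    by (elim BseqE) blast
  have "(\<integral>x. (fs k x)\<^sup>2 \<partial>N) \<le> 2 * B + 2 * (\<integral>x. (f x)\<^sup>2 \<partial>N)" for k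
  proof -
    have "(\<integral>x. (fs k x)\<^sup>2 \<partial>N) \<le> (\<integral>x. 2 * (fs k x - f x)\<^sup>2 + 2 * (f x)\<^sup>2 \<partial>N)"
    proof (rule integral_mono)
      fix x
      have "0 \<le> ((fs k x - f x) - f x)\<^sup>2" by simp
      then show "(fs k x)\<^sup>2 \<le> 2 * (fs k x - f x)\<^sup>2 + 2 * (f x)\<^sup>2"
        by (simp add: power2_eq_square algebra_simps)
    qed (use d[of k] f fk[of k] in \<open>simp_all add: square_integrableD\<close>)
    also have "\<dots> = 2 * (\<integral>x. (fs k x - f x)\<^sup>2 \<partial>N) + 2 * (\<integral>x. (f x)\<^sup>2 \<partial>N)"
      using d[of k] f by (simp add: square_integrableD)
    finally show ?thesis using B[of k] by simp
  qed
  then show thesis by (rule that)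
qed

text \<open>The difference of the products is (fs - f) gs + f (gs - g). Cauchy-Schwarz treats both
  terms, the first with the help of a uniform bound on the second moments of gs.\<close>

lemma integral_mult_tendsto:
  assumes "L2_tendsto N fs f" "L2_tendsto N gs g"
  shows "(\<lambda>k. \<integral>x. fs k x * gs k x \<partial>N) \<longlonglongrightarrow> (\<integral>x. f x * g x \<partial>N)"
proof -
  obtain B where B: "\<And>k. (\<integral>x. (gs k x)\<^sup>2 \<partial>N) \<le> B" using L2_tendsto_bounded[OF assms(2)] by blast
  have s: "square_integrable N f" "square_integrable N g" "\<And>k. square_integrable N (fs k)"
    "\<And>k. square_integrable N (gs k)" "\<And>k. square_integrable N (\<lambda>x. fs k x - f x)"
    "\<And>k. square_integrable N (\<lambda>x. gs k x - g x)"
    using assms by (auto simp: L2_tendsto_def intro: square_integrable_diff)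
  note m = integrable_mult_square_integrable
  define \<alpha> \<beta> where "\<alpha> k = (\<integral>x. (fs k x - f x)\<^sup>2 \<partial>N)" and "\<beta> k = (\<integral>x. (gs k x - g x)\<^sup>2 \<partial>N)" for k
  have "(\<lambda>k. (\<integral>x. fs k x * gs k x \<partial>N) - (\<integral>x. f x * g x \<partial>N)) \<longlonglongrightarrow> 0"
  proof (rule Lim_null_comparison)
    show "\<forall>\<^sub>F k in sequentially. norm ((\<integral>x. fs k x * gs k x \<partial>N) - (\<integral>x. f x * g x \<partial>N))
        \<le> sqrt (\<alpha> k) * sqrt B + sqrt (\<integral>x. (f x)\<^sup>2 \<partial>N) * sqrt (\<beta> k)"
    proof (intro always_eventually allI)
      fix k
      have "(\<integral>x. fs k x * gs k x \<partial>N) - (\<integral>x. f x * g x \<partial>N)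
          = (\<integral>x. fs k x * gs k x - f x * g x \<partial>N)"
        using s by (simp add: m)
      also have "(\<lambda>x. fs k x * gs k x - f x * g x) = (\<lambda>x. (fs k x - f x) * gs k x + f x * (gs k x - g x))"
        by (simp add: algebra_simps)
      also have "(\<integral>x. \<dots> x \<partial>N) = (\<integral>x. (fs k x - f x) * gs k x \<partial>N) + (\<integral>x. f x * (gs k x - g x) \<partial>N)"
        using s by (intro Bochner_Integration.integral_add m)
      finally have eq: "(\<integral>x. fs k x * gs k x \<partial>N) - (\<integral>x. f x * g x \<partial>N)
        = (\<integral>x. (fs k x - f x) * gs k x \<partial>N) + (\<integral>x. f x * (gs k x - g x) \<partial>N)" .
      have "\<bar>\<integral>x. (fs k x - f x) * gs k x \<partial>N\<bar> \<le> sqrt (\<alpha> k) * sqrt (\<integral>x. (gs k x)\<^sup>2 \<partial>N)"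
        unfolding \<alpha>_def by (rule integral_mult_bound) (use s in auto)
      also have "\<dots> \<le> sqrt (\<alpha> k) * sqrt B"
        using B[of k] by (intro mult_left_mono) (auto simp: \<alpha>_def)
      finally have 1: "\<bar>\<integral>x. (fs k x - f x) * gs k x \<partial>N\<bar> \<le> sqrt (\<alpha> k) * sqrt B" .
      have 2: "\<bar>\<integral>x. f x * (gs k x - g x) \<partial>N\<bar> \<le> sqrt (\<integral>x. (f x)\<^sup>2 \<partial>N) * sqrt (\<beta> k)"
        unfolding \<beta>_def by (rule integral_mult_bound) (use s in auto)
      show "norm ((\<integral>x. fs k x * gs k x \<partial>N) - (\<integral>x. f x * g x \<partial>N))
        \<le> sqrt (\<alpha> k) * sqrt B + sqrt (\<integral>x. (f x)\<^sup>2 \<partial>N) * sqrt (\<beta> k)"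
        using 1 2 unfolding eq by simp
    qed
    have "(\<lambda>k. sqrt (\<alpha> k) * sqrt B + sqrt (\<integral>x. (f x)\<^sup>2 \<partial>N) * sqrt (\<beta> k))
      \<longlonglongrightarrow> sqrt 0 * sqrt B + sqrt (\<integral>x. (f x)\<^sup>2 \<partial>N) * sqrt 0"
      using assms by (intro tendsto_intros) (simp_all add: L2_tendsto_def \<alpha>_def \<beta>_def)
    then show "(\<lambda>k. sqrt (\<alpha> k) * sqrt B + sqrt (\<integral>x. (f x)\<^sup>2 \<partial>N) * sqrt (\<beta> k)) \<longlonglongrightarrow> 0" by simp
  qed
  then show ?thesis by (simp add: LIM_zero_cancel)
qed

lemma square_integrable_pen1:
  "square_integrable N f \<Longrightarrow> square_integrable N (\<lambda>x. pen1 (f x))"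
  by (rule square_integrable_bound[OF square_integrable_cmult[of N f 6]])
     (auto simp: abs_mult pen1_nonneg pen1_le)

lemma integrable_pen:
  assumes "square_integrable N f" shows "integrable N (\<lambda>x. pen (f x))"
  by (rule Bochner_Integration.integrable_bound[of N "\<lambda>x. 3 * (f x)\<^sup>2"])
     (use assms in \<open>auto simp: pen_nonneg pen_le dest: square_integrableD\<close>)

lemma L2_tendsto_pen1:
  assumes "L2_tendsto N fs f" shows "L2_tendsto N (\<lambda>k x. pen1 (fs k x)) (\<lambda>x. pen1 (f x))"
proof (rule L2_tendsto_dominated[OF assms, where c = 6])
  show "square_integrable N (\<lambda>x. pen1 (f x))"
    using assms by (auto simp: L2_tendsto_def intro: square_integrable_pen1)
  have [measurable]: "fs k \<in> borel_measurable N" for k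
    using assms by (auto simp: L2_tendsto_def square_integrable_def)
  show "(\<lambda>x. pen1 (fs k x)) \<in> borel_measurable N" for k by measurable
qed (use pen1_lipschitz in auto)

lemma integral_pen_tendsto:
  assumes "L2_tendsto N fs f"
  shows "(\<lambda>k. \<integral>x. pen (fs k x) \<partial>N) \<longlonglongrightarrow> (\<integral>x. pen (f x) \<partial>N)"
proof -
  have s: "square_integrable N f" "\<And>k. square_integrable N (fs k)"
    "\<And>k. square_integrable N (\<lambda>x. fs k x - f x)"
    using assms by (auto simp: L2_tendsto_def intro: square_integrable_diff)
  have d: "L2_tendsto N (\<lambda>k x. \<bar>fs k x - f x\<bar>) (\<lambda>x. 0)"
    using assms s by (auto simp: L2_tendsto_def intro: square_integrable_abs)
  have i: "integrable N (\<lambda>x. \<bar>f x\<bar> * \<bar>fs k x - f x\<bar>)" "integrable N (\<lambda>x. (fs k x - f x)\<^sup>2)" for k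
    using s by (auto intro!: integrable_mult_square_integrable square_integrable_abs dest: square_integrableD)
  have "(\<lambda>k. (\<integral>x. pen (fs k x) \<partial>N) - (\<integral>x. pen (f x) \<partial>N)) \<longlonglongrightarrow> 0"
  proof (rule Lim_null_comparison)
    have "(\<lambda>k. 12 * (\<integral>x. \<bar>f x\<bar> * \<bar>fs k x - f x\<bar> \<partial>N) + 6 * (\<integral>x. (fs k x - f x)\<^sup>2 \<partial>N))
      \<longlonglongrightarrow> 12 * (\<integral>x. \<bar>f x\<bar> * 0 \<partial>N) + 6 * 0"
      using assms by (intro tendsto_intros integral_mult_tendsto L2_tendsto_const square_integrable_abs s d)
         (simp add: L2_tendsto_def)
    then show "(\<lambda>k. 12 * (\<integral>x. \<bar>f x\<bar> * \<bar>fs k x - f x\<bar> \<partial>N) + 6 * (\<integral>x. (fs k x - f x)\<^sup>2 \<partial>N)) \<longlonglongrightarrow> 0"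
      by simp
    show "\<forall>\<^sub>F k in sequentially. norm ((\<integral>x. pen (fs k x) \<partial>N) - (\<integral>x. pen (f x) \<partial>N))
        \<le> 12 * (\<integral>x. \<bar>f x\<bar> * \<bar>fs k x - f x\<bar> \<partial>N) + 6 * (\<integral>x. (fs k x - f x)\<^sup>2 \<partial>N)"
    proof (intro always_eventually allI)
      fix k
      have "norm ((\<integral>x. pen (fs k x) \<partial>N) - (\<integral>x. pen (f x) \<partial>N)) = norm (\<integral>x. pen (fs k x) - pen (f x) \<partial>N)"
        using s by (simp add: integrable_pen)
      also have "\<dots> \<le> (\<integral>x. norm (pen (fs k x) - pen (f x)) \<partial>N)" by (rule integral_norm_bound)
      also have "\<dots> \<le> (\<integral>x. 12 * (\<bar>f x\<bar> * \<bar>fs k x - f x\<bar>) + 6 * (fs k x - f x)\<^sup>2 \<partial>N)"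
        using s i pen_diff by (intro integral_mono) (auto simp: integrable_pen mult.assoc)
      also have "\<dots> = 12 * (\<integral>x. \<bar>f x\<bar> * \<bar>fs k x - f x\<bar> \<partial>N) + 6 * (\<integral>x. (fs k x - f x)\<^sup>2 \<partial>N)"
        using i by simp
      finally show "norm ((\<integral>x. pen (fs k x) \<partial>N) - (\<integral>x. pen (f x) \<partial>N))
        \<le> 12 * (\<integral>x. \<bar>f x\<bar> * \<bar>fs k x - f x\<bar> \<partial>N) + 6 * (\<integral>x. (fs k x - f x)\<^sup>2 \<partial>N)" .
    qed
  qed
  then show ?thesis by (simp add: LIM_zero_cancel)
qed

section \<open>Processes on a time interval\<close>

abbreviation lborel_Icc :: "real \<Rightarrow> real \<Rightarrow> real measure" where
  "lborel_Icc a b \<equiv> restrict_space lborel {a..b}"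

text \<open>Time is cut down to the interval so that the product measure is finite and square
  integrability implies integrability.\<close>

definition time_space :: "'a measure \<Rightarrow> real \<Rightarrow> real \<Rightarrow> (real \<times> 'a) measure" where
  "time_space M a b = lborel_Icc a b \<Otimes>\<^sub>M M"

lemma space_time_space: "space (time_space M a b) = {a..b} \<times> space M"
  by (simp add: time_space_def space_pair_measure)

lemma sets_time_space [measurable_cong]:
  "sets (time_space M a b) = sets (restrict_space borel {a..b} \<Otimes>\<^sub>M M)"
  unfolding time_space_def by (intro sets_pair_measure_cong sets_restrict_space_cong) auto

lemma finite_measure_lborel_Icc: "finite_measure (lborel_Icc a b)"
  by (rule finite_measureI, cases "a \<le> b") (auto simp: emeasure_restrict_space space_restrict_space)

lemma integral_lborel_Icc:
  fixes f :: "real \<Rightarrow> real"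
  shows "integral\<^sup>L (lborel_Icc a b) f = (LINT s:{a..b}|lborel. f s)"
  by (simp add: integral_restrict_space set_lebesgue_integral_def)

lemma integrable_lborel_Icc:
  fixes f :: "real \<Rightarrow> real"
  shows "integrable (lborel_Icc a b) f \<longleftrightarrow> set_integrable lborel {a..b} f"
  by (simp add: integrable_restrict_space set_integrable_def)

lemma AE_lborel_Icc: "(AE s in lborel_Icc a b. P s) \<longleftrightarrow> (AE s in lborel. s \<in> {a..b} \<longrightarrow> P s)"
  by (simp add: AE_restrict_space_iff)

lemma measurable_time_space_mono:
  assumes "f \<in> borel_measurable (time_space M a b)" "a \<le> c" "d \<le> b"
  shows "f \<in> borel_measurable (time_space M c d)"
proof -
  have 1: "(\<lambda>s. s) \<in> measurable (lborel_Icc c d) (lborel_Icc a b)"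
    by (rule measurable_restrict_space3) (use assms in auto)
  have "(\<lambda>x. (fst x, snd x)) \<in> measurable (time_space M c d) (time_space M a b)"
    unfolding time_space_def
    by (intro measurable_Pair measurable_snd measurable_compose[OF measurable_fst 1])
  from measurable_compose[OF this assms(1)] show ?thesis by simp
qed

lemma measurable_time_space_restrict:
  assumes "case_prod f \<in> borel_measurable (borel \<Otimes>\<^sub>M M)"
  shows "case_prod f \<in> borel_measurable (time_space M a b)"
proof -
  have 1: "(\<lambda>s. s) \<in> measurable (lborel_Icc a b) borel"
    by (rule measurable_restrict_space1) auto
  have "(\<lambda>x. (fst x, snd x)) \<in> measurable (time_space M a b) (borel \<Otimes>\<^sub>M M)"
    unfolding time_space_def
    by (intro measurable_Pair measurable_snd measurable_compose[OF measurable_fst 1])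
  from measurable_compose[OF this assms] show ?thesis by simp
qed

lemma set_integral_Icc_split:
  fixes f :: "real \<Rightarrow> real"
  assumes "set_integrable lborel {a..c} f" "a \<le> b" "b \<le> c"
  shows "(LINT s:{a..c}|lborel. f s) = (LINT s:{a..b}|lborel. f s) + (LINT s:{b..c}|lborel. f s)"
proof -
  have "(LINT s:{a..c}|lborel. f s) = (LINT s:{a..<b} \<union> {b..c}|lborel. f s)"
    using assms by (simp add: ivl_disj_un)
  also have "\<dots> = (LINT s:{a..<b}|lborel. f s) + (LINT s:{b..c}|lborel. f s)"
    using assms by (intro set_integral_Un set_integrable_subset[OF assms(1)]) auto
  also have "(LINT s:{a..<b}|lborel. f s) = (LINT s:{a..b}|lborel. f s)"
  proof -
    have "set_integrable lborel {a..<b} f" "set_integrable lborel {a..b} f"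
      using assms by (auto intro!: set_integrable_subset[OF assms(1)])
    moreover have "AE s in lborel. indicator {a..<b} s *\<^sub>R f s = indicator {a..b} s *\<^sub>R f s"
      using AE_lborel_singleton[of b] by eventually_elim (auto split: split_indicator)
    ultimately show ?thesis
      unfolding set_lebesgue_integral_def
      by (intro integral_cong_AE) (auto simp: set_integrable_def simp del: real_scaleR_def dest: borel_measurable_integrable)
  qed
  finally show ?thesis .
qed

context prob_space
begin

lemma pair_sigma_finite_time: "pair_sigma_finite (lborel_Icc a b) M"
proof -
  interpret L: finite_measure "lborel_Icc a b" by (rule finite_measure_lborel_Icc)
  show ?thesis ..
qed

lemma finite_measure_time_space: "finite_measure (time_space M a b)"
  unfolding time_space_def
  by (rule finite_measure_pair_measure) (auto intro: finite_measure_axioms finite_measure_lborel_Icc)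

lemma time_space_Fubini:
  fixes f :: "real \<Rightarrow> 'a \<Rightarrow> real"
  assumes "integrable (time_space M a b) (case_prod f)"
  shows "AE s in lborel_Icc a b. integrable M (f s)"
    and "set_integrable lborel {a..b} (\<lambda>s. \<integral>\<omega>. f s \<omega> \<partial>M)"
    and "integral\<^sup>L (time_space M a b) (case_prod f) = (LINT s:{a..b}|lborel. (\<integral>\<omega>. f s \<omega> \<partial>M))"
    and "AE \<omega> in M. set_integrable lborel {a..b} (\<lambda>s. f s \<omega>)"
    and "integrable M (\<lambda>\<omega>. LINT s:{a..b}|lborel. f s \<omega>)"
    and "integral\<^sup>L (time_space M a b) (case_prod f) = (\<integral>\<omega>. (LINT s:{a..b}|lborel. f s \<omega>) \<partial>M)"
proof -
  interpret P: pair_sigma_finite "lborel_Icc a b" M by (rule pair_sigma_finite_time)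
  note i = assms[unfolded time_space_def]
  show "AE s in lborel_Icc a b. integrable M (f s)" using P.AE_integrable_fst'[OF i] by simp
  show "set_integrable lborel {a..b} (\<lambda>s. \<integral>\<omega>. f s \<omega> \<partial>M)"
    using P.integrable_fst'[OF i] by (simp add: integrable_lborel_Icc)
  show "integral\<^sup>L (time_space M a b) (case_prod f) = (LINT s:{a..b}|lborel. (\<integral>\<omega>. f s \<omega> \<partial>M))"
    using P.integral_fst'[OF i] by (simp add: integral_lborel_Icc time_space_def)
  show "AE \<omega> in M. set_integrable lborel {a..b} (\<lambda>s. f s \<omega>)"
    using P.AE_integrable_snd[OF i] by (simp add: integrable_lborel_Icc)
  show "integrable M (\<lambda>\<omega>. LINT s:{a..b}|lborel. f s \<omega>)"
    using P.integrable_snd[OF i] by (simp add: integral_lborel_Icc)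
  show "integral\<^sup>L (time_space M a b) (case_prod f) = (\<integral>\<omega>. (LINT s:{a..b}|lborel. f s \<omega>) \<partial>M)"
    using P.integral_snd[OF i] by (simp add: integral_lborel_Icc time_space_def)
qed

lemma time_space_section_measurable:
  assumes "case_prod f \<in> borel_measurable (time_space M a b)" "s \<in> {a..b}"
  shows "f s \<in> borel_measurable M"
proof -
  have "(\<lambda>\<omega>. (s, \<omega>)) \<in> measurable M (time_space M a b)"
    unfolding time_space_def using assms(2) by (intro measurable_Pair measurable_const measurable_ident_sets) auto
  from measurable_compose[OF this assms(1)] show ?thesis by simp
qed

lemma square_integrable_time_space:
  assumes m: "case_prod f \<in> borel_measurable (time_space M a b)" and ab: "a \<le> b"
    and f: "\<And>s. s \<in> {a..b} \<Longrightarrow> square_integrable M (f s)"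
    and le: "\<And>s. s \<in> {a..b} \<Longrightarrow> (\<integral>\<omega>. (f s \<omega>)\<^sup>2 \<partial>M) \<le> B"
  shows "square_integrable (time_space M a b) (case_prod f)"
    and "(\<integral>x. (case_prod f x)\<^sup>2 \<partial>time_space M a b) \<le> (b - a) * B"
proof -
  interpret P: pair_sigma_finite "lborel_Icc a b" M by (rule pair_sigma_finite_time)
  interpret L: finite_measure "lborel_Icc a b" by (rule finite_measure_lborel_Icc)
  note [measurable] = m[unfolded time_space_def]
  have i: "integrable (lborel_Icc a b) (\<lambda>s. \<integral>\<omega>. (f s \<omega>)\<^sup>2 \<partial>M)"
    by (rule L.integrable_const_bound[where B = B]) (use le in \<open>auto simp: space_restrict_space\<close>)
  have "integrable (lborel_Icc a b \<Otimes>\<^sub>M M) (\<lambda>x. (case_prod f x)\<^sup>2)"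
    by (rule P.Fubini_integrable) (use i f in \<open>auto simp: space_restrict_space square_integrable_def\<close>)
  then have I: "integrable (time_space M a b) (case_prod (\<lambda>s \<omega>. (f s \<omega>)\<^sup>2))"
    by (simp add: time_space_def case_prod_beta')
  then show "square_integrable (time_space M a b) (case_prod f)"
    using m by (simp add: square_integrable_def case_prod_beta')
  have "(\<integral>x. (case_prod f x)\<^sup>2 \<partial>time_space M a b) = (LINT s:{a..b}|lborel. (\<integral>\<omega>. (f s \<omega>)\<^sup>2 \<partial>M))"
    using time_space_Fubini(3)[OF I] by (simp add: case_prod_beta')
  also have "\<dots> = (\<integral>s. (\<integral>\<omega>. (f s \<omega>)\<^sup>2 \<partial>M) \<partial>lborel_Icc a b)" by (simp add: integral_lborel_Icc)
  also have "\<dots> \<le> (\<integral>s. B \<partial>lborel_Icc a b)"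
    using i by (intro integral_mono) (use le in \<open>auto simp: space_restrict_space\<close>)
  also have "\<dots> = (b - a) * B"
    using ab by (simp add: space_restrict_space measure_restrict_space)
  finally show "(\<integral>x. (case_prod f x)\<^sup>2 \<partial>time_space M a b) \<le> (b - a) * B" .
qed

lemma square_integrable_time_space_const:
  assumes "square_integrable M f"
  shows "square_integrable (time_space M a b) (\<lambda>(s, \<omega>). f \<omega>)"
proof (cases "a \<le> b")
  case True
  have [measurable]: "f \<in> borel_measurable M" using assms by measurable
  show ?thesis
    by (rule square_integrable_time_space(1)[OF _ True, where B = "\<integral>\<omega>. (f \<omega>)\<^sup>2 \<partial>M"])
       (use assms in \<open>auto simp: time_space_def\<close>)
next
  case False
  then have "space (time_space M a b) = {}" by (simp add: space_time_space)
  then show ?thesis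
    by (simp add: square_integrable_def integrable_iff_bounded nn_integral_empty measurable_def)
qed

text \<open>Cauchy-Schwarz in time against the indicator of {a..s}. The exceptional null set comes
  from Fubini alone and is therefore the same for all s.\<close>

lemma running_integral_bound:
  assumes h: "square_integrable (time_space M a b) (case_prod h)"
  shows "AE \<omega> in M. \<forall>s\<in>{a..b}. (LINT u:{a..s}|lborel. h u \<omega>)\<^sup>2 \<le> (b - a) * (LINT u:{a..b}|lborel. (h u \<omega>)\<^sup>2)"
proof -
  have i: "integrable (time_space M a b) (case_prod (\<lambda>s \<omega>. (h s \<omega>)\<^sup>2))"
    using square_integrableD[OF h] by (simp add: case_prod_beta')
  have m: "case_prod h \<in> borel_measurable (time_space M a b)" using h by measurable
  show ?thesis
    using time_space_Fubini(4)[OF i] AE_space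
  proof eventually_elim
    case (elim \<omega>)
    let ?L = "lborel_Icc a b"
    interpret L: finite_measure ?L by (rule finite_measure_lborel_Icc)
    have "(\<lambda>s. (s, \<omega>)) \<in> measurable ?L (time_space M a b)"
      unfolding time_space_def using elim by (intro measurable_Pair measurable_const measurable_ident_sets) auto
    from measurable_compose[OF this m] have hm: "(\<lambda>s. h s \<omega>) \<in> borel_measurable ?L" by simp
    then have hs: "square_integrable ?L (\<lambda>s. h s \<omega>)"
      using elim by (simp add: square_integrable_def integrable_lborel_Icc)
    show ?case
    proof
      fix s assume s: "s \<in> {a..b}"
      have ind: "square_integrable ?L (indicator {a..s})"
        by (rule L.square_integrable_bounded[where B = 1]) (auto intro!: measurable_restrict_space1)
      have "(LINT u:{a..s}|lborel. h u \<omega>) = (\<integral>u. indicator {a..s} u * h u \<omega> \<partial>?L)"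
        unfolding integral_lborel_Icc set_lebesgue_integral_def
        by (rule Bochner_Integration.integral_cong) (use s in \<open>auto split: split_indicator\<close>)
      then have "\<bar>LINT u:{a..s}|lborel. h u \<omega>\<bar>
          \<le> sqrt (\<integral>u. (indicator {a..s} u)\<^sup>2 \<partial>?L) * sqrt (\<integral>u. (h u \<omega>)\<^sup>2 \<partial>?L)"
        using integral_mult_bound[OF ind hs] by simp
      then have "(LINT u:{a..s}|lborel. h u \<omega>)\<^sup>2
          \<le> (sqrt (\<integral>u. (indicator {a..s} u)\<^sup>2 \<partial>?L) * sqrt (\<integral>u. (h u \<omega>)\<^sup>2 \<partial>?L))\<^sup>2"
        by (rule abs_le_square_iff[THEN iffD1, OF order_trans]) simp
      also have "\<dots> = (\<integral>u. (indicator {a..s} u)\<^sup>2 \<partial>?L) * (\<integral>u. (h u \<omega>)\<^sup>2 \<partial>?L)"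
        by (simp add: power_mult_distrib)
      also have "\<dots> \<le> (b - a) * (\<integral>u. (h u \<omega>)\<^sup>2 \<partial>?L)"
      proof (rule mult_right_mono)
        have "(\<integral>u. (indicator {a..s} u :: real)\<^sup>2 \<partial>?L) \<le> (\<integral>u. 1 \<partial>?L)"
          by (rule integral_mono) (use square_integrableD[OF ind] in \<open>auto split: split_indicator\<close>)
        also have "\<dots> = b - a" using s by (simp add: space_restrict_space measure_restrict_space)
        finally show "(\<integral>u. (indicator {a..s} u :: real)\<^sup>2 \<partial>?L) \<le> b - a" .
      qed simp
      finally show "(LINT u:{a..s}|lborel. h u \<omega>)\<^sup>2 \<le> (b - a) * (LINT u:{a..b}|lborel. (h u \<omega>)\<^sup>2)"
        by (simp add: integral_lborel_Icc)
    qed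
  qed
qed

lemma running_integral_measurable:
  assumes h: "case_prod h \<in> borel_measurable (time_space M a b)" and s: "s \<in> {a..b}"
  shows "(\<lambda>\<omega>. LINT u:{a..s}|lborel. h u \<omega> :: real) \<in> borel_measurable M"
proof -
  interpret P: pair_sigma_finite "lborel_Icc a s" M by (rule pair_sigma_finite_time)
  have "case_prod h \<in> borel_measurable (time_space M a s)"
    by (rule measurable_time_space_mono[OF h]) (use s in auto)
  then have "(\<lambda>(\<omega>, u). h u \<omega>) \<in> borel_measurable (M \<Otimes>\<^sub>M lborel_Icc a s)"
    unfolding time_space_def by (subst measurable_pair_swap_iff) simp
  then have "(\<lambda>\<omega>. \<integral>u. h u \<omega> \<partial>lborel_Icc a s) \<in> borel_measurable M"
    by (intro P.M1.borel_measurable_lebesgue_integral) simp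
  then show ?thesis by (simp add: integral_lborel_Icc)
qed

lemma running_integral_square:
  assumes h: "square_integrable (time_space M a b) (case_prod h)" and s: "s \<in> {a..b}"
  shows "square_integrable M (\<lambda>\<omega>. LINT u:{a..s}|lborel. h u \<omega>)"
    and "(\<integral>\<omega>. (LINT u:{a..s}|lborel. h u \<omega>)\<^sup>2 \<partial>M) \<le> (b - a) * (\<integral>x. (case_prod h x)\<^sup>2 \<partial>time_space M a b)"
proof -
  have i: "integrable (time_space M a b) (case_prod (\<lambda>s \<omega>. (h s \<omega>)\<^sup>2))"
    using square_integrableD[OF h] by (simp add: case_prod_beta')
  have m: "(\<lambda>\<omega>. LINT u:{a..s}|lborel. h u \<omega>) \<in> borel_measurable M"
    by (rule running_integral_measurable[OF _ s]) (use h in measurable)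
  have le: "AE \<omega> in M. (LINT u:{a..s}|lborel. h u \<omega>)\<^sup>2 \<le> (b - a) * (LINT u:{a..b}|lborel. (h u \<omega>)\<^sup>2)"
    using running_integral_bound[OF h] s by auto
  have I: "integrable M (\<lambda>\<omega>. (b - a) * (LINT u:{a..b}|lborel. (h u \<omega>)\<^sup>2))"
    using time_space_Fubini(5)[OF i] by simp
  have i2: "integrable M (\<lambda>\<omega>. (LINT u:{a..s}|lborel. h u \<omega>)\<^sup>2)"
  proof (rule Bochner_Integration.integrable_bound[OF I])
    show "AE \<omega> in M. norm ((LINT u:{a..s}|lborel. h u \<omega>)\<^sup>2) \<le> norm ((b - a) * (LINT u:{a..b}|lborel. (h u \<omega>)\<^sup>2))"
      using le by eventually_elim simp
  qed (use m in measurable)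
  then show "square_integrable M (\<lambda>\<omega>. LINT u:{a..s}|lborel. h u \<omega>)"
    using m by (simp add: square_integrable_def)
  have "(\<integral>\<omega>. (LINT u:{a..s}|lborel. h u \<omega>)\<^sup>2 \<partial>M) \<le> (\<integral>\<omega>. (b - a) * (LINT u:{a..b}|lborel. (h u \<omega>)\<^sup>2) \<partial>M)"
    by (rule integral_mono_AE[OF i2 I le])
  also have "\<dots> = (b - a) * (\<integral>x. (case_prod h x)\<^sup>2 \<partial>time_space M a b)"
    using time_space_Fubini(6)[OF i] by (simp add: case_prod_beta')
  finally show "(\<integral>\<omega>. (LINT u:{a..s}|lborel. h u \<omega>)\<^sup>2 \<partial>M) \<le> (b - a) * (\<integral>x. (case_prod h x)\<^sup>2 \<partial>time_space M a b)" .
qed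

end

section \<open>The Ito inequality for the penalty\<close>

text \<open>A is the drift part of an increment over a time r and B its martingale part. In
  expectation A^2 is of order r times an additive quantity, B^2 of order r and B^4 of order r^2, so
  each of the three error terms has expectation of order \<open>sqrt r\<close> times an additive
  quantity. Young's inequality with weight \<open>sqrt r\<close> produces exactly these
  terms.\<close>

lemma pen_increment_lower:
  fixes x A B r :: real
  assumes r: "0 < r" "r \<le> 1"
  shows "pen x + pen1 x * (B - A) + pen2 x / 2 * B\<^sup>2 - (12 / sqrt r * A\<^sup>2 + 6 * sqrt r * B\<^sup>2 + 6 / sqrt r * B ^ 4)
    \<le> pen (x + (B - A))"
proof -
  define q where "q = sqrt r"
  have q: "0 < q" "q \<le> 1" "1 \<le> 1 / q" using r by (auto simp: q_def)
  have young: "2 * (u * v) \<le> u\<^sup>2 / q + q * v\<^sup>2" for u v :: real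
  proof -
    have "0 \<le> (u - q * v)\<^sup>2 / q" using q by simp
    also have "(u - q * v)\<^sup>2 / q = u\<^sup>2 / q + q * v\<^sup>2 - 2 * (u * v)"
      using q by (simp add: power2_eq_square field_simps)
    finally show ?thesis by simp
  qed
  define d where "d = B - A"
  have A0: "0 \<le> A\<^sup>2" and B0: "0 \<le> B\<^sup>2" and B4: "0 \<le> B ^ 4" by simp_all
  have AB: "d\<^sup>2 = B\<^sup>2 - 2 * (A * B) + A\<^sup>2" by (simp add: d_def power2_eq_square algebra_simps)
  \<comment> \<open>Because \<open>pen2\<close> is nonnegative, a lower bound for d^2 is enough; the
    cross term 2 A B is split with weight q.\<close>
  have sq: "B\<^sup>2 - (A\<^sup>2 / q + q * B\<^sup>2) \<le> d\<^sup>2"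
    using young[of A B] AB A0 by linarith
  have t1: "pen2 x / 2 * B\<^sup>2 - 3 * (A\<^sup>2 / q + q * B\<^sup>2) \<le> pen2 x / 2 * d\<^sup>2"
  proof -
    have "pen2 x / 2 * (A\<^sup>2 / q + q * B\<^sup>2) \<le> 3 * (A\<^sup>2 / q + q * B\<^sup>2)"
      using pen2_bounds[of x] q by (intro mult_right_mono) auto
    moreover have "pen2 x / 2 * (B\<^sup>2 - (A\<^sup>2 / q + q * B\<^sup>2)) \<le> pen2 x / 2 * d\<^sup>2"
      using pen2_bounds[of x] sq by (intro mult_left_mono) auto
    ultimately show ?thesis by (simp only: right_diff_distrib)
  qed
  have "(A + B)\<^sup>2 = A\<^sup>2 + 2 * (A * B) + B\<^sup>2" by (simp add: power2_sum)
  then have d2: "d\<^sup>2 \<le> 2 * A\<^sup>2 + 2 * B\<^sup>2"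
    using AB zero_le_power2[of "A + B"] by linarith
  have b1: "2 * (B\<^sup>2 * \<bar>A\<bar>) \<le> B ^ 4 / q + A\<^sup>2 / q"
  proof -
    have "2 * (B\<^sup>2 * \<bar>A\<bar>) \<le> B ^ 4 / q + q * A\<^sup>2" using young[of "B\<^sup>2" "\<bar>A\<bar>"] by simp
    moreover have "q * A\<^sup>2 \<le> (1 / q) * A\<^sup>2" using q by (intro mult_right_mono[OF _ A0]) linarith
    ultimately show ?thesis by simp
  qed
  have b2: "2 * (B\<^sup>2 * \<bar>B\<bar>) \<le> B ^ 4 / q + q * B\<^sup>2" using young[of "B\<^sup>2" "\<bar>B\<bar>"] by simp
  have A1: "A\<^sup>2 \<le> A\<^sup>2 / q" using mult_right_mono[OF q(3) A0] by simp
  \<comment> \<open>The truncated factor is used in two ways: it is at most 1 against A^2 and at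
    most |A| + |B| against B^2. After Young's inequality A then occurs only squared and B to at most
    the fourth power.\<close>
  have "d\<^sup>2 * min 1 \<bar>d\<bar> \<le> (2 * A\<^sup>2 + 2 * B\<^sup>2) * min 1 \<bar>d\<bar>"
    by (rule mult_right_mono) (use d2 in auto)
  also have "\<dots> = 2 * A\<^sup>2 * min 1 \<bar>d\<bar> + 2 * B\<^sup>2 * min 1 \<bar>d\<bar>" by (simp only: distrib_right)
  also have "\<dots> \<le> 2 * A\<^sup>2 * 1 + 2 * B\<^sup>2 * (\<bar>A\<bar> + \<bar>B\<bar>)"
    by (intro add_mono mult_left_mono) (auto simp: d_def)
  also have "\<dots> = 2 * A\<^sup>2 + 2 * (B\<^sup>2 * \<bar>A\<bar>) + 2 * (B\<^sup>2 * \<bar>B\<bar>)" by (simp add: algebra_simps)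
  also have "\<dots> \<le> 3 * (A\<^sup>2 / q) + 2 * (B ^ 4 / q) + q * B\<^sup>2"
    using b1 b2 A1 by linarith
  finally have t2: "d\<^sup>2 * min 1 \<bar>d\<bar> \<le> 3 * (A\<^sup>2 / q) + 2 * (B ^ 4 / q) + q * B\<^sup>2" .
  define m where "m = d\<^sup>2 * min 1 \<bar>d\<bar>"
  note t2 = t2[folded m_def]
  have "pen x + pen1 x * d + pen2 x / 2 * d\<^sup>2 - 3 * m \<le> pen (x + d)"
    unfolding m_def by (rule pen_taylor)
  then have "pen x + pen1 x * d + (pen2 x / 2 * B\<^sup>2 - 3 * (A\<^sup>2 / q + q * B\<^sup>2))
      - 3 * (3 * (A\<^sup>2 / q) + 2 * (B ^ 4 / q) + q * B\<^sup>2) \<le> pen (x + d)"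
    by (rule order_trans[rotated]) (intro diff_mono add_mono mult_left_mono t1 t2 order_refl; simp)
  moreover have "p + t - (12 * \<alpha> + 6 * \<gamma> + 6 * \<beta>) \<le> v"
    if "p + (t - 3 * (\<alpha> + \<gamma>)) - 3 * (3 * \<alpha> + 2 * \<beta> + \<gamma>) \<le> v" for p t \<alpha> \<beta> \<gamma> v :: real
    using that by simp
  ultimately have "pen x + pen1 x * d + pen2 x / 2 * B\<^sup>2 - (12 * (A\<^sup>2 / q) + 6 * (q * B\<^sup>2) + 6 * (B ^ 4 / q)) \<le> pen (x + d)"
    by blast
  then show ?thesis by (simp add: q_def d_def)
qed

text \<open>The price of replacing a frozen value y by the running value x in the coefficients:
  \<open>pen1\<close> and \<open>pen2\<close> are Lipschitz, and |x - y| is split off with weight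
  \<open>sqrt r\<close>, since (x - y)^2 will have expectation of order r.\<close>

lemma pen_freeze:
  fixes x y h q n r :: real
  assumes r: "0 < r" "r \<le> 1" and q: "0 \<le> q" "q \<le> n"
  shows "pen2 x / 2 * q - pen1 x * h
    \<le> pen2 y / 2 * q - pen1 y * h + ((3 + 2 * n) / sqrt r * (x - y)\<^sup>2 + sqrt r * (3 * h\<^sup>2 + 2 * n))"
proof -
  define p where "p = sqrt r"
  have p: "0 < p" using r by (auto simp: p_def)
  have young: "2 * (u * v) \<le> u\<^sup>2 / p + p * v\<^sup>2" for u v :: real
  proof -
    have "0 \<le> (u - p * v)\<^sup>2 / p" using p by simp
    also have "(u - p * v)\<^sup>2 / p = u\<^sup>2 / p + p * v\<^sup>2 - 2 * (u * v)"
      using p by (simp add: power2_eq_square field_simps)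
    finally show ?thesis by simp
  qed
  have "(pen1 y - pen1 x) * h \<le> \<bar>pen1 y - pen1 x\<bar> * \<bar>h\<bar>" by (metis abs_mult abs_ge_self)
  also have "\<dots> \<le> (6 * \<bar>x - y\<bar>) * \<bar>h\<bar>"
    using pen1_lipschitz[of y x] by (intro mult_right_mono) (auto simp: abs_minus_commute)
  also have "\<dots> = 3 * (2 * (\<bar>x - y\<bar> * \<bar>h\<bar>))" by simp
  also have "\<dots> \<le> 3 * ((x - y)\<^sup>2 / p + p * h\<^sup>2)"
    using young[of "\<bar>x - y\<bar>" "\<bar>h\<bar>"] unfolding power2_abs by (intro mult_left_mono) auto
  finally have 1: "(pen1 y - pen1 x) * h \<le> 3 * ((x - y)\<^sup>2 / p + p * h\<^sup>2)" .
  have "(pen2 x - pen2 y) / 2 * q \<le> (3 * \<bar>x - y\<bar>) * q"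
    using pen2_lipschitz[of x y] q by (intro mult_right_mono) (auto simp: abs_le_iff)
  also have "\<dots> \<le> (3 * \<bar>x - y\<bar>) * n" using q by (intro mult_left_mono) auto
  also have "\<dots> = (3 * n / 2) * (2 * (\<bar>x - y\<bar> * 1))" by simp
  also have "\<dots> \<le> (3 * n / 2) * ((x - y)\<^sup>2 / p + p)"
    using young[of "\<bar>x - y\<bar>" 1] q by (intro mult_left_mono) auto
  also have "\<dots> \<le> (2 * n) * ((x - y)\<^sup>2 / p + p)"
    using p q by (intro mult_right_mono) auto
  finally have 2: "(pen2 x - pen2 y) / 2 * q \<le> (2 * n) * ((x - y)\<^sup>2 / p + p)" .
  have "pen2 x / 2 * q - pen1 x * h = pen2 y / 2 * q - pen1 y * h + ((pen1 y - pen1 x) * h + (pen2 x - pen2 y) / 2 * q)"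
    by (simp add: algebra_simps diff_divide_distrib)
  also have "\<dots> \<le> pen2 y / 2 * q - pen1 y * h + (3 * ((x - y)\<^sup>2 / p + p * h\<^sup>2) + (2 * n) * ((x - y)\<^sup>2 / p + p))"
    using 1 2 by linarith
  also have "\<dots> = pen2 y / 2 * q - pen1 y * h + ((3 + 2 * n) / p * (x - y)\<^sup>2 + p * (3 * h\<^sup>2 + 2 * n))"
    by (simp add: algebra_simps add_divide_distrib)
  finally show ?thesis by (simp only: p_def)
qed

text \<open>One short interval of the Ito inequality. The stochastic input is confined to the moment
  bounds on B and to \<open>mart1\<close> and \<open>mart2\<close>, which say that B b is centred
  and has variance density q when tested against functions of the starting value. The coefficients
  run with time instead of being frozen at a, so that the statements for adjacent intervals add
  up.\<close>

lemma (in prob_space) pen_step: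
  fixes h X B :: "real \<Rightarrow> 'a \<Rightarrow> real" and Xa q :: "'a \<Rightarrow> real"
  assumes ab: "a < b" "b - a \<le> 1" and n: "0 \<le> n"
    and h: "square_integrable (time_space M a b) (case_prod h)"
    and Xm: "case_prod X \<in> borel_measurable (time_space M a b)"
    and Xa: "square_integrable M Xa"
    and X: "\<And>s. s \<in> {a..b} \<Longrightarrow> AE \<omega> in M. X s \<omega> = Xa \<omega> - (LINT u:{a..s}|lborel. h u \<omega>) + B s \<omega>"
    and B2: "\<And>s. s \<in> {a..b} \<Longrightarrow> square_integrable M (B s)"
            "\<And>s. s \<in> {a..b} \<Longrightarrow> (\<integral>\<omega>. (B s \<omega>)\<^sup>2 \<partial>M) \<le> n * (b - a)"
    and B4: "integrable M (\<lambda>\<omega>. (B b \<omega>) ^ 4)" "(\<integral>\<omega>. (B b \<omega>) ^ 4 \<partial>M) \<le> n * (b - a)\<^sup>2"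
    and q: "q \<in> borel_measurable M" "\<And>\<omega>. \<omega> \<in> space M \<Longrightarrow> 0 \<le> q \<omega> \<and> q \<omega> \<le> n"
    and mart1: "(\<integral>\<omega>. pen1 (Xa \<omega>) * B b \<omega> \<partial>M) = 0"
    and mart2: "(\<integral>\<omega>. pen2 (Xa \<omega>) * (B b \<omega>)\<^sup>2 \<partial>M) = (b - a) * (\<integral>\<omega>. pen2 (Xa \<omega>) * q \<omega> \<partial>M)"
  shows "(\<integral>\<omega>. pen (Xa \<omega>) \<partial>M) + (\<integral>(s, \<omega>). pen2 (X s \<omega>) / 2 * q \<omega> - pen1 (X s \<omega>) * h s \<omega> \<partial>time_space M a b)
     - (33 + 38 * n + 8 * n\<^sup>2) * sqrt (b - a) * (\<integral>(s, \<omega>). (h s \<omega>)\<^sup>2 + 1 \<partial>time_space M a b)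
     \<le> (\<integral>\<omega>. pen (X b \<omega>) \<partial>M)"
    and "\<And>s. s \<in> {a..b} \<Longrightarrow> square_integrable M (X s)"
    and "integrable (time_space M a b) (\<lambda>(s, \<omega>). pen2 (X s \<omega>) / 2 * q \<omega> - pen1 (X s \<omega>) * h s \<omega>)"
proof -
  define r where "r = b - a"
  have r: "0 < r" "r \<le> 1" using ab by (auto simp: r_def)
  let ?N = "time_space M a b"
  interpret N: finite_measure ?N by (rule finite_measure_time_space)
  define D where "D = (\<integral>x. (case_prod h x)\<^sup>2 \<partial>?N)"
  have D0: "0 \<le> D" by (simp add: D_def)
  define A where "A s \<omega> = (LINT u:{a..s}|lborel. h u \<omega>)" for s \<omega>
  have A: "square_integrable M (A s)" "(\<integral>\<omega>. (A s \<omega>)\<^sup>2 \<partial>M) \<le> r * D" if "s \<in> {a..b}" for s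
    unfolding A_def r_def D_def by (rule running_integral_square[OF h that])+
  have b: "b \<in> {a..b}" using ab by simp
  have Xsec: "X s \<in> borel_measurable M" if "s \<in> {a..b}" for s
    by (rule time_space_section_measurable[OF Xm that])
  show Xsq: "square_integrable M (X s)" if s: "s \<in> {a..b}" for s
  proof (rule square_integrable_bound)
    show "square_integrable M (\<lambda>\<omega>. Xa \<omega> - A s \<omega> + B s \<omega>)"
      by (intro square_integrable_add square_integrable_diff Xa A B2 s)
    show "AE \<omega> in M. \<bar>X s \<omega>\<bar> \<le> \<bar>Xa \<omega> - A s \<omega> + B s \<omega>\<bar>"
      using X[OF s] by eventually_elim (simp add: A_def)
  qed (rule Xsec[OF s])
  have XXa: "square_integrable M (\<lambda>\<omega>. X s \<omega> - Xa \<omega>)" if s: "s \<in> {a..b}" for s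
    by (intro square_integrable_diff Xsq Xa s)
  have XXa2: "(\<integral>\<omega>. (X s \<omega> - Xa \<omega>)\<^sup>2 \<partial>M) \<le> 2 * (r * D) + 2 * (n * r)" if s: "s \<in> {a..b}" for s
  proof -
    have i: "integrable M (\<lambda>\<omega>. (A s \<omega>)\<^sup>2)" "integrable M (\<lambda>\<omega>. (B s \<omega>)\<^sup>2)"
      using A(1)[OF s] B2(1)[OF s] by (auto dest: square_integrableD)
    have "(\<integral>\<omega>. (X s \<omega> - Xa \<omega>)\<^sup>2 \<partial>M) \<le> (\<integral>\<omega>. 2 * (A s \<omega>)\<^sup>2 + 2 * (B s \<omega>)\<^sup>2 \<partial>M)"
    proof (rule integral_mono_AE)
      show "AE \<omega> in M. (X s \<omega> - Xa \<omega>)\<^sup>2 \<le> 2 * (A s \<omega>)\<^sup>2 + 2 * (B s \<omega>)\<^sup>2"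
        using X[OF s]
      proof eventually_elim
        case (elim \<omega>)
        have "0 \<le> (A s \<omega> + B s \<omega>)\<^sup>2" by simp
        moreover have "(X s \<omega> - Xa \<omega>) = B s \<omega> - A s \<omega>" using elim by (simp add: A_def)
        ultimately show ?case by (simp only:) (simp add: power2_eq_square algebra_simps)
      qed
    qed (use i square_integrableD[OF XXa[OF s]] in auto)
    also have "\<dots> = 2 * (\<integral>\<omega>. (A s \<omega>)\<^sup>2 \<partial>M) + 2 * (\<integral>\<omega>. (B s \<omega>)\<^sup>2 \<partial>M)" using i by simp
    finally show ?thesis using A(2)[OF s] B2(2)[OF s] by (simp add: r_def)
  qed
  have Xam: "(\<lambda>(s, \<omega>). Xa \<omega>) \<in> borel_measurable ?N" and qm: "(\<lambda>(s, \<omega>). q \<omega>) \<in> borel_measurable ?N"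
    using Xa q(1) by (auto simp: time_space_def square_integrable_def)
  have hm: "case_prod h \<in> borel_measurable ?N" using h by measurable
  note [measurable] = Xam[unfolded case_prod_beta'] qm[unfolded case_prod_beta'] hm[unfolded case_prod_beta'] Xm[unfolded case_prod_beta']
  have Xam2: "case_prod (\<lambda>s \<omega>. X s \<omega> - Xa \<omega>) \<in> borel_measurable ?N"
    by (simp add: case_prod_beta')
  have XXN: "square_integrable ?N (case_prod (\<lambda>s \<omega>. X s \<omega> - Xa \<omega>))"
    "(\<integral>x. (case_prod (\<lambda>s \<omega>. X s \<omega> - Xa \<omega>) x)\<^sup>2 \<partial>?N) \<le> (b - a) * (2 * (r * D) + 2 * (n * r))"
    by (rule square_integrable_time_space[OF Xam2 _ XXa XXa2]; use ab in simp)+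
  have XaN: "square_integrable ?N (\<lambda>x. Xa (snd x))"
    using square_integrable_time_space_const[OF Xa, of a b] by (simp add: case_prod_beta')
  have XN: "square_integrable ?N (\<lambda>x. X (fst x) (snd x))"
    using square_integrable_add[OF XXN(1) XaN] by (simp add: case_prod_beta')
  have hN: "square_integrable ?N (\<lambda>x. h (fst x) (snd x))"
    using h by (simp add: case_prod_beta')
  have int2: "integrable ?N (\<lambda>x. pen2 (Y x) / 2 * q (snd x))" if [measurable]: "Y \<in> borel_measurable ?N" for Y
  proof (rule N.integrable_const_bound[where B = "3 * n"])
    show "AE x in ?N. norm (pen2 (Y x) / 2 * q (snd x)) \<le> 3 * n"
    proof (rule AE_I2)
      fix x assume "x \<in> space ?N"
      then have "0 \<le> q (snd x) \<and> q (snd x) \<le> n" by (auto simp: space_time_space intro!: q)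
      then have "pen2 (Y x) / 2 * q (snd x) \<le> 3 * n" "0 \<le> pen2 (Y x) / 2 * q (snd x)"
        using pen2_bounds[of "Y x"] by (auto intro!: mult_mono)
      then show "norm (pen2 (Y x) / 2 * q (snd x)) \<le> 3 * n" by simp
    qed
  qed measurable
  have int1: "integrable ?N (\<lambda>x. pen1 (Y x) * h (fst x) (snd x))" if "square_integrable ?N Y" for Y
    by (intro integrable_mult_square_integrable square_integrable_pen1 that hN)
  show intX: "integrable ?N (\<lambda>(s, \<omega>). pen2 (X s \<omega>) / 2 * q \<omega> - pen1 (X s \<omega>) * h s \<omega>)"
    unfolding case_prod_beta'
    by (rule Bochner_Integration.integrable_diff[OF int2 int1[OF XN]]) measurable
  have intXa: "integrable ?N (\<lambda>(s, \<omega>). pen2 (Xa \<omega>) / 2 * q \<omega> - pen1 (Xa \<omega>) * h s \<omega>)"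
    unfolding case_prod_beta'
    by (rule Bochner_Integration.integrable_diff[OF int2 int1[OF XaN]]) measurable
  define E1 where "E1 = (\<integral>\<omega>. pen1 (Xa \<omega>) * A b \<omega> \<partial>M)"
  define E2 where "E2 = (\<integral>\<omega>. pen2 (Xa \<omega>) * q \<omega> \<partial>M)"
  \<comment> \<open>With coefficients frozen at Xa, Fubini turns the space-time integrals into the
    moments that occur in the Taylor bound.\<close>
  have E1N: "(\<integral>x. pen1 (Xa (snd x)) * h (fst x) (snd x) \<partial>?N) = E1"
  proof -
    have "(\<integral>x. pen1 (Xa (snd x)) * h (fst x) (snd x) \<partial>?N)
       = (\<integral>\<omega>. (LINT s:{a..b}|lborel. pen1 (Xa \<omega>) * h s \<omega>) \<partial>M)"
      using time_space_Fubini(6)[of a b "\<lambda>s \<omega>. pen1 (Xa \<omega>) * h s \<omega>"] int1[OF XaN]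
      by (simp add: case_prod_beta')
    then show ?thesis by (simp add: E1_def A_def)
  qed
  have E2N: "(\<integral>x. pen2 (Xa (snd x)) / 2 * q (snd x) \<partial>?N) = r * (E2 / 2)"
  proof -
    have "(\<integral>x. pen2 (Xa (snd x)) / 2 * q (snd x) \<partial>?N)
       = (LINT s:{a..b}|lborel. (\<integral>\<omega>. pen2 (Xa \<omega>) / 2 * q \<omega> \<partial>M))"
      using time_space_Fubini(3)[of a b "\<lambda>s \<omega>. pen2 (Xa \<omega>) / 2 * q \<omega>"] int2[of "\<lambda>x. Xa (snd x)"]
      by (simp add: case_prod_beta')
    also have "\<dots> = (LINT s:{a..b}|lborel. (1 / 2) * E2)"
      by (simp add: E2_def)
    also have "\<dots> = r * (E2 / 2)"
      using ab by (simp add: set_lebesgue_integral_def r_def)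
    finally show ?thesis .
  qed
  have one: "(\<integral>x. 1 \<partial>?N) = r"
  proof -
    have "(\<integral>x. 1 \<partial>?N) = (LINT s:{a..b}|lborel. (1 :: real))"
      using time_space_Fubini(3)[of a b "\<lambda>s \<omega>. 1"] by (simp add: case_prod_beta' prob_space)
    also have "\<dots> = r" using ab by (simp add: set_lebesgue_integral_def r_def)
    finally show ?thesis .
  qed
  note iA = square_integrableD[OF A(1)[OF b]] and iB = square_integrableD[OF B2(1)[OF b]]
  note ih = square_integrableD[OF hN] and iXX = square_integrableD[OF XXN(1), unfolded case_prod_beta']
  have ip1A: "integrable M (\<lambda>\<omega>. pen1 (Xa \<omega>) * A b \<omega>)" and ip1B: "integrable M (\<lambda>\<omega>. pen1 (Xa \<omega>) * B b \<omega>)"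
    by (intro integrable_mult_square_integrable square_integrable_pen1 Xa A B2 b)+
  have [measurable]: "Xa \<in> borel_measurable M" "B b \<in> borel_measurable M" "q \<in> borel_measurable M"
    using Xa B2(1)[OF b] q by measurable
  have ip2: "integrable M (\<lambda>\<omega>. pen2 (Xa \<omega>) * (B b \<omega>)\<^sup>2)"
  proof (rule Bochner_Integration.integrable_bound[of M "\<lambda>\<omega>. 6 * (B b \<omega>)\<^sup>2"])
    show "AE \<omega> in M. norm (pen2 (Xa \<omega>) * (B b \<omega>)\<^sup>2) \<le> norm (6 * (B b \<omega>)\<^sup>2)"
      using pen2_bounds by (auto simp: abs_mult intro!: mult_right_mono)
  qed (use iB in auto)
  note ipen = integrable_pen[OF Xa] integrable_pen[OF Xsq[OF b]]
  \<comment> \<open>Expectation of the pathwise Taylor bound, with A b the drift part and B b the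
    martingale part. \<open>mart1\<close> removes the first-order term in B, and
    \<open>mart2\<close> turns the second-order term into r E2 / 2.\<close>
  have "(\<integral>\<omega>. pen (Xa \<omega>) + (pen1 (Xa \<omega>) * B b \<omega> - pen1 (Xa \<omega>) * A b \<omega>) + (1 / 2) * (pen2 (Xa \<omega>) * (B b \<omega>)\<^sup>2)
      - (12 / sqrt r * (A b \<omega>)\<^sup>2 + 6 * sqrt r * (B b \<omega>)\<^sup>2 + 6 / sqrt r * (B b \<omega>) ^ 4) \<partial>M) \<le> (\<integral>\<omega>. pen (X b \<omega>) \<partial>M)"
  proof (rule integral_mono_AE)
    show "AE \<omega> in M. pen (Xa \<omega>) + (pen1 (Xa \<omega>) * B b \<omega> - pen1 (Xa \<omega>) * A b \<omega>) + (1 / 2) * (pen2 (Xa \<omega>) * (B b \<omega>)\<^sup>2)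
      - (12 / sqrt r * (A b \<omega>)\<^sup>2 + 6 * sqrt r * (B b \<omega>)\<^sup>2 + 6 / sqrt r * (B b \<omega>) ^ 4) \<le> pen (X b \<omega>)"
      using X[OF b]
    proof eventually_elim
      case (elim \<omega>)
      then have "X b \<omega> = Xa \<omega> + (B b \<omega> - A b \<omega>)" by (simp add: A_def)
      then show ?case using pen_increment_lower[OF r, of "Xa \<omega>" "B b \<omega>" "A b \<omega>"]
        by (simp add: right_diff_distrib)
    qed
  qed (use iA iB B4 ip1A ip1B ip2 ipen in auto)
  also have "(\<integral>\<omega>. pen (Xa \<omega>) + (pen1 (Xa \<omega>) * B b \<omega> - pen1 (Xa \<omega>) * A b \<omega>) + (1 / 2) * (pen2 (Xa \<omega>) * (B b \<omega>)\<^sup>2)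
      - (12 / sqrt r * (A b \<omega>)\<^sup>2 + 6 * sqrt r * (B b \<omega>)\<^sup>2 + 6 / sqrt r * (B b \<omega>) ^ 4) \<partial>M)
    = (\<integral>\<omega>. pen (Xa \<omega>) \<partial>M) + (0 - E1) + (1 / 2) * (r * E2)
      - (12 / sqrt r * (\<integral>\<omega>. (A b \<omega>)\<^sup>2 \<partial>M) + 6 * sqrt r * (\<integral>\<omega>. (B b \<omega>)\<^sup>2 \<partial>M) + 6 / sqrt r * (\<integral>\<omega>. (B b \<omega>) ^ 4 \<partial>M))"
    using iA iB B4(1) ip1A ip1B ip2 ipen by (simp add: mart1 mart2 E1_def E2_def r_def)
  finally have taylor: "(\<integral>\<omega>. pen (Xa \<omega>) \<partial>M) + (0 - E1) + (1 / 2) * (r * E2)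
      - (12 / sqrt r * (\<integral>\<omega>. (A b \<omega>)\<^sup>2 \<partial>M) + 6 * sqrt r * (\<integral>\<omega>. (B b \<omega>)\<^sup>2 \<partial>M) + 6 / sqrt r * (\<integral>\<omega>. (B b \<omega>) ^ 4 \<partial>M))
      \<le> (\<integral>\<omega>. pen (X b \<omega>) \<partial>M)" .
  have sr: "r / sqrt r = sqrt r" "0 < sqrt r" "r * r / sqrt r = r * sqrt r"
    using r by (simp_all add: real_div_sqrt flip: times_divide_eq_right)
  have "12 / sqrt r * (\<integral>\<omega>. (A b \<omega>)\<^sup>2 \<partial>M) \<le> 12 / sqrt r * (r * D)"
    by (intro mult_left_mono A b) (use sr in auto)
  then have err1: "12 / sqrt r * (\<integral>\<omega>. (A b \<omega>)\<^sup>2 \<partial>M) \<le> sqrt r * (12 * D)"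
    using sr by (simp add: field_simps)
  have "6 * sqrt r * (\<integral>\<omega>. (B b \<omega>)\<^sup>2 \<partial>M) \<le> 6 * sqrt r * (n * r)"
    unfolding r_def by (intro mult_left_mono B2 b) (use ab in auto)
  then have err2: "6 * sqrt r * (\<integral>\<omega>. (B b \<omega>)\<^sup>2 \<partial>M) \<le> sqrt r * (6 * n * r)" by (simp add: mult_ac)
  have "6 / sqrt r * (\<integral>\<omega>. (B b \<omega>) ^ 4 \<partial>M) \<le> 6 / sqrt r * (n * (r * r))"
    using B4(2) sr by (intro mult_left_mono) (auto simp: r_def power2_eq_square)
  also have "\<dots> = 6 * n * (r * r / sqrt r)" by simp
  also have "\<dots> = sqrt r * (6 * n * r)" by (simp only: sr) simp
  finally have err3: "6 / sqrt r * (\<integral>\<omega>. (B b \<omega>) ^ 4 \<partial>M) \<le> sqrt r * (6 * n * r)" .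
  \<comment> \<open>Replacing the coefficients at the left end point by the running ones costs another error of
    order \<open>sqrt (b - a)\<close>.\<close>
  have "(\<integral>(s, \<omega>). pen2 (X s \<omega>) / 2 * q \<omega> - pen1 (X s \<omega>) * h s \<omega> \<partial>?N)
     \<le> (\<integral>x. (pen2 (Xa (snd x)) / 2 * q (snd x) - pen1 (Xa (snd x)) * h (fst x) (snd x))
        + ((3 + 2 * n) / sqrt r * (X (fst x) (snd x) - Xa (snd x))\<^sup>2 + sqrt r * (3 * (h (fst x) (snd x))\<^sup>2 + 2 * n)) \<partial>?N)"
  proof (rule integral_mono)
    fix x assume "x \<in> space ?N"
    then have qx: "0 \<le> q (snd x)" "q (snd x) \<le> n" using q(2) by (auto simp: space_time_space)
    show "(case x of (s, \<omega>) \<Rightarrow> pen2 (X s \<omega>) / 2 * q \<omega> - pen1 (X s \<omega>) * h s \<omega>)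
     \<le> (pen2 (Xa (snd x)) / 2 * q (snd x) - pen1 (Xa (snd x)) * h (fst x) (snd x))
        + ((3 + 2 * n) / sqrt r * (X (fst x) (snd x) - Xa (snd x))\<^sup>2 + sqrt r * (3 * (h (fst x) (snd x))\<^sup>2 + 2 * n))"
      using pen_freeze[OF r qx, of "X (fst x) (snd x)" "h (fst x) (snd x)" "Xa (snd x)"]
      by (simp add: case_prod_beta')
  next
    show "integrable ?N (\<lambda>x. (pen2 (Xa (snd x)) / 2 * q (snd x) - pen1 (Xa (snd x)) * h (fst x) (snd x))
        + ((3 + 2 * n) / sqrt r * (X (fst x) (snd x) - Xa (snd x))\<^sup>2 + sqrt r * (3 * (h (fst x) (snd x))\<^sup>2 + 2 * n)))"
      using intXa ih iXX by (intro Bochner_Integration.integrable_add integrable_mult_right) (auto simp: case_prod_beta')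
  qed (rule intX)
  also have "\<dots> = (\<integral>x. pen2 (Xa (snd x)) / 2 * q (snd x) - pen1 (Xa (snd x)) * h (fst x) (snd x) \<partial>?N)
     + ((3 + 2 * n) / sqrt r * (\<integral>x. (X (fst x) (snd x) - Xa (snd x))\<^sup>2 \<partial>?N)
     + sqrt r * (3 * (\<integral>x. (h (fst x) (snd x))\<^sup>2 \<partial>?N) + (\<integral>x. 2 * n \<partial>?N)))"
    using intXa ih iXX by (simp add: case_prod_beta')
  also have "(\<integral>x. pen2 (Xa (snd x)) / 2 * q (snd x) - pen1 (Xa (snd x)) * h (fst x) (snd x) \<partial>?N) = r * (E2 / 2) - E1"
    using int2[of "\<lambda>x. Xa (snd x)"] int1[OF XaN] E1N E2N by simp
  also have "(\<integral>x. 2 * n \<partial>?N) = 2 * n * r" using one by simp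
  also have "(\<integral>x. (h (fst x) (snd x))\<^sup>2 \<partial>?N) = D" by (simp add: D_def case_prod_beta')
  also have "(3 + 2 * n) / sqrt r * (\<integral>x. (X (fst x) (snd x) - Xa (snd x))\<^sup>2 \<partial>?N)
      \<le> (3 + 2 * n) / sqrt r * (r * (2 * (r * D) + 2 * (n * r)))"
    using XXN(2) n sr by (intro mult_left_mono) (auto simp: case_prod_beta' r_def)
  also have "(3 + 2 * n) / sqrt r * (r * (2 * (r * D) + 2 * (n * r)))
      = (3 + 2 * n) * (2 * (r * D) + 2 * (n * r)) * (r / sqrt r)" by simp
  also have "\<dots> = sqrt r * ((6 + 4 * n) * (r * D) + (6 * n + 4 * n\<^sup>2) * r)"
    by (simp only: sr) (simp add: power2_eq_square algebra_simps)
  finally have unfreeze: "(\<integral>(s, \<omega>). pen2 (X s \<omega>) / 2 * q \<omega> - pen1 (X s \<omega>) * h s \<omega> \<partial>?N)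
    \<le> r * (E2 / 2) - E1 + (sqrt r * ((6 + 4 * n) * (r * D) + (6 * n + 4 * n\<^sup>2) * r) + sqrt r * (3 * D + 2 * n * r))"
    by simp
  have tot: "(\<integral>(s, \<omega>). (h s \<omega>)\<^sup>2 + 1 \<partial>?N) = D + r"
    using ih one by (simp add: D_def case_prod_beta')
  have "sqrt r * (12 * D) + sqrt r * (6 * n * r) + sqrt r * (6 * n * r)
      + (sqrt r * ((6 + 4 * n) * (r * D) + (6 * n + 4 * n\<^sup>2) * r) + sqrt r * (3 * D + 2 * n * r))
    = sqrt r * (15 * D + (6 + 4 * n) * (r * D) + (20 * n + 4 * n\<^sup>2) * r)" by (simp add: algebra_simps)
  also have "\<dots> \<le> sqrt r * (15 * D + (6 + 4 * n) * (1 * D) + (20 * n + 4 * n\<^sup>2) * r)"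
    using sr D0 r n by (intro mult_left_mono add_mono mult_right_mono) auto
  \<comment> \<open>The collected coefficients are 21 + 4 n at D and 20 n + 4 n^2 at r. One generous
    polynomial covers both, so the error becomes a multiple of D + r, which is additive in the
    interval.\<close>
  also have "\<dots> \<le> sqrt r * ((33 + 38 * n + 8 * n\<^sup>2) * (D + r))"
  proof (rule mult_left_mono)
    have "0 \<le> (12 + 34 * n + 8 * n\<^sup>2) * D + (33 + 18 * n + 4 * n\<^sup>2) * r" using n D0 r by simp
    then show "15 * D + (6 + 4 * n) * (1 * D) + (20 * n + 4 * n\<^sup>2) * r \<le> (33 + 38 * n + 8 * n\<^sup>2) * (D + r)"
      by (simp add: algebra_simps)
  qed (use sr in simp)
  finally have err: "sqrt r * (12 * D) + sqrt r * (6 * n * r) + sqrt r * (6 * n * r)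
      + (sqrt r * ((6 + 4 * n) * (r * D) + (6 * n + 4 * n\<^sup>2) * r) + sqrt r * (3 * D + 2 * n * r))
    \<le> (33 + 38 * n + 8 * n\<^sup>2) * sqrt r * (D + r)" by (simp add: mult_ac)
  show "(\<integral>\<omega>. pen (Xa \<omega>) \<partial>M) + (\<integral>(s, \<omega>). pen2 (X s \<omega>) / 2 * q \<omega> - pen1 (X s \<omega>) * h s \<omega> \<partial>?N)
     - (33 + 38 * n + 8 * n\<^sup>2) * sqrt (b - a) * (\<integral>(s, \<omega>). (h s \<omega>)\<^sup>2 + 1 \<partial>?N) \<le> (\<integral>\<omega>. pen (X b \<omega>) \<partial>M)"
    unfolding tot r_def[symmetric] using taylor unfreeze err err1 err2 err3 by linarith
qed

section \<open>Brownian increments\<close>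

context prob_space
begin

lemma indep_set_subset:
  assumes "indep_set A B" "A' \<subseteq> A" "B' \<subseteq> B"
  shows "indep_set A' B'"
  using assms unfolding indep_sets2_eq by blast

lemma centered_normal_moments:
  assumes D: "distributed M lborel X (normal_density 0 \<sigma>)" and \<sigma>: "0 < \<sigma>"
  shows "integrable M X" "expectation X = 0"
    and "integrable M (\<lambda>\<omega>. (X \<omega>)\<^sup>2)" "(\<integral>\<omega>. (X \<omega>)\<^sup>2 \<partial>M) = \<sigma>\<^sup>2"
    and "integrable M (\<lambda>\<omega>. (X \<omega>) ^ 4)" "(\<integral>\<omega>. (X \<omega>) ^ 4 \<partial>M) = 3 * \<sigma> ^ 4"
proof -
  have int: "integrable M (\<lambda>\<omega>. (X \<omega>) ^ k)" for k :: nat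
    using distributed_integrable[OF D, of "\<lambda>x. x ^ k"] integrable_normal_moment[OF \<sigma>, of 0 k] by simp
  have E: "(\<integral>\<omega>. (X \<omega>) ^ k \<partial>M) = (\<integral>x. normal_density 0 \<sigma> x * x ^ k \<partial>lborel)" for k :: nat
    using distributed_integral[OF D, of "\<lambda>x. x ^ k"] by simp
  show "integrable M X" using int[of 1] by simp
  show "integrable M (\<lambda>\<omega>. (X \<omega>)\<^sup>2)" "integrable M (\<lambda>\<omega>. (X \<omega>) ^ 4)" by (rule int)+
  show "expectation X = 0" by (rule normal_distributed_expectation[OF \<sigma> D])
  show "(\<integral>\<omega>. (X \<omega>)\<^sup>2 \<partial>M) = \<sigma>\<^sup>2"
    unfolding E using integral_normal_moment_even[OF \<sigma>, of 0 1] by (simp add: fact_numeral)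
  show "(\<integral>\<omega>. (X \<omega>) ^ 4 \<partial>M) = 3 * \<sigma> ^ 4"
    unfolding E using integral_normal_moment_even[OF \<sigma>, of 0 2] \<sigma>
    by (simp add: fact_numeral field_simps power_mult[symmetric] flip: power_mult)
qed

end

lemma standard_brownian_motionD:
  assumes "standard_brownian_motion M W"
  shows "\<And>t. 0 \<le> t \<Longrightarrow> W t \<in> borel_measurable M"
    and "AE \<omega> in M. W 0 \<omega> = 0"
    and "AE \<omega> in M. continuous_on {0..} (\<lambda>t. W t \<omega>)"
    and "\<And>t n. 0 \<le> t 0 \<Longrightarrow> mono t \<Longrightarrow>
        prob_space.indep_vars M (\<lambda>_. borel) (\<lambda>i \<omega>. W (t (Suc i)) \<omega> - W (t i) \<omega>) {..<n}"
    and "\<And>s t. 0 \<le> s \<Longrightarrow> s < t \<Longrightarrow> prob_space.indep_vars M (\<lambda>_. borel) (\<lambda>i \<omega>. (W t \<omega> - W s \<omega>) $ i) UNIV"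
    and "\<And>s t i. 0 \<le> s \<Longrightarrow> s < t \<Longrightarrow>
        distributed M lborel (\<lambda>\<omega>. (W t \<omega> - W s \<omega>) $ i) (normal_density 0 (sqrt (t - s)))"
  using assms unfolding standard_brownian_motion_def by blast+

lemma sets_brownian_filtration:
  assumes "standard_brownian_motion M W"
  shows "sets (brownian_filtration M W t) =
    sigma_sets (space M) ({W s -` A \<inter> space M | s A. s \<in> {0..t} \<and> A \<in> sets borel} \<union> null_sets M)"
    and "space (brownian_filtration M W t) = space M"
    and "sets (brownian_filtration M W t) \<subseteq> sets M"
proof -
  let ?G = "{W s -` A \<inter> space M | s A. s \<in> {0..t} \<and> A \<in> sets borel} \<union> null_sets M"
  have G: "?G \<subseteq> sets M"
    using standard_brownian_motionD(1)[OF assms] by (auto intro: measurable_sets)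
  then have "?G \<subseteq> Pow (space M)" using sets.space_closed by blast
  then show *: "sets (brownian_filtration M W t) = sigma_sets (space M) ?G"
    and "space (brownian_filtration M W t) = space M"
    by (simp_all add: brownian_filtration_def sets_measure_of space_measure_of)
  show "sets (brownian_filtration M W t) \<subseteq> sets M"
    unfolding * by (rule sets.sigma_sets_subset[OF G])
qed

text \<open>The definition speaks of increments along a nondecreasing sequence of times, whereas the
  filtration speaks of values. Values are partial sums of increments starting from W 0 = 0, so a
  cylinder event belongs to the increments before s.\<close>

lemma (in prob_space) brownian_cylinder_indep:
  assumes W: "standard_brownian_motion M W" and st: "0 \<le> s" "s < t"
    and J: "finite J" "J \<subseteq> {0..s}" and A: "\<And>u. A u \<in> sets borel" and E: "E \<in> sets borel"
  shows "prob ({\<omega>\<in>space M. \<forall>u\<in>J. W u \<omega> \<in> A u} \<inter> ((\<lambda>\<omega>. W t \<omega> - W s \<omega>) -` E \<inter> space M))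
    = prob {\<omega>\<in>space M. \<forall>u\<in>J. W u \<omega> \<in> A u} * prob ((\<lambda>\<omega>. W t \<omega> - W s \<omega>) -` E \<inter> space M)"
proof -
  define xs where "xs = sorted_list_of_set J"
  define n where "n = length xs"
  have xs: "set xs = J" "sorted xs" using J by (simp_all add: xs_def)
  \<comment> \<open>The times are 0, the points of J in increasing order, s, and t from then on, so
    the increment from s to t has index \<open>Suc n\<close>. Repeated times do no harm, since the
    sequence only has to be monotone.\<close>
  define \<tau> where "\<tau> i = (if i = 0 then 0 else if i \<le> n then xs ! (i - 1) else if i = Suc n then s else t)" for i
  have nth: "xs ! i \<in> {0..s}" if "i < n" for i
    using J(2) xs(1) that nth_mem[of i xs] by (auto simp: n_def)
  have "mono \<tau>"
    unfolding mono_iff_le_Suc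
  proof
    fix i
    consider "i = 0" | "0 < i" "i < n" | "0 < i" "i = n" | "i = Suc n" | "Suc n < i" by linarith
    then show "\<tau> i \<le> \<tau> (Suc i)"
    proof cases
      case 1
      then show ?thesis using nth[of 0] st by (auto simp: \<tau>_def)
    next
      case 2
      then show ?thesis using sorted_nth_mono[OF xs(2), of "i - 1" i] by (auto simp: \<tau>_def n_def)
    next
      case 3
      then show ?thesis using nth[of "i - 1"] st by (auto simp: \<tau>_def)
    qed (use st in \<open>auto simp: \<tau>_def\<close>)
  qed
  define D where "D i \<omega> = W (\<tau> (Suc i)) \<omega> - W (\<tau> i) \<omega>" for i \<omega>
  have ind: "indep_vars (\<lambda>_. borel) D {..<n + 2}"
    unfolding D_def[abs_def] by (rule standard_brownian_motionD(4)[OF W _ \<open>mono \<tau>\<close>]) (simp add: \<tau>_def)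
  define I where "I = {..<Suc n}"
  define P where "P = PiM I (\<lambda>_::nat. borel :: (real ^ 'b) measure)"
  define P' where "P' = PiM {Suc n} (\<lambda>_::nat. borel :: (real ^ 'b) measure)"
  have iv: "indep_var P (\<lambda>\<omega>. restrict (\<lambda>i. D i \<omega>) I) P' (\<lambda>\<omega>. restrict (\<lambda>i. D i \<omega>) {Suc n})"
    unfolding P_def P'_def I_def by (rule indep_var_restrict[OF ind]) auto
  define S where "S = {x\<in>space P. \<forall>i\<in>{1..n}. (\<Sum>l<i. x l) \<in> A (\<tau> i)}"
  define S' where "S' = {x\<in>space P'. x (Suc n) \<in> E}"
  have S: "S \<in> sets P"
  proof -
    have "(\<lambda>x. \<Sum>l<i. x l) \<in> borel_measurable P" if "i \<in> {1..n}" for i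
      unfolding P_def by (intro borel_measurable_sum measurable_component_singleton) (use that in \<open>auto simp: I_def\<close>)
    from measurable_sets[OF this A] have "{x \<in> space P. (\<Sum>l<i. x l) \<in> A (\<tau> i)} \<in> sets P" if "i \<in> {1..n}" for i
      using that by (simp add: vimage_def Int_def conj_commute)
    then show ?thesis
      unfolding S_def by (intro sets.sets_Collect_finite_All) auto
  qed
  have S': "S' \<in> sets P'"
  proof -
    have "(\<lambda>x. x (Suc n)) \<in> measurable P' borel"
      unfolding P'_def by (rule measurable_component_singleton) simp
    from measurable_sets[OF this E] show ?thesis by (simp add: S'_def vimage_def Int_def conj_commute)
  qed
  let ?C = "{\<omega>\<in>space M. \<forall>u\<in>J. W u \<omega> \<in> A u}"
  let ?C' = "(\<lambda>\<omega>. restrict (\<lambda>i. D i \<omega>) I) -` S \<inter> space M"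
  let ?D = "(\<lambda>\<omega>. W t \<omega> - W s \<omega>) -` E \<inter> space M"
  have Deq: "?D = (\<lambda>\<omega>. restrict (\<lambda>i. D i \<omega>) {Suc n}) -` S' \<inter> space M"
    by (auto simp: S'_def P'_def space_PiM D_def \<tau>_def)
  have Jn: "J = \<tau> ` {1..n}"
  proof -
    have "\<tau> ` {1..n} = \<tau> ` (Suc ` {..<n})" by (simp add: image_Suc_lessThan)
    also have "\<dots> = (\<lambda>i. xs ! i) ` {..<n}" unfolding image_image by (intro image_cong) (auto simp: \<tau>_def)
    also have "\<dots> = set xs" by (auto simp: n_def in_set_conv_nth)
    finally show ?thesis using xs by simp
  qed
  \<comment> \<open>Partial sums of increments equal values of W only where W starts at 0, so the
    two events agree up to a null set.\<close>
  have AE: "AE \<omega> in M. \<omega> \<in> ?C \<longleftrightarrow> \<omega> \<in> ?C'"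
    using standard_brownian_motionD(2)[OF W]
  proof eventually_elim
    case (elim \<omega>)
    have sum: "(\<Sum>l<i. D l \<omega>) = W (\<tau> i) \<omega>" for i
      using elim by (simp add: D_def sum_lessThan_telescope[of "\<lambda>i. W (\<tau> i) \<omega>"]) (simp add: \<tau>_def)
    have "(\<Sum>l<i. restrict (\<lambda>i. D i \<omega>) I l) = W (\<tau> i) \<omega>" if "i \<in> {1..n}" for i
      unfolding sum[symmetric] by (rule sum.cong) (use that in \<open>auto simp: I_def\<close>)
    then show ?case by (auto simp: S_def P_def space_PiM Jn)
  qed
  have "{\<omega>\<in>space M. W u \<omega> \<in> A u} \<in> sets M" if "u \<in> J" for u
    using J that measurable_sets[OF standard_brownian_motionD(1)[OF W] A, of u u]
    by (auto simp: vimage_def Int_def conj_commute)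
  then have Cm: "?C \<in> sets M" using J(1) by (intro sets.sets_Collect_finite_All) auto
  have Wts: "W s \<in> borel_measurable M" "W t \<in> borel_measurable M"
    using st by (auto intro!: standard_brownian_motionD(1)[OF W])
  have Dm: "?D \<in> sets M"
    using E Wts by (intro measurable_sets[of _ _ borel]) auto
  have rv: "(\<lambda>\<omega>. restrict (\<lambda>i. D i \<omega>) I) \<in> measurable M P"
    using iv unfolding indep_var_eq by simp
  have C'm: "?C' \<in> sets M" by (rule measurable_sets[OF rv S])
  have "prob (?C \<inter> ?D) = prob (?C' \<inter> ?D)"
    using AE Cm C'm Dm by (intro finite_measure_eq_AE) (auto elim!: eventually_mono)
  also have "\<dots> = prob ((\<lambda>\<omega>. (restrict (\<lambda>i. D i \<omega>) I, restrict (\<lambda>i. D i \<omega>) {Suc n})) -` (S \<times> S') \<inter> space M)"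
    unfolding Deq by (rule arg_cong[where f = prob]) auto
  also have "\<dots> = prob ?C' * prob ?D"
    unfolding Deq by (rule indep_varD[OF iv S S'])
  also have "prob ?C' = prob ?C"
    using AE Cm C'm by (intro finite_measure_eq_AE) (auto elim!: eventually_mono)
  finally show ?thesis .
qed

text \<open>Cylinder events together with null sets form an intersection-stable generator of the
  completed filtration. Null sets are independent of every event, and independence passes from
  intersection-stable generators to the generated \<sigma>-algebras.\<close>

lemma (in prob_space) brownian_increment_indep:
  assumes W: "standard_brownian_motion M W" and st: "0 \<le> s" "s < t"
  shows "indep_set (sets (brownian_filtration M W s))
     (sigma_sets (space M) {(\<lambda>\<omega>. W t \<omega> - W s \<omega>) -` E \<inter> space M | E. E \<in> sets borel})"
proof -
  define cyl where "cyl J A = {\<omega>\<in>space M. \<forall>u\<in>J. W u \<omega> \<in> A u}" for J :: "real set" and A :: "real \<Rightarrow> (real ^ 'b) set"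
  define C where "C = {cyl J A | J A. finite J \<and> J \<subseteq> {0..s} \<and> (\<forall>u. A u \<in> sets borel)}"
  define B where "B = {(\<lambda>\<omega>. W t \<omega> - W s \<omega>) -` E \<inter> space M | E. E \<in> sets borel}"
  have Wts: "W s \<in> borel_measurable M" "W t \<in> borel_measurable M"
    using st by (auto intro!: standard_brownian_motionD(1)[OF W])
  have Bm: "B \<subseteq> sets M"
  proof
    fix b assume "b \<in> B"
    then obtain E where "b = (\<lambda>\<omega>. W t \<omega> - W s \<omega>) -` E \<inter> space M" "E \<in> sets borel" by (auto simp: B_def)
    then show "b \<in> sets M" using Wts by (auto intro!: measurable_sets[of _ _ borel])
  qed
  have Cm: "C \<subseteq> sets M"
  proof
    fix c assume "c \<in> C"
    then obtain J A where c: "c = cyl J A" "finite J" "J \<subseteq> {0..s}" "\<And>u. A u \<in> sets borel" by (auto simp: C_def)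
    have "{\<omega>\<in>space M. W u \<omega> \<in> A u} \<in> sets M" if "u \<in> J" for u
      using c that measurable_sets[OF standard_brownian_motionD(1)[OF W] c(4), of u u]
      by (auto simp: vimage_def Int_def conj_commute)
    then show "c \<in> sets M" unfolding c(1) cyl_def using c(2) by (intro sets.sets_Collect_finite_All) auto
  qed
  have "indep_set (C \<union> null_sets M) B"
  proof (rule indep_setI)
    show "C \<union> null_sets M \<subseteq> events" using Cm by auto
    show "B \<subseteq> events" by (rule Bm)
    fix c b assume c: "c \<in> C \<union> null_sets M" and b: "b \<in> B"
    from c show "prob (c \<inter> b) = prob c * prob b"
    proof
      assume "c \<in> C"
      then show ?thesis
        using b brownian_cylinder_indep[OF W st] by (auto simp: C_def B_def cyl_def)
    next
      assume "c \<in> null_sets M"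
      moreover from this have "c \<inter> b \<in> null_sets M" using b Bm by (intro null_set_Int2) auto
      ultimately show ?thesis by (simp add: measure_def null_setsD1)
    qed
  qed
  moreover have "Int_stable (C \<union> null_sets M)"
  proof (rule Int_stableI)
    fix a b assume ab: "a \<in> C \<union> null_sets M" "b \<in> C \<union> null_sets M"
    show "a \<inter> b \<in> C \<union> null_sets M"
    proof (cases "a \<in> null_sets M \<or> b \<in> null_sets M")
      case True
      then show ?thesis
        using ab Cm null_set_Int1[of a M b] null_set_Int2[of b M a] by (auto simp: Int_commute)
    next
      case False
      then obtain J A J' A' where a: "a = cyl J A" "finite J" "J \<subseteq> {0..s}" "\<And>u. A u \<in> sets borel"
        and b: "b = cyl J' A'" "finite J'" "J' \<subseteq> {0..s}" "\<And>u. A' u \<in> sets borel"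
        using ab by (auto simp: C_def)
      \<comment> \<open>A time that belongs to only one of the two index sets is left unconstrained
        by the other.\<close>
      define A'' where "A'' u = (if u \<in> J then A u else UNIV) \<inter> (if u \<in> J' then A' u else UNIV)" for u
      have "a \<inter> b = cyl (J \<union> J') A''"
        unfolding a(1) b(1) cyl_def A''_def by (auto split: if_splits)
      moreover have "\<And>u. A'' u \<in> sets borel" using a(4) b(4) by (auto simp: A''_def)
      ultimately show ?thesis using a(2,3) b(2,3) unfolding C_def by blast
    qed
  qed
  moreover have "Int_stable B"
  proof (rule Int_stableI)
    fix a b assume "a \<in> B" "b \<in> B"
    then obtain E E' where "a = (\<lambda>\<omega>. W t \<omega> - W s \<omega>) -` E \<inter> space M" "E \<in> sets borel"
      "b = (\<lambda>\<omega>. W t \<omega> - W s \<omega>) -` E' \<inter> space M" "E' \<in> sets borel" by (auto simp: B_def)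
    then show "a \<inter> b \<in> B" unfolding B_def by (intro CollectI exI[of _ "E \<inter> E'"]) auto
  qed
  ultimately have "indep_set (sigma_sets (space M) (C \<union> null_sets M)) (sigma_sets (space M) B)"
    by (rule indep_set_sigma_sets)
  moreover have "sets (brownian_filtration M W s) \<subseteq> sigma_sets (space M) (C \<union> null_sets M)"
    unfolding sets_brownian_filtration[OF W]
  proof (rule sigma_sets_mono')
    show "{W u -` A \<inter> space M | u A. u \<in> {0..s} \<and> A \<in> sets borel} \<union> null_sets M \<subseteq> C \<union> null_sets M"
    proof (intro Un_mono subsetI order_refl)
      fix x assume "x \<in> {W u -` A \<inter> space M | u A. u \<in> {0..s} \<and> A \<in> sets borel}"
      then obtain u A where "x = W u -` A \<inter> space M" "u \<in> {0..s}" "A \<in> sets borel" by auto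
      then show "x \<in> C"
        unfolding C_def by (intro CollectI exI[of _ "{u}"] exI[of _ "\<lambda>_. A"]) (auto simp: cyl_def)
    qed
  qed
  ultimately show ?thesis unfolding B_def by (rule indep_set_subset) auto
qed

text \<open>Of the Brownian motion this keeps adaptedness, joint measurability, and moments of
  increments tested against the past. The moments are integrals and do not see null sets, so they
  survive a modification of W, while joint measurability is what the modification gains.\<close>

locale brownian_basis = prob_space M for M :: "'a measure" +
  fixes F :: "real \<Rightarrow> 'a measure" and W :: "real \<Rightarrow> 'a \<Rightarrow> real ^ 'd"
  assumes complete: "complete_measure M"
    and F_subalgebra: "\<And>t. 0 \<le> t \<Longrightarrow> subalgebra M (F t)"
    and F_mono: "\<And>s t. 0 \<le> s \<Longrightarrow> s \<le> t \<Longrightarrow> sets (F s) \<subseteq> sets (F t)"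
    and F_null: "\<And>t. 0 \<le> t \<Longrightarrow> null_sets M \<subseteq> sets (F t)"
    and W_adapted: "\<And>t. 0 \<le> t \<Longrightarrow> W t \<in> borel_measurable (F t)"
    and W_measurable: "case_prod W \<in> borel_measurable (borel \<Otimes>\<^sub>M M)"
    and W_mean: "\<And>s t G i. 0 \<le> s \<Longrightarrow> s < t \<Longrightarrow> G \<in> borel_measurable (F s) \<Longrightarrow> integrable M G \<Longrightarrow>
      integrable M (\<lambda>\<omega>. G \<omega> * (W t \<omega> - W s \<omega>) $ i) \<and>
      (\<integral>\<omega>. G \<omega> * (W t \<omega> - W s \<omega>) $ i \<partial>M) = 0"
    and W_cov: "\<And>s t G i j. 0 \<le> s \<Longrightarrow> s < t \<Longrightarrow> G \<in> borel_measurable (F s) \<Longrightarrow> integrable M G \<Longrightarrow>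
      integrable M (\<lambda>\<omega>. G \<omega> * ((W t \<omega> - W s \<omega>) $ i * (W t \<omega> - W s \<omega>) $ j)) \<and>
      (\<integral>\<omega>. G \<omega> * ((W t \<omega> - W s \<omega>) $ i * (W t \<omega> - W s \<omega>) $ j) \<partial>M)
        = (if i = j then (t - s) * (\<integral>\<omega>. G \<omega> \<partial>M) else 0)"
    and W_moment4: "\<And>s t i. 0 \<le> s \<Longrightarrow> s < t \<Longrightarrow> integrable M (\<lambda>\<omega>. ((W t \<omega> - W s \<omega>) $ i) ^ 4) \<and>
      (\<integral>\<omega>. ((W t \<omega> - W s \<omega>) $ i) ^ 4 \<partial>M) = 3 * (t - s)\<^sup>2"

lemma (in prob_space) brownian_increment_moments:
  fixes W :: "real \<Rightarrow> 'a \<Rightarrow> real ^ 'd"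
  assumes W: "standard_brownian_motion M W" and st: "0 \<le> s" "s < t"
    and G: "G \<in> borel_measurable (brownian_filtration M W s)" "integrable M G"
  shows "integrable M (\<lambda>\<omega>. G \<omega> * (W t \<omega> - W s \<omega>) $ i)"
    and "(\<integral>\<omega>. G \<omega> * (W t \<omega> - W s \<omega>) $ i \<partial>M) = 0"
    and "integrable M (\<lambda>\<omega>. G \<omega> * ((W t \<omega> - W s \<omega>) $ i * (W t \<omega> - W s \<omega>) $ j))"
    and "(\<integral>\<omega>. G \<omega> * ((W t \<omega> - W s \<omega>) $ i * (W t \<omega> - W s \<omega>) $ j) \<partial>M)
      = (if i = j then (t - s) * (\<integral>\<omega>. G \<omega> \<partial>M) else 0)"
    and "integrable M (\<lambda>\<omega>. ((W t \<omega> - W s \<omega>) $ i) ^ 4)"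
    and "(\<integral>\<omega>. ((W t \<omega> - W s \<omega>) $ i) ^ 4 \<partial>M) = 3 * (t - s)\<^sup>2"
proof -
  define D where "D \<omega> = W t \<omega> - W s \<omega>" for \<omega>
  have Wts: "W s \<in> borel_measurable M" "W t \<in> borel_measurable M"
    using st by (auto intro!: standard_brownian_motionD(1)[OF W])
  have Dm [measurable]: "D \<in> borel_measurable M" unfolding D_def[abs_def] using Wts by simp
  have "(\<lambda>x. x $ i) \<in> borel_measurable borel" for i :: 'd
    by (intro borel_measurable_continuous_onI continuous_intros)
  note nth_m [measurable] = this
  have sq: "0 < sqrt (t - s)" using st by simp
  note mom = centered_normal_moments[OF standard_brownian_motionD(6)[OF W st] sq, folded D_def]
  have m4: "sqrt (t - s) ^ 4 = (t - s)\<^sup>2"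
    using st power_mult[of "sqrt (t - s)" 2 2] by simp
  show "integrable M (\<lambda>\<omega>. ((W t \<omega> - W s \<omega>) $ i) ^ 4)"
    and "(\<integral>\<omega>. ((W t \<omega> - W s \<omega>) $ i) ^ 4 \<partial>M) = 3 * (t - s)\<^sup>2"
    using mom(5,6)[of i] m4 by (simp_all add: D_def)
  have cov: "integrable M (\<lambda>\<omega>. D \<omega> $ i * D \<omega> $ j)"
    "(\<integral>\<omega>. D \<omega> $ i * D \<omega> $ j \<partial>M) = (if i = j then t - s else 0)"
  proof -
    have "integrable M (\<lambda>\<omega>. D \<omega> $ i * D \<omega> $ j) \<and> (\<integral>\<omega>. D \<omega> $ i * D \<omega> $ j \<partial>M) = (if i = j then t - s else 0)"
    proof (cases "i = j")
      case True
      then show ?thesis using mom(3,4)[of i] st by (simp add: power2_eq_square)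
    next
      case False
      have "indep_vars (\<lambda>_. borel) (\<lambda>i \<omega>. D \<omega> $ i) UNIV"
        using standard_brownian_motionD(5)[OF W st] by (simp add: D_def)
      then have "indep_var (PiM {i} (\<lambda>_. borel)) (\<lambda>\<omega>. restrict (\<lambda>i. D \<omega> $ i) {i})
          (PiM {j} (\<lambda>_. borel)) (\<lambda>\<omega>. restrict (\<lambda>i. D \<omega> $ i) {j})"
        by (rule indep_var_restrict) (use False in auto)
      then have "indep_var borel ((\<lambda>x. x i) \<circ> (\<lambda>\<omega>. restrict (\<lambda>i. D \<omega> $ i) {i}))
          borel ((\<lambda>x. x j) \<circ> (\<lambda>\<omega>. restrict (\<lambda>i. D \<omega> $ i) {j}))"
        by (rule indep_var_compose) (rule measurable_component_singleton, simp)+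
      then have iv: "indep_var borel (\<lambda>\<omega>. D \<omega> $ i) borel (\<lambda>\<omega>. D \<omega> $ j)"
        by (simp add: comp_def)
      show ?thesis
        using indep_var_lebesgue_integral[OF iv mom(1) mom(1)] indep_var_integrable[OF iv mom(1) mom(1)] mom(2) False
        by simp
    qed
    then show "integrable M (\<lambda>\<omega>. D \<omega> $ i * D \<omega> $ j)"
      "(\<integral>\<omega>. D \<omega> $ i * D \<omega> $ j \<partial>M) = (if i = j then t - s else 0)" by auto
  qed
  let ?Fs = "brownian_filtration M W s"
  have GM: "G \<in> borel_measurable M"
    using G(2) by (rule borel_measurable_integrable)
  have "sigma_sets (space M) {G -` A \<inter> space M | A. A \<in> sets borel} \<subseteq> sets ?Fs"
  proof -
    have "{G -` A \<inter> space M | A. A \<in> sets borel} \<subseteq> sets ?Fs"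
      using measurable_sets[OF G(1)] by (auto simp: sets_brownian_filtration(2)[OF W])
    from sets.sigma_sets_subset[OF this] show ?thesis by (simp add: sets_brownian_filtration(2)[OF W])
  qed
  note Gsub = this
  \<comment> \<open>G and g(D) generate parts of two \<sigma>-algebras already known to be
    independent. This form covers both a single coordinate and a product of two.\<close>
  have ivg: "indep_var borel G borel (\<lambda>\<omega>. g (D \<omega>))" if g: "g \<in> borel_measurable borel" for g :: "real ^ 'd \<Rightarrow> real"
  proof -
    have "{(\<lambda>\<omega>. g (D \<omega>)) -` A \<inter> space M | A. A \<in> sets borel}
        \<subseteq> {D -` E \<inter> space M | E. E \<in> sets borel}"
    proof
      fix x assume "x \<in> {(\<lambda>\<omega>. g (D \<omega>)) -` A \<inter> space M | A. A \<in> sets borel}"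
      then obtain A where "x = (\<lambda>\<omega>. g (D \<omega>)) -` A \<inter> space M" "A \<in> sets borel" by auto
      then show "x \<in> {D -` E \<inter> space M | E. E \<in> sets borel}"
        using measurable_sets[OF g, of A] by (intro CollectI exI[of _ "g -` A"]) auto
    qed
    then have "sigma_sets (space M) {(\<lambda>\<omega>. g (D \<omega>)) -` A \<inter> space M | A. A \<in> sets borel}
        \<subseteq> sigma_sets (space M) {D -` E \<inter> space M | E. E \<in> sets borel}"
      by (rule sigma_sets_mono')
    then show ?thesis
      unfolding indep_var_eq using Gsub g measurable_compose[OF Dm g] GM
      by (intro conjI indep_set_subset[OF brownian_increment_indep[OF W st]]) (simp_all add: D_def[abs_def])
  qed
  have iv1: "indep_var borel G borel (\<lambda>\<omega>. D \<omega> $ i)" by (rule ivg) measurable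
  have iv2: "indep_var borel G borel (\<lambda>\<omega>. D \<omega> $ i * D \<omega> $ j)" by (rule ivg) measurable
  show "integrable M (\<lambda>\<omega>. G \<omega> * (W t \<omega> - W s \<omega>) $ i)"
    using indep_var_integrable[OF iv1 G(2) mom(1)] by (simp add: D_def)
  show "(\<integral>\<omega>. G \<omega> * (W t \<omega> - W s \<omega>) $ i \<partial>M) = 0"
    using indep_var_lebesgue_integral[OF iv1 G(2) mom(1)] mom(2) by (simp add: D_def)
  show "integrable M (\<lambda>\<omega>. G \<omega> * ((W t \<omega> - W s \<omega>) $ i * (W t \<omega> - W s \<omega>) $ j))"
    using indep_var_integrable[OF iv2 G(2) cov(1)] by (simp add: D_def)
  show "(\<integral>\<omega>. G \<omega> * ((W t \<omega> - W s \<omega>) $ i * (W t \<omega> - W s \<omega>) $ j) \<partial>M)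
      = (if i = j then (t - s) * (\<integral>\<omega>. G \<omega> \<partial>M) else 0)"
    using indep_var_lebesgue_integral[OF iv2 G(2) cov(1)] cov(2) by (simp add: D_def)
qed

text \<open>Rounding the time down to a grid of width 1/(n + 1) leaves countably many random
  variables, hence a jointly measurable function; continuity of the paths makes it converge
  pointwise.\<close>

lemma continuous_process_measurable:
  fixes V :: "real \<Rightarrow> 'a \<Rightarrow> 'b :: euclidean_space"
  assumes V: "\<And>t. V t \<in> borel_measurable M" and cont: "\<And>\<omega>. \<omega> \<in> space M \<Longrightarrow> continuous_on UNIV (\<lambda>t. V t \<omega>)"
  shows "case_prod V \<in> borel_measurable (borel \<Otimes>\<^sub>M M)"
proof (rule borel_measurable_LIMSEQ_metric)
  define V' where "V' n x = V (real_of_int \<lfloor>fst x * real (Suc n)\<rfloor> / real (Suc n)) (snd x)" for n and x :: "real \<times> 'a"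
  show "V' n \<in> borel_measurable (borel \<Otimes>\<^sub>M M)" for n
  proof -
    have g: "(\<lambda>x :: real \<times> 'a. \<lfloor>fst x * real (Suc n)\<rfloor>) \<in> measurable (borel \<Otimes>\<^sub>M M) (count_space UNIV)"
      by measurable
    have "(\<lambda>x. V (real_of_int k / real (Suc n)) (snd x)) \<in> borel_measurable (borel \<Otimes>\<^sub>M M)" for k
      by (rule measurable_compose[OF measurable_snd V])
    from measurable_compose_countable'[OF this g] show ?thesis
      unfolding V'_def[abs_def] by simp
  qed
  show "(\<lambda>n. V' n x) \<longlonglongrightarrow> case_prod V x" if x: "x \<in> space (borel \<Otimes>\<^sub>M M)" for x
  proof -
    have "(\<lambda>n. real_of_int \<lfloor>fst x * real (Suc n)\<rfloor> / real (Suc n)) \<longlonglongrightarrow> fst x"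
    proof (rule tendsto_sandwich[OF _ _ _ tendsto_const])
      show "\<forall>\<^sub>F n in sequentially. fst x - 1 / real (Suc n) \<le> real_of_int \<lfloor>fst x * real (Suc n)\<rfloor> / real (Suc n)"
      proof (rule eventuallyI)
        fix n
        have "fst x * real (Suc n) - 1 \<le> real_of_int \<lfloor>fst x * real (Suc n)\<rfloor>" by linarith
        then have "(fst x * real (Suc n) - 1) / real (Suc n) \<le> real_of_int \<lfloor>fst x * real (Suc n)\<rfloor> / real (Suc n)"
          by (intro divide_right_mono) auto
        then show "fst x - 1 / real (Suc n) \<le> real_of_int \<lfloor>fst x * real (Suc n)\<rfloor> / real (Suc n)"
          by (simp add: diff_divide_distrib)
      qed
      show "\<forall>\<^sub>F n in sequentially. real_of_int \<lfloor>fst x * real (Suc n)\<rfloor> / real (Suc n) \<le> fst x"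
      proof (rule eventuallyI)
        fix n
        have "real_of_int \<lfloor>fst x * real (Suc n)\<rfloor> \<le> fst x * real (Suc n)" by linarith
        then show "real_of_int \<lfloor>fst x * real (Suc n)\<rfloor> / real (Suc n) \<le> fst x"
          by (simp add: divide_le_eq)
      qed
      show "(\<lambda>n. fst x - 1 / real (Suc n)) \<longlonglongrightarrow> fst x"
        using tendsto_diff[OF tendsto_const LIMSEQ_inverse_real_of_nat, of "fst x"] by (simp add: inverse_eq_divide)
    qed
    moreover have "isCont (\<lambda>t. V t (snd x)) (fst x)"
      using cont[of "snd x"] x by (auto simp: space_pair_measure continuous_on_eq_continuous_at)
    ultimately show ?thesis
      unfolding V'_def case_prod_beta' by (rule isCont_tendsto_compose[rotated])
  qed
qed

text \<open>The paths of \<open>W\<close> are continuous only outside a null set, so joint measurability is available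
  only after changing \<open>W\<close> on that set.\<close>

lemma brownian_basis_modification:
  fixes W :: "real \<Rightarrow> 'a \<Rightarrow> real ^ 'd"
  assumes "prob_space M" "complete_measure M" and W: "standard_brownian_motion M W"
    and F: "\<And>t. 0 \<le> t \<Longrightarrow> sets (F t) = sets (brownian_filtration M W t)"
  obtains W' where "brownian_basis M F W'" "\<And>t. 0 \<le> t \<Longrightarrow> AE \<omega> in M. W' t \<omega> = W t \<omega>"
proof -
  interpret prob_space M by fact
  obtain N where N: "{\<omega>\<in>space M. \<not> continuous_on {0..} (\<lambda>t. W t \<omega>)} \<subseteq> N" "emeasure M N = 0" "N \<in> sets M"
    by (rule AE_E[OF standard_brownian_motionD(3)[OF W]])
  note N = N(1) null_setsI[OF N(2,3)]
  \<comment> \<open>Zero on the exceptional set and constant before time 0, so that every path is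
    continuous on the whole line.\<close>
  define W' where "W' t \<omega> = (if \<omega> \<in> N then 0 else W (max 0 t) \<omega>)" for t \<omega>
  have AE: "AE \<omega> in M. W' t \<omega> = W t \<omega>" if "0 \<le> t" for t
    using AE_not_in[OF N(2)] by eventually_elim (use that in \<open>simp add: W'_def\<close>)
  have spF: "space (F t) = space M" if "0 \<le> t" for t
    using sets_eq_imp_space_eq[OF F[OF that]] sets_brownian_filtration(2)[OF W] by simp
  have bmF: "borel_measurable (F t) = borel_measurable (brownian_filtration M W t)" if "0 \<le> t" for t
    by (rule measurable_cong_sets[OF F[OF that] refl])
  have gen: "{W s -` A \<inter> space M | s A. s \<in> {0..t} \<and> A \<in> sets borel} \<union> null_sets M \<subseteq> sets (F t)" if "0 \<le> t" for t
    unfolding F[OF that] sets_brownian_filtration[OF W] by (rule sigma_sets_superset_generator)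
  have null: "null_sets M \<subseteq> sets (F t)" if "0 \<le> t" for t using gen[OF that] by blast
  have W_F: "W t \<in> borel_measurable (F t)" if "0 \<le> t" for t
  proof (rule measurableI)
    fix A :: "(real ^ 'd) set" assume "A \<in> sets borel"
    then show "W t -` A \<inter> space (F t) \<in> sets (F t)"
      using gen[OF that] that by (auto simp: spF[OF that])
  qed simp
  have W'_F: "W' t \<in> borel_measurable (F t)" if "0 \<le> t" for t
  proof -
    have "N \<inter> space (F t) \<in> sets (F t)" using null[OF that] N(2) by auto
    then show ?thesis
      unfolding W'_def[abs_def] using that W_F[OF that]
      by (intro measurable_If_set) auto
  qed
  have sub: "subalgebra M (F t)" if "0 \<le> t" for t
    unfolding subalgebra_def F[OF that] spF[OF that] using sets_brownian_filtration(3)[OF W] by simp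
  have W'_M: "W' t \<in> borel_measurable M" for t
  proof -
    have "W' t = W' (max 0 t)" by (simp add: W'_def fun_eq_iff)
    then show ?thesis using measurable_from_subalg[OF sub W'_F, of "max 0 t"] by simp
  qed
  have joint: "case_prod W' \<in> borel_measurable (borel \<Otimes>\<^sub>M M)"
  proof (rule continuous_process_measurable[OF W'_M])
    fix \<omega> assume \<omega>: "\<omega> \<in> space M"
    show "continuous_on UNIV (\<lambda>t. W' t \<omega>)"
    proof (cases "\<omega> \<in> N")
      case False
      then have "continuous_on {0..} (\<lambda>t. W t \<omega>)" using N \<omega> by auto
      then have "continuous_on UNIV (\<lambda>t. W (max 0 t) \<omega>)"
        by (rule continuous_on_compose2) (auto intro!: continuous_intros)
      then show ?thesis using False by (simp add: W'_def)
    qed (simp add: W'_def)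
  qed
  have W'm: "W' t \<in> borel_measurable M" and Wm: "0 \<le> t \<Longrightarrow> W t \<in> borel_measurable M" for t
    by (rule W'_M, rule standard_brownian_motionD(1)[OF W])
  have nth_m [measurable]: "(\<lambda>x. x $ i) \<in> borel_measurable borel" for i :: 'd
    by (intro borel_measurable_continuous_onI continuous_intros)
  \<comment> \<open>General G and g let one argument cover the mean, the covariance and the fourth
    moment.\<close>
  have transfer: "integrable M (\<lambda>\<omega>. G \<omega> * g (W' t \<omega> - W' s \<omega>)) \<and> (\<integral>\<omega>. G \<omega> * g (W' t \<omega> - W' s \<omega>) \<partial>M) = c"
    if st: "0 \<le> s" "s < t" and [measurable]: "G \<in> borel_measurable M" "g \<in> borel_measurable borel"
      and i: "integrable M (\<lambda>\<omega>. G \<omega> * g (W t \<omega> - W s \<omega>))" "(\<integral>\<omega>. G \<omega> * g (W t \<omega> - W s \<omega>) \<partial>M) = c"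
    for s t c and G :: "'a \<Rightarrow> real" and g :: "real ^ 'd \<Rightarrow> real"
  proof -
    have [measurable]: "W t \<in> borel_measurable M" "W s \<in> borel_measurable M"
        "W' t \<in> borel_measurable M" "W' s \<in> borel_measurable M"
      using st W'm Wm by auto
    have ae: "AE \<omega> in M. G \<omega> * g (W' t \<omega> - W' s \<omega>) = G \<omega> * g (W t \<omega> - W s \<omega>)"
      using AE[of t] AE[of s] st by (auto elim!: eventually_elim2)
    have "integrable M (\<lambda>\<omega>. G \<omega> * g (W' t \<omega> - W' s \<omega>))"
      by (rule integrable_cong_AE[OF _ _ ae, THEN iffD2]) (use i(1) in simp_all)
    moreover have "(\<integral>\<omega>. G \<omega> * g (W' t \<omega> - W' s \<omega>) \<partial>M) = c"
      using integral_cong_AE[OF _ _ ae] i(2) by simp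
    ultimately show ?thesis by simp
  qed
  have "brownian_basis M F W'"
  proof
    fix s t :: real assume "0 \<le> s" "s \<le> t"
    then show "sets (F s) \<subseteq> sets (F t)"
      unfolding F[OF \<open>0 \<le> s\<close>] F[OF order_trans[OF \<open>0 \<le> s\<close> \<open>s \<le> t\<close>]] sets_brownian_filtration[OF W]
    proof (intro sigma_sets_mono' Un_mono order_refl)
      show "{W u -` A \<inter> space M | u A. u \<in> {0..s} \<and> A \<in> sets borel}
          \<subseteq> {W u -` A \<inter> space M | u A. u \<in> {0..t} \<and> A \<in> sets borel}"
      proof
        fix x assume "x \<in> {W u -` A \<inter> space M | u A. u \<in> {0..s} \<and> A \<in> sets borel}"
        then obtain u A where "x = W u -` A \<inter> space M" "0 \<le> u" "u \<le> s" "A \<in> sets borel" by auto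
        then show "x \<in> {W u -` A \<inter> space M | u A. u \<in> {0..t} \<and> A \<in> sets borel}"
          using \<open>s \<le> t\<close> by (intro CollectI exI[of _ u] exI[of _ A]) auto
      qed
    qed
  next
    fix s t :: real and i :: 'd assume st: "0 \<le> s" "s < t"
    show "integrable M (\<lambda>\<omega>. ((W' t \<omega> - W' s \<omega>) $ i) ^ 4) \<and>
      (\<integral>\<omega>. ((W' t \<omega> - W' s \<omega>) $ i) ^ 4 \<partial>M) = 3 * (t - s)\<^sup>2"
    proof -
      have 1: "(\<lambda>_. 1 :: real) \<in> borel_measurable (brownian_filtration M W s)" "integrable M (\<lambda>_. 1 :: real)"
        by simp_all
      have "integrable M (\<lambda>\<omega>. 1 * ((W' t \<omega> - W' s \<omega>) $ i) ^ 4) \<and>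
        (\<integral>\<omega>. 1 * ((W' t \<omega> - W' s \<omega>) $ i) ^ 4 \<partial>M) = 3 * (t - s)\<^sup>2"
        by (rule transfer[OF st, of "\<lambda>_. 1" "\<lambda>x. (x $ i) ^ 4"])
           (use brownian_increment_moments(5,6)[OF W st 1, of i] in simp_all)
      then show ?thesis by simp
    qed
    fix G :: "'a \<Rightarrow> real" assume G: "G \<in> borel_measurable (F s)" "integrable M G"
    note G' = G(1)[unfolded bmF[OF st(1)]] G(2)
    have GM: "G \<in> borel_measurable M" using G(2) by (rule borel_measurable_integrable)
    show "integrable M (\<lambda>\<omega>. G \<omega> * (W' t \<omega> - W' s \<omega>) $ i) \<and>
      (\<integral>\<omega>. G \<omega> * (W' t \<omega> - W' s \<omega>) $ i \<partial>M) = 0"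
      using transfer[OF st GM nth_m[of i], OF brownian_increment_moments(1,2)[OF W st G']] .
    fix j
    show "integrable M (\<lambda>\<omega>. G \<omega> * ((W' t \<omega> - W' s \<omega>) $ i * (W' t \<omega> - W' s \<omega>) $ j)) \<and>
      (\<integral>\<omega>. G \<omega> * ((W' t \<omega> - W' s \<omega>) $ i * (W' t \<omega> - W' s \<omega>) $ j) \<partial>M)
        = (if i = j then (t - s) * (\<integral>\<omega>. G \<omega> \<partial>M) else 0)"
      using transfer[OF st GM _ brownian_increment_moments(3,4)[OF W st G'], of i j] by measurable
  qed (rule complete_measure.complete[OF assms(2)] sub null W'_F joint; assumption?)+
  then show thesis using AE by (rule that)
qed

context brownian_basis
begin

lemma from_F: "0 \<le> t \<Longrightarrow> f \<in> measurable (F t) N \<Longrightarrow> f \<in> measurable M N"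
  by (rule measurable_from_subalg[OF F_subalgebra])

lemma F_le: "0 \<le> s \<Longrightarrow> s \<le> t \<Longrightarrow> f \<in> measurable (F s) N \<Longrightarrow> f \<in> measurable (F t) N"
  using F_mono[of s t] F_subalgebra[of s] F_subalgebra[of t]
  by (intro measurable_from_subalg[of "F t" "F s"]) (auto simp: subalgebra_def)

text \<open>The functions differ on a subset of a null set; by completeness all such subsets are
  null, hence members of \<open>F t\<close>. This will make approximants adapted whose drift
  integral is not known to be adapted.\<close>

lemma F_AE_eq:
  assumes t: "0 \<le> t" and f: "f \<in> borel_measurable (F t)" and g: "AE \<omega> in M. g \<omega> = f \<omega>"
  shows "g \<in> borel_measurable (F t)"
proof (rule measurableI)
  interpret C: complete_measure M by (rule complete)
  have sp: "space (F t) = space M" using F_subalgebra[OF t] by (simp add: subalgebra_def)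
  fix A :: "'b set" assume A: "A \<in> sets borel"
  obtain N where N: "{\<omega>\<in>space M. g \<omega> \<noteq> f \<omega>} \<subseteq> N" "emeasure M N = 0" "N \<in> sets M"
    by (rule AE_E[OF g])
  note N = N(1) null_setsI[OF N(2,3)]
  have sub: "B \<in> sets (F t)" if "B \<subseteq> N" for B
  proof -
    have "B \<in> null_sets M" using C.complete2[OF that N(2)] .
    then show ?thesis using F_null[OF t] by blast
  qed
  have "g -` A \<inter> space (F t) = (f -` A \<inter> space (F t) - N) \<union> (g -` A \<inter> space (F t) \<inter> N)"
  proof -
    have "g \<omega> = f \<omega>" if "\<omega> \<in> space M" "\<omega> \<notin> N" for \<omega> using N(1) that by auto
    then show ?thesis by (auto simp: sp)
  qed
  also have "\<dots> \<in> sets (F t)"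
    using measurable_sets[OF f A] sub by (intro sets.Un sets.Diff) auto
  finally show "g -` A \<inter> space (F t) \<in> sets (F t)" .
qed simp

end

context brownian_basis
begin

text \<open>The inner product is expanded in coordinates, and the factors G and H, both known at
  time a, are collected in front of the increments. Only the diagonal covariances survive and leave
  |H|^2.\<close>

lemma increment_product:
  assumes ab: "0 \<le> a" "a < b" and H: "H \<in> borel_measurable (F a)" "\<forall>\<omega>\<in>space M. norm (H \<omega>) \<le> N"
  shows "square_integrable M G \<Longrightarrow> G \<in> borel_measurable (F a) \<Longrightarrow>
      integrable M (\<lambda>\<omega>. G \<omega> * (H \<omega> \<bullet> (W b \<omega> - W a \<omega>)))"
    and "square_integrable M G \<Longrightarrow> G \<in> borel_measurable (F a) \<Longrightarrow>
      (\<integral>\<omega>. G \<omega> * (H \<omega> \<bullet> (W b \<omega> - W a \<omega>)) \<partial>M) = 0"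
    and "G \<in> borel_measurable (F a) \<Longrightarrow> (\<And>\<omega>. \<omega> \<in> space M \<Longrightarrow> \<bar>G \<omega>\<bar> \<le> c) \<Longrightarrow>
      integrable M (\<lambda>\<omega>. G \<omega> * (H \<omega> \<bullet> (W b \<omega> - W a \<omega>))\<^sup>2)"
    and "G \<in> borel_measurable (F a) \<Longrightarrow> (\<And>\<omega>. \<omega> \<in> space M \<Longrightarrow> \<bar>G \<omega>\<bar> \<le> c) \<Longrightarrow>
      (\<integral>\<omega>. G \<omega> * (H \<omega> \<bullet> (W b \<omega> - W a \<omega>))\<^sup>2 \<partial>M) = (b - a) * (\<integral>\<omega>. G \<omega> * (norm (H \<omega>))\<^sup>2 \<partial>M)"
    and "square_integrable M (\<lambda>\<omega>. H \<omega> \<bullet> (W b \<omega> - W a \<omega>))"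
    and "(\<integral>\<omega>. (H \<omega> \<bullet> (W b \<omega> - W a \<omega>))\<^sup>2 \<partial>M) \<le> N\<^sup>2 * (b - a)"
    and "integrable M (\<lambda>\<omega>. (H \<omega> \<bullet> (W b \<omega> - W a \<omega>)) ^ 4)"
    and "(\<integral>\<omega>. (H \<omega> \<bullet> (W b \<omega> - W a \<omega>)) ^ 4 \<partial>M) \<le> 3 * (real CARD('d))\<^sup>2 * N ^ 4 * (b - a)\<^sup>2"
proof -
  note H = H(1) H(2)[rule_format]
  define D where "D \<omega> = W b \<omega> - W a \<omega>" for \<omega>
  have nth_m [measurable]: "(\<lambda>x. x $ i) \<in> borel_measurable borel" for i :: 'd
    by (intro borel_measurable_continuous_onI continuous_intros)
  have HF: "(\<lambda>\<omega>. H \<omega> $ i) \<in> borel_measurable (F a)" for i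
    by (rule measurable_compose[OF H(1) nth_m])
  have HM [measurable]: "H \<in> borel_measurable M" by (rule from_F[OF ab(1) H(1)])
  have [measurable]: "W a \<in> borel_measurable M" "W b \<in> borel_measurable M"
    using ab by (auto intro!: from_F[OF _ W_adapted])
  have DM [measurable]: "D \<in> borel_measurable M" unfolding D_def[abs_def] by simp
  have Hi: "\<bar>H \<omega> $ i\<bar> \<le> N" if "\<omega> \<in> space M" for \<omega> i
    using component_le_norm_cart[of "H \<omega>" i] H(2)[OF that] by simp
  obtain \<omega>0 where "\<omega>0 \<in> space M" using not_empty by auto
  then have N0: "0 \<le> N" using H(2)[of \<omega>0] norm_ge_zero order_trans by blast
  have inner: "H \<omega> \<bullet> D \<omega> = (\<Sum>i\<in>UNIV. H \<omega> $ i * D \<omega> $ i)" for \<omega>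
    by (simp add: inner_vec_def)
  have 1: "integrable M (\<lambda>\<omega>. G \<omega> * (H \<omega> \<bullet> D \<omega>)) \<and> (\<integral>\<omega>. G \<omega> * (H \<omega> \<bullet> D \<omega>) \<partial>M) = 0"
    if G: "square_integrable M G" "G \<in> borel_measurable (F a)" for G
  proof -
    have [measurable]: "G \<in> borel_measurable M" using G(1) by measurable
    have Gi: "integrable M (\<lambda>\<omega>. G \<omega> * H \<omega> $ i)" for i
    proof (rule Bochner_Integration.integrable_bound)
      show "integrable M (\<lambda>\<omega>. N * G \<omega>)" using square_integrable_integrable[OF G(1)] by simp
      show "AE \<omega> in M. norm (G \<omega> * H \<omega> $ i) \<le> norm (N * G \<omega>)"
      proof (rule AE_I2)
        fix \<omega> assume "\<omega> \<in> space M"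
        then show "norm (G \<omega> * H \<omega> $ i) \<le> norm (N * G \<omega>)"
          using mult_left_mono[OF Hi[of \<omega> i], of "\<bar>G \<omega>\<bar>"] N0 by (simp add: abs_mult mult.commute)
      qed
    qed measurable
    have m: "(\<lambda>\<omega>. G \<omega> * H \<omega> $ i) \<in> borel_measurable (F a)" for i
      using G(2) HF by (intro borel_measurable_times)
    note w = W_mean[OF ab m Gi, folded D_def]
    have eq: "(\<lambda>\<omega>. G \<omega> * (H \<omega> \<bullet> D \<omega>)) = (\<lambda>\<omega>. \<Sum>i\<in>UNIV. G \<omega> * H \<omega> $ i * D \<omega> $ i)"
      by (simp add: inner sum_distrib_left mult.assoc)
    have "(\<integral>\<omega>. (\<Sum>i\<in>UNIV. G \<omega> * H \<omega> $ i * D \<omega> $ i) \<partial>M) = (\<Sum>i\<in>UNIV. \<integral>\<omega>. G \<omega> * H \<omega> $ i * D \<omega> $ i \<partial>M)"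
      by (rule Bochner_Integration.integral_sum) (use w in blast)
    also have "\<dots> = 0" using w by (simp add: D_def)
    finally show ?thesis
      unfolding eq using w by (intro conjI Bochner_Integration.integrable_sum) blast+
  qed
  show "square_integrable M G \<Longrightarrow> G \<in> borel_measurable (F a) \<Longrightarrow>
      integrable M (\<lambda>\<omega>. G \<omega> * (H \<omega> \<bullet> (W b \<omega> - W a \<omega>)))"
    "square_integrable M G \<Longrightarrow> G \<in> borel_measurable (F a) \<Longrightarrow>
      (\<integral>\<omega>. G \<omega> * (H \<omega> \<bullet> (W b \<omega> - W a \<omega>)) \<partial>M) = 0"
    using 1[of G] by (simp_all add: D_def)
  have 2: "integrable M (\<lambda>\<omega>. G \<omega> * (H \<omega> \<bullet> D \<omega>)\<^sup>2) \<and>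
      (\<integral>\<omega>. G \<omega> * (H \<omega> \<bullet> D \<omega>)\<^sup>2 \<partial>M) = (b - a) * (\<integral>\<omega>. G \<omega> * (norm (H \<omega>))\<^sup>2 \<partial>M)"
    if G: "G \<in> borel_measurable (F a)" "\<And>\<omega>. \<omega> \<in> space M \<Longrightarrow> \<bar>G \<omega>\<bar> \<le> c" for G c
  proof -
    have [measurable]: "G \<in> borel_measurable M" by (rule from_F[OF ab(1) G(1)])
    have Gi: "integrable M (\<lambda>\<omega>. G \<omega> * (H \<omega> $ i * H \<omega> $ j))" for i j
    proof (rule integrable_const_bound[where B = "c * (N * N)"])
      show "AE \<omega> in M. norm (G \<omega> * (H \<omega> $ i * H \<omega> $ j)) \<le> c * (N * N)"
      proof (rule AE_I2)
        fix \<omega> assume \<omega>: "\<omega> \<in> space M"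
        have "\<bar>G \<omega>\<bar> * (\<bar>H \<omega> $ i\<bar> * \<bar>H \<omega> $ j\<bar>) \<le> c * (N * N)"
          using G(2)[OF \<omega>] Hi[OF \<omega>] N0 by (intro mult_mono) (auto intro: order_trans[OF abs_ge_zero])
        then show "norm (G \<omega> * (H \<omega> $ i * H \<omega> $ j)) \<le> c * (N * N)" by (simp add: abs_mult)
      qed
    qed measurable
    have m: "(\<lambda>\<omega>. G \<omega> * (H \<omega> $ i * H \<omega> $ j)) \<in> borel_measurable (F a)" for i j
      using G(1) HF by (intro borel_measurable_times)
    note w = W_cov[OF ab m Gi, folded D_def]
    have eq: "(\<lambda>\<omega>. G \<omega> * (H \<omega> \<bullet> D \<omega>)\<^sup>2) = (\<lambda>\<omega>. \<Sum>i\<in>UNIV. \<Sum>j\<in>UNIV. G \<omega> * (H \<omega> $ i * H \<omega> $ j) * (D \<omega> $ i * D \<omega> $ j))"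
      by (simp add: inner power2_eq_square sum_product sum_distrib_left mult_ac)
    have "(\<integral>\<omega>. (\<Sum>i\<in>UNIV. \<Sum>j\<in>UNIV. G \<omega> * (H \<omega> $ i * H \<omega> $ j) * (D \<omega> $ i * D \<omega> $ j)) \<partial>M)
        = (\<Sum>i\<in>UNIV. \<Sum>j\<in>UNIV. \<integral>\<omega>. G \<omega> * (H \<omega> $ i * H \<omega> $ j) * (D \<omega> $ i * D \<omega> $ j) \<partial>M)"
      by (simp add: Bochner_Integration.integral_sum Bochner_Integration.integrable_sum conjunct1[OF w])
    also have "\<dots> = (\<Sum>i\<in>UNIV. \<Sum>j\<in>UNIV. if i = j then (b - a) * (\<integral>\<omega>. G \<omega> * (H \<omega> $ i * H \<omega> $ j) \<partial>M) else 0)"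
      using w by (intro sum.cong refl) blast
    also have "\<dots> = (\<Sum>i\<in>UNIV. (b - a) * (\<integral>\<omega>. G \<omega> * (H \<omega> $ i * H \<omega> $ i) \<partial>M))"
      by (simp add: sum.delta)
    also have "\<dots> = (b - a) * (\<integral>\<omega>. (\<Sum>i\<in>UNIV. G \<omega> * (H \<omega> $ i * H \<omega> $ i)) \<partial>M)"
      using Gi by (simp add: Bochner_Integration.integral_sum sum_distrib_left)
    also have "(\<lambda>\<omega>. \<Sum>i\<in>UNIV. G \<omega> * (H \<omega> $ i * H \<omega> $ i)) = (\<lambda>\<omega>. G \<omega> * (norm (H \<omega>))\<^sup>2)"
      by (simp add: power2_norm_eq_inner inner_vec_def sum_distrib_left)
    finally show ?thesis
      unfolding eq using w by (intro conjI Bochner_Integration.integrable_sum) blast+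
  qed
  show "G \<in> borel_measurable (F a) \<Longrightarrow> (\<And>\<omega>. \<omega> \<in> space M \<Longrightarrow> \<bar>G \<omega>\<bar> \<le> c) \<Longrightarrow>
      integrable M (\<lambda>\<omega>. G \<omega> * (H \<omega> \<bullet> (W b \<omega> - W a \<omega>))\<^sup>2)"
    "G \<in> borel_measurable (F a) \<Longrightarrow> (\<And>\<omega>. \<omega> \<in> space M \<Longrightarrow> \<bar>G \<omega>\<bar> \<le> c) \<Longrightarrow>
      (\<integral>\<omega>. G \<omega> * (H \<omega> \<bullet> (W b \<omega> - W a \<omega>))\<^sup>2 \<partial>M) = (b - a) * (\<integral>\<omega>. G \<omega> * (norm (H \<omega>))\<^sup>2 \<partial>M)"
    using 2[of G c] by (simp_all add: D_def)
  have one: "(\<lambda>_. 1 :: real) \<in> borel_measurable (F a)" by simp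
  from 2[OF one, of 1] have sq: "integrable M (\<lambda>\<omega>. (H \<omega> \<bullet> D \<omega>)\<^sup>2)"
    "(\<integral>\<omega>. (H \<omega> \<bullet> D \<omega>)\<^sup>2 \<partial>M) = (b - a) * (\<integral>\<omega>. (norm (H \<omega>))\<^sup>2 \<partial>M)" by simp_all
  show "square_integrable M (\<lambda>\<omega>. H \<omega> \<bullet> (W b \<omega> - W a \<omega>))"
    using sq(1) by (simp add: square_integrable_def D_def)
  have "(\<integral>\<omega>. (norm (H \<omega>))\<^sup>2 \<partial>M) \<le> (\<integral>\<omega>. N\<^sup>2 \<partial>M)"
  proof (rule integral_mono)
    have bd: "(norm (H \<omega>))\<^sup>2 \<le> N\<^sup>2" if "\<omega> \<in> space M" for \<omega>
      using H(2)[OF that] by (intro power_mono) auto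
    then show "\<And>\<omega>. \<omega> \<in> space M \<Longrightarrow> (norm (H \<omega>))\<^sup>2 \<le> N\<^sup>2" .
    show "integrable M (\<lambda>\<omega>. (norm (H \<omega>))\<^sup>2)"
      by (rule integrable_const_bound[where B = "N\<^sup>2"]) (use bd in auto)
  qed simp
  then have "(b - a) * (\<integral>\<omega>. (norm (H \<omega>))\<^sup>2 \<partial>M) \<le> (b - a) * N\<^sup>2"
    using ab by (intro mult_left_mono) (simp_all add: prob_space)
  then show "(\<integral>\<omega>. (H \<omega> \<bullet> (W b \<omega> - W a \<omega>))\<^sup>2 \<partial>M) \<le> N\<^sup>2 * (b - a)"
    using sq(2) by (simp add: D_def mult.commute)
  \<comment> \<open>Cauchy-Schwarz twice: the inner product gives N^4, and the sum of squares over
    the d coordinates gives a factor d. The second factor d and the 3 in the final bound come from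
    adding up d Gaussian fourth moments.\<close>
  have bd4: "(H \<omega> \<bullet> D \<omega>) ^ 4 \<le> N ^ 4 * (real CARD('d) * (\<Sum>i\<in>UNIV. (D \<omega> $ i) ^ 4))" if \<omega>: "\<omega> \<in> space M" for \<omega>
  proof -
    have "(H \<omega> \<bullet> D \<omega>)\<^sup>2 \<le> (H \<omega> \<bullet> H \<omega>) * (D \<omega> \<bullet> D \<omega>)" by (rule Cauchy_Schwarz_ineq)
    also have "\<dots> \<le> N\<^sup>2 * (D \<omega> \<bullet> D \<omega>)"
      using power_mono[OF H(2)[OF \<omega>], of 2] by (intro mult_right_mono) (auto simp: power2_norm_eq_inner)
    finally have "((H \<omega> \<bullet> D \<omega>)\<^sup>2)\<^sup>2 \<le> (N\<^sup>2 * (D \<omega> \<bullet> D \<omega>))\<^sup>2" by (rule power_mono) simp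
    also have "\<dots> = N ^ 4 * (\<Sum>i\<in>UNIV. (D \<omega> $ i)\<^sup>2)\<^sup>2"
      by (simp add: power_mult_distrib inner_vec_def power2_eq_square[of "D \<omega> $ _"])
    also have "\<dots> \<le> N ^ 4 * ((\<Sum>i\<in>UNIV. ((D \<omega> $ i)\<^sup>2)\<^sup>2) * real CARD('d))"
      by (intro mult_left_mono sum_squared_le_sum_of_squares) auto
    finally show ?thesis by (simp add: mult_ac)
  qed
  have i4: "integrable M (\<lambda>\<omega>. N ^ 4 * (real CARD('d) * (\<Sum>i\<in>UNIV. (D \<omega> $ i) ^ 4)))"
    using W_moment4[OF ab] by (intro integrable_mult_right Bochner_Integration.integrable_sum) (simp add: D_def)
  show "integrable M (\<lambda>\<omega>. (H \<omega> \<bullet> (W b \<omega> - W a \<omega>)) ^ 4)"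
    unfolding D_def[symmetric]
  proof (rule Bochner_Integration.integrable_bound[OF i4])
    show "AE \<omega> in M. norm ((H \<omega> \<bullet> D \<omega>) ^ 4) \<le> norm (N ^ 4 * (real CARD('d) * (\<Sum>i\<in>UNIV. (D \<omega> $ i) ^ 4)))"
    proof (rule AE_I2)
      fix \<omega> assume "\<omega> \<in> space M"
      from bd4[OF this] show "norm ((H \<omega> \<bullet> D \<omega>) ^ 4) \<le> norm (N ^ 4 * (real CARD('d) * (\<Sum>i\<in>UNIV. (D \<omega> $ i) ^ 4)))"
        by simp
    qed
  qed measurable
  from this[folded D_def] have "(\<integral>\<omega>. (H \<omega> \<bullet> D \<omega>) ^ 4 \<partial>M) \<le> (\<integral>\<omega>. N ^ 4 * (real CARD('d) * (\<Sum>i\<in>UNIV. (D \<omega> $ i) ^ 4)) \<partial>M)"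
    by (rule integral_mono[OF _ i4 bd4])
  also have "\<dots> = N ^ 4 * (real CARD('d) * (\<Sum>i\<in>(UNIV :: 'd set). \<integral>\<omega>. (D \<omega> $ i) ^ 4 \<partial>M))"
    using W_moment4[OF ab] by (simp add: D_def Bochner_Integration.integral_sum)
  also have "\<dots> = 3 * (real CARD('d))\<^sup>2 * N ^ 4 * (b - a)\<^sup>2"
    using W_moment4[OF ab] by (simp add: D_def power2_eq_square)
  finally show "(\<integral>\<omega>. (H \<omega> \<bullet> (W b \<omega> - W a \<omega>)) ^ 4 \<partial>M) \<le> 3 * (real CARD('d))\<^sup>2 * N ^ 4 * (b - a)\<^sup>2"
    by (simp add: D_def)
qed

section \<open>Stochastic integrals of step processes\<close>

text \<open>The integral formula is asked on every interval without interior breakpoints instead of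
  along a partition. It then localises at once, and for a difference of two integrals the breakpoint
  sets are simply united, without a common refinement.\<close>

definition step_integral :: "real \<Rightarrow> real set \<Rightarrow> real \<Rightarrow> (real \<Rightarrow> 'a \<Rightarrow> real ^ 'd) \<Rightarrow> (real \<Rightarrow> 'a \<Rightarrow> real) \<Rightarrow> bool" where
  "step_integral T P N z J \<longleftrightarrow> finite P \<and>
     case_prod J \<in> borel_measurable (time_space M 0 T) \<and>
     case_prod z \<in> borel_measurable (time_space M 0 T) \<and>
     (\<forall>s\<in>{0..T}. J s \<in> borel_measurable (F s)) \<and>
     (\<forall>\<omega>\<in>space M. J 0 \<omega> = 0) \<and>
     (\<forall>s\<in>{0..T}. \<forall>\<omega>\<in>space M. norm (z s \<omega>) \<le> N) \<and>
     (\<forall>a b. 0 \<le> a \<longrightarrow> a < b \<longrightarrow> b \<le> T \<longrightarrow> P \<inter> {a<..<b} = {} \<longrightarrow>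
       (\<exists>H. H \<in> borel_measurable (F a) \<and> (\<forall>s\<in>{a<..b}. \<forall>\<omega>\<in>space M. z s \<omega> = H \<omega>) \<and>
         (\<forall>s\<in>{a..b}. \<forall>\<omega>\<in>space M. J s \<omega> - J a \<omega> = H \<omega> \<bullet> (W s \<omega> - W a \<omega>))))"

lemma step_integralD:
  assumes "step_integral T P N z J"
  shows "finite P"
    and "case_prod J \<in> borel_measurable (time_space M 0 T)"
    and "case_prod z \<in> borel_measurable (time_space M 0 T)"
    and "\<And>s. s \<in> {0..T} \<Longrightarrow> J s \<in> borel_measurable (F s)"
    and "\<And>\<omega>. \<omega> \<in> space M \<Longrightarrow> J 0 \<omega> = 0"
    and "\<And>s \<omega>. s \<in> {0..T} \<Longrightarrow> \<omega> \<in> space M \<Longrightarrow> norm (z s \<omega>) \<le> N"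
  using assms by (auto simp: step_integral_def)

lemma step_integral_piece:
  assumes "step_integral T P N z J" and ab: "0 \<le> a" "a < b" "b \<le> T" "P \<inter> {a<..<b} = {}"
  obtains H where "H \<in> borel_measurable (F a)" "\<And>\<omega>. \<omega> \<in> space M \<Longrightarrow> norm (H \<omega>) \<le> N"
    "\<And>s \<omega>. s \<in> {a<..b} \<Longrightarrow> \<omega> \<in> space M \<Longrightarrow> z s \<omega> = H \<omega>"
    "\<And>s \<omega>. s \<in> {a..b} \<Longrightarrow> \<omega> \<in> space M \<Longrightarrow> J s \<omega> - J a \<omega> = H \<omega> \<bullet> (W s \<omega> - W a \<omega>)"
proof -
  obtain H where H: "H \<in> borel_measurable (F a)" "\<forall>s\<in>{a<..b}. \<forall>\<omega>\<in>space M. z s \<omega> = H \<omega>"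
    "\<forall>s\<in>{a..b}. \<forall>\<omega>\<in>space M. J s \<omega> - J a \<omega> = H \<omega> \<bullet> (W s \<omega> - W a \<omega>)"
    using assms unfolding step_integral_def by meson
  have "norm (H \<omega>) \<le> N" if "\<omega> \<in> space M" for \<omega>
    using step_integralD(6)[OF assms(1), of b \<omega>] H(2) ab that by force
  then show thesis using H by (intro that) auto
qed

text \<open>Between breakpoints the increment is orthogonal to the past value, so second moments can
  only grow. Bounding them by the value at the final time is what makes later estimates uniform in
  time.\<close>

lemma step_integral_square:
  assumes J: "step_integral T P N z J" and st: "0 \<le> s" "s \<le> t" "t \<le> T"
  shows "square_integrable M (J t)" and "(\<integral>\<omega>. (J s \<omega>)\<^sup>2 \<partial>M) \<le> (\<integral>\<omega>. (J t \<omega>)\<^sup>2 \<partial>M)"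
proof -
  have piece: "square_integrable M (J b) \<and> (\<integral>\<omega>. (J a \<omega>)\<^sup>2 \<partial>M) \<le> (\<integral>\<omega>. (J b \<omega>)\<^sup>2 \<partial>M)"
    if ab: "0 \<le> a" "a < b" "b \<le> T" "P \<inter> {a<..<b} = {}" and Ja: "square_integrable M (J a)" for a b
  proof -
    obtain H where H: "H \<in> borel_measurable (F a)" "\<And>\<omega>. \<omega> \<in> space M \<Longrightarrow> norm (H \<omega>) \<le> N"
      "\<And>s \<omega>. s \<in> {a<..b} \<Longrightarrow> \<omega> \<in> space M \<Longrightarrow> z s \<omega> = H \<omega>"
      "\<And>s \<omega>. s \<in> {a..b} \<Longrightarrow> \<omega> \<in> space M \<Longrightarrow> J s \<omega> - J a \<omega> = H \<omega> \<bullet> (W s \<omega> - W a \<omega>)"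
      by (rule step_integral_piece[OF J ab], rule that)
    define B where "B \<omega> = H \<omega> \<bullet> (W b \<omega> - W a \<omega>)" for \<omega>
    have JF: "J a \<in> borel_measurable (F a)" using step_integralD(4)[OF J, of a] ab by simp
    have "\<forall>\<omega>\<in>space M. norm (H \<omega>) \<le> N" using H(2) by blast
    note inc = increment_product[OF ab(1,2) H(1) this]
    have B: "square_integrable M B" "integrable M (\<lambda>\<omega>. J a \<omega> * B \<omega>)" "(\<integral>\<omega>. J a \<omega> * B \<omega> \<partial>M) = 0"
      using inc(1,2)[OF Ja JF] inc(5) by (simp_all add: B_def[abs_def])
    have Jb: "J b \<omega> = J a \<omega> + B \<omega>" if "\<omega> \<in> space M" for \<omega>
      using H(4)[of b \<omega>] ab that by (simp add: B_def)
    have "J b \<in> borel_measurable M"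
      using step_integralD(4)[OF J, of b] ab by (intro from_F[of b]) auto
    then have sq: "square_integrable M (J b)"
      by (rule square_integrable_bound[OF square_integrable_add[OF Ja B(1)]]) (simp add: Jb)
    have "(\<integral>\<omega>. (J b \<omega>)\<^sup>2 \<partial>M) = (\<integral>\<omega>. (J a \<omega>)\<^sup>2 + 2 * (J a \<omega> * B \<omega>) + (B \<omega>)\<^sup>2 \<partial>M)"
      by (rule Bochner_Integration.integral_cong) (auto simp: Jb power2_eq_square algebra_simps)
    also have "\<dots> = (\<integral>\<omega>. (J a \<omega>)\<^sup>2 \<partial>M) + 2 * (\<integral>\<omega>. J a \<omega> * B \<omega> \<partial>M) + (\<integral>\<omega>. (B \<omega>)\<^sup>2 \<partial>M)"
      using B Ja by (simp add: square_integrableD)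
    also have "\<dots> \<ge> (\<integral>\<omega>. (J a \<omega>)\<^sup>2 \<partial>M)" using B(3) by simp
    finally show ?thesis using sq by simp
  qed
  have sq: "square_integrable M (J t)" if t: "0 \<le> t" "t \<le> T" for t
  proof -
    \<comment> \<open>Square integrability is encoded as 0 or 1, so that its passage through the
      breakpoints becomes an instance of monotonicity.\<close>
    define \<Phi> :: "real \<Rightarrow> real" where "\<Phi> s = (if square_integrable M (J s) then 1 else 0)" for s
    have "\<Phi> 0 \<le> \<Phi> t"
    proof (rule mono_through_breakpoints[OF step_integralD(1)[OF J] t(1)])
      fix c d assume "0 \<le> c" "c < d" "d \<le> t" "P \<inter> {c<..<d} = {}"
      then show "\<Phi> c \<le> \<Phi> d" using piece[of c d] t by (auto simp: \<Phi>_def)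
    qed
    moreover have "square_integrable M (J 0)"
    proof (rule square_integrable_bound[OF square_integrable_zero])
      show "J 0 \<in> borel_measurable M"
        using step_integralD(4)[OF J, of 0] t by (intro from_F[of 0]) auto
    qed (use step_integralD(5)[OF J] in simp)
    ultimately show ?thesis by (auto simp: \<Phi>_def split: if_splits)
  qed
  then show "square_integrable M (J t)" using st by simp
  show "(\<integral>\<omega>. (J s \<omega>)\<^sup>2 \<partial>M) \<le> (\<integral>\<omega>. (J t \<omega>)\<^sup>2 \<partial>M)"
  proof (rule mono_through_breakpoints[OF step_integralD(1)[OF J] st(2)])
    fix c d assume "s \<le> c" "c < d" "d \<le> t" "P \<inter> {c<..<d} = {}"
    then show "(\<integral>\<omega>. (J c \<omega>)\<^sup>2 \<partial>M) \<le> (\<integral>\<omega>. (J d \<omega>)\<^sup>2 \<partial>M)"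
      using piece[of c d] sq[of c] st by simp
  qed
qed

lemma step_integral_diff:
  assumes 1: "step_integral T P1 N1 z1 J1" and 2: "step_integral T P2 N2 z2 J2"
  shows "step_integral T (P1 \<union> P2) (N1 + N2) (\<lambda>s \<omega>. z1 s \<omega> - z2 s \<omega>) (\<lambda>s \<omega>. J1 s \<omega> - J2 s \<omega>)"
  unfolding step_integral_def
proof (intro conjI allI impI ballI)
  show "finite (P1 \<union> P2)" using 1 2 by (simp add: step_integralD)
  show "(\<lambda>(s, \<omega>). J1 s \<omega> - J2 s \<omega>) \<in> borel_measurable (time_space M 0 T)"
    using borel_measurable_diff[OF step_integralD(2)[OF 1] step_integralD(2)[OF 2]] by (simp add: case_prod_beta')
  show "(\<lambda>(s, \<omega>). z1 s \<omega> - z2 s \<omega>) \<in> borel_measurable (time_space M 0 T)"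
    using borel_measurable_diff[OF step_integralD(3)[OF 1] step_integralD(3)[OF 2]] by (simp add: case_prod_beta')
  fix a b assume ab: "0 \<le> a" "a < b" "b \<le> T" "(P1 \<union> P2) \<inter> {a<..<b} = {}"
  then have p: "P1 \<inter> {a<..<b} = {}" "P2 \<inter> {a<..<b} = {}" by auto
  obtain H1 where H1: "H1 \<in> borel_measurable (F a)" "\<And>\<omega>. \<omega> \<in> space M \<Longrightarrow> norm (H1 \<omega>) \<le> N1"
      "\<And>s \<omega>. s \<in> {a<..b} \<Longrightarrow> \<omega> \<in> space M \<Longrightarrow> z1 s \<omega> = H1 \<omega>"
      "\<And>s \<omega>. s \<in> {a..b} \<Longrightarrow> \<omega> \<in> space M \<Longrightarrow> J1 s \<omega> - J1 a \<omega> = H1 \<omega> \<bullet> (W s \<omega> - W a \<omega>)"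
    by (rule step_integral_piece[OF 1 ab(1-3) p(1)], rule that)
  obtain H2 where H2: "H2 \<in> borel_measurable (F a)" "\<And>\<omega>. \<omega> \<in> space M \<Longrightarrow> norm (H2 \<omega>) \<le> N2"
      "\<And>s \<omega>. s \<in> {a<..b} \<Longrightarrow> \<omega> \<in> space M \<Longrightarrow> z2 s \<omega> = H2 \<omega>"
      "\<And>s \<omega>. s \<in> {a..b} \<Longrightarrow> \<omega> \<in> space M \<Longrightarrow> J2 s \<omega> - J2 a \<omega> = H2 \<omega> \<bullet> (W s \<omega> - W a \<omega>)"
    by (rule step_integral_piece[OF 2 ab(1-3) p(2)], rule that)
  have "J1 s \<omega> - J2 s \<omega> - (J1 a \<omega> - J2 a \<omega>) = (H1 \<omega> - H2 \<omega>) \<bullet> (W s \<omega> - W a \<omega>)"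
    if "s \<in> {a..b}" "\<omega> \<in> space M" for s \<omega>
    using H1(4)[OF that] H2(4)[OF that] by (simp add: inner_diff_left)
  then show "\<exists>H. H \<in> borel_measurable (F a) \<and> (\<forall>s\<in>{a<..b}. \<forall>\<omega>\<in>space M. z1 s \<omega> - z2 s \<omega> = H \<omega>) \<and>
         (\<forall>s\<in>{a..b}. \<forall>\<omega>\<in>space M. J1 s \<omega> - J2 s \<omega> - (J1 a \<omega> - J2 a \<omega>) = H \<omega> \<bullet> (W s \<omega> - W a \<omega>))"
    using H1(1,3) H2(1,3) by (intro exI[of _ "\<lambda>\<omega>. H1 \<omega> - H2 \<omega>"]) auto
next
  fix s \<omega> assume "s \<in> {0..T}" "\<omega> \<in> space M"
  then show "norm (z1 s \<omega> - z2 s \<omega>) \<le> N1 + N2"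
    using step_integralD(6)[OF 1, of s \<omega>] step_integralD(6)[OF 2, of s \<omega>] norm_triangle_ineq4[of "z1 s \<omega>" "z2 s \<omega>"]
    by linarith
qed (use step_integralD(4,5)[OF 1] step_integralD(4,5)[OF 2] in auto)

lemma simple_integral_step:
  assumes T: "0 < T" and H: "simple_integrand M F T n \<tau> H"
  obtains P N where "step_integral T P N (simple_process n \<tau> H) (simple_integral W n \<tau> H)"
proof -
  have \<tau>: "\<tau> 0 = 0" "\<tau> n = T" "\<And>i. i < n \<Longrightarrow> \<tau> i < \<tau> (Suc i)" and HF: "\<And>i. i < n \<Longrightarrow> H i \<in> borel_measurable (F (\<tau> i))"
    using H by (auto simp: simple_integrand_def)
  have "\<forall>i. \<exists>B. i < n \<longrightarrow> (\<forall>\<omega>\<in>space M. norm (H i \<omega>) \<le> B)"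
    using H by (auto simp: simple_integrand_def)
  then obtain B where B: "\<And>i \<omega>. i < n \<Longrightarrow> \<omega> \<in> space M \<Longrightarrow> norm (H i \<omega>) \<le> B i" by metis
  have \<tau>_mono: "\<tau> i \<le> \<tau> j" if "i \<le> j" "j \<le> n" for i j
    using that
  proof (induction j rule: dec_induct)
    case (step j)
    then show ?case using \<tau>(3)[of j] by simp
  qed simp
  have \<tau>0: "0 \<le> \<tau> i" "\<tau> i \<le> T" if "i \<le> n" for i
    using \<tau>_mono[of 0 i] \<tau>_mono[of i n] that \<tau> by auto
  have HM: "H i \<in> borel_measurable M" if "i < n" for i
    using HF[OF that] \<tau>0[of i] that by (intro from_F[of "\<tau> i"]) auto
  have Wmeas: "(\<lambda>x. W (min (fst x) c) (snd x)) \<in> borel_measurable (borel \<Otimes>\<^sub>M M)" for c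
  proof -
    have "(\<lambda>x. (min (fst x) c, snd x)) \<in> measurable (borel \<Otimes>\<^sub>M M) (borel \<Otimes>\<^sub>M M)" by measurable
    from measurable_compose[OF this W_measurable] show ?thesis by simp
  qed
  have [measurable]: "(\<lambda>x. H i (snd x)) \<in> borel_measurable (borel \<Otimes>\<^sub>M M)" if "i < n" for i
    by (rule measurable_compose[OF measurable_snd HM[OF that]])
  have ind: "(\<lambda>x. indicator {c<..d} (fst x) :: real) \<in> borel_measurable (borel \<Otimes>\<^sub>M M)" for c d :: real
    by measurable
  have "step_integral T (\<tau> ` {..n}) (\<Sum>i<n. max 0 (B i)) (simple_process n \<tau> H) (simple_integral W n \<tau> H)"
    unfolding step_integral_def
  proof (intro conjI allI impI ballI)
    show "finite (\<tau> ` {..n})" by simp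
    show "case_prod (simple_integral W n \<tau> H) \<in> borel_measurable (time_space M 0 T)"
      unfolding simple_integral_def case_prod_beta'
      by (rule measurable_time_space_restrict[of "\<lambda>s \<omega>. \<Sum>i<n. H i \<omega> \<bullet> (W (min s (\<tau> (Suc i))) \<omega> - W (min s (\<tau> i)) \<omega>)", unfolded case_prod_beta'])
         (intro borel_measurable_sum borel_measurable_inner borel_measurable_diff Wmeas, simp)
    show "case_prod (simple_process n \<tau> H) \<in> borel_measurable (time_space M 0 T)"
      unfolding simple_process_def case_prod_beta'
      by (rule measurable_time_space_restrict[of "\<lambda>s \<omega>. \<Sum>i<n. indicator {\<tau> i<..\<tau> (Suc i)} s *\<^sub>R H i \<omega>", unfolded case_prod_beta'])
         (intro borel_measurable_sum borel_measurable_scaleR ind, simp)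
  next
    fix s assume s: "s \<in> {0..T}"
    show "simple_integral W n \<tau> H s \<in> borel_measurable (F s)"
      unfolding simple_integral_def[abs_def]
    proof (rule borel_measurable_sum)
      fix i assume i: "i \<in> {..<n}"
      have Wm: "W (min s (\<tau> j)) \<in> borel_measurable (F s)" if "j \<le> n" for j
        using s \<tau>0[OF that] by (intro F_le[OF _ _ W_adapted]) auto
      show "(\<lambda>\<omega>. H i \<omega> \<bullet> (W (min s (\<tau> (Suc i))) \<omega> - W (min s (\<tau> i)) \<omega>)) \<in> borel_measurable (F s)"
      proof (cases "\<tau> i \<le> s")
        case True
        have "H i \<in> borel_measurable (F s)"
          using i True \<tau>0[of i] by (intro F_le[OF _ True HF]) auto
        then show ?thesis using i by (intro borel_measurable_inner borel_measurable_diff Wm) auto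
      next
        case False
        \<comment> \<open>Before its cell begins, the summand vanishes identically; it is measurable
          at time s although \<open>H i\<close> need not be.\<close>
        then have "min s (\<tau> (Suc i)) = s" "min s (\<tau> i) = s" using \<tau>(3)[of i] i by auto
        then show ?thesis by simp
      qed
    qed
  next
    fix \<omega> assume "\<omega> \<in> space M"
    have "min 0 (\<tau> i) = 0" if "i \<le> n" for i using \<tau>0[OF that] by simp
    then show "simple_integral W n \<tau> H 0 \<omega> = 0" by (simp add: simple_integral_def)
  next
    fix s \<omega> assume s: "s \<in> {0..T}" "\<omega> \<in> space M"
    have "norm (simple_process n \<tau> H s \<omega>) \<le> (\<Sum>i<n. norm (indicator {\<tau> i<..\<tau> (Suc i)} s *\<^sub>R H i \<omega>))"
      unfolding simple_process_def by (rule norm_sum)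
    also have "\<dots> \<le> (\<Sum>i<n. max 0 (B i))"
    proof (rule sum_mono)
      fix i assume "i \<in> {..<n}"
      then show "norm (indicator {\<tau> i<..\<tau> (Suc i)} s *\<^sub>R H i \<omega>) \<le> max 0 (B i)"
        using B[of i \<omega>] s by (auto split: split_indicator)
    qed
    finally show "norm (simple_process n \<tau> H s \<omega>) \<le> (\<Sum>i<n. max 0 (B i))" .
  next
    fix a b assume ab: "0 \<le> a" "a < b" "b \<le> T" "\<tau> ` {..n} \<inter> {a<..<b} = {}"
    have free: "\<tau> i \<le> a \<or> b \<le> \<tau> i" if "i \<le> n" for i
    proof -
      have "\<tau> i \<notin> {a<..<b}" using ab(4) that by blast
      then show ?thesis by auto
    qed
    \<comment> \<open>The cell that contains the interval. If there were none, induction along the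
      partition would place every \<tau> i at or before a, against \<tau> n = T.\<close>
    have "\<exists>i<n. \<tau> i \<le> a \<and> b \<le> \<tau> (Suc i)"
    proof (rule ccontr)
      assume no: "\<not> (\<exists>i<n. \<tau> i \<le> a \<and> b \<le> \<tau> (Suc i))"
      have "\<tau> i \<le> a" if "i \<le> n" for i
        using that
      proof (induction i)
        case 0
        then show ?case using \<tau> ab by simp
      next
        case (Suc i)
        then show ?case using no free[of "Suc i"] by auto
      qed
      from this[of n] show False using \<tau> ab by simp
    qed
    then obtain i where i: "i < n" "\<tau> i \<le> a" "b \<le> \<tau> (Suc i)" by blast
    have other: "\<tau> (Suc j) \<le> a \<or> b \<le> \<tau> j" if "j < n" "j \<noteq> i" for j
    proof (cases "j < i")
      case True
      then show ?thesis using \<tau>_mono[of "Suc j" i] i by auto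
    next
      case False
      then show ?thesis using \<tau>_mono[of "Suc i" j] i that by auto
    qed
    have HF': "H i \<in> borel_measurable (F a)" using i \<tau>0[of i] by (intro F_le[OF _ i(2) HF]) auto
    have z: "simple_process n \<tau> H s \<omega> = H i \<omega>" if "s \<in> {a<..b}" for s \<omega>
    proof -
      have "simple_process n \<tau> H s \<omega> = (\<Sum>j<n. if j = i then H i \<omega> else 0)"
        unfolding simple_process_def
      proof (rule sum.cong[OF refl])
        fix j assume "j \<in> {..<n}"
        then show "indicator {\<tau> j<..\<tau> (Suc j)} s *\<^sub>R H j \<omega> = (if j = i then H i \<omega> else 0)"
          using other[of j] i that by (auto split: split_indicator)
      qed
      then show ?thesis using i by simp
    qed
    have J: "simple_integral W n \<tau> H s \<omega> - simple_integral W n \<tau> H a \<omega> = H i \<omega> \<bullet> (W s \<omega> - W a \<omega>)"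
      if s: "s \<in> {a..b}" for s \<omega>
    proof -
      have "simple_integral W n \<tau> H s \<omega> - simple_integral W n \<tau> H a \<omega>
        = (\<Sum>j<n. H j \<omega> \<bullet> (W (min s (\<tau> (Suc j))) \<omega> - W (min s (\<tau> j)) \<omega>)
            - H j \<omega> \<bullet> (W (min a (\<tau> (Suc j))) \<omega> - W (min a (\<tau> j)) \<omega>))"
        by (simp add: simple_integral_def sum_subtractf)
      also have "\<dots> = (\<Sum>j<n. if j = i then H i \<omega> \<bullet> (W s \<omega> - W a \<omega>) else 0)"
      proof (rule sum.cong[OF refl])
        fix j assume j: "j \<in> {..<n}"
        show "H j \<omega> \<bullet> (W (min s (\<tau> (Suc j))) \<omega> - W (min s (\<tau> j)) \<omega>)
            - H j \<omega> \<bullet> (W (min a (\<tau> (Suc j))) \<omega> - W (min a (\<tau> j)) \<omega>)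
          = (if j = i then H i \<omega> \<bullet> (W s \<omega> - W a \<omega>) else 0)"
        proof (cases "j = i")
          case True
          then have "min s (\<tau> (Suc j)) = s" "min s (\<tau> j) = \<tau> j" "min a (\<tau> (Suc j)) = a" "min a (\<tau> j) = \<tau> j"
            using i s ab by auto
          then show ?thesis using True by (simp add: inner_diff_right)
        next
          case False
          have lt: "\<tau> j < \<tau> (Suc j)" using \<tau>(3)[of j] j by simp
          have "\<tau> (Suc j) \<le> a \<or> b \<le> \<tau> j" using other[of j] False j by simp
          then show ?thesis
          proof
            assume "\<tau> (Suc j) \<le> a"
            then have "min s (\<tau> (Suc j)) = \<tau> (Suc j)" "min s (\<tau> j) = \<tau> j"
              "min a (\<tau> (Suc j)) = \<tau> (Suc j)" "min a (\<tau> j) = \<tau> j"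
              using lt s by auto
            then show ?thesis using False by simp
          next
            assume "b \<le> \<tau> j"
            then have "min s (\<tau> (Suc j)) = s" "min s (\<tau> j) = s" "min a (\<tau> (Suc j)) = a" "min a (\<tau> j) = a"
              using lt s by auto
            then show ?thesis using False by simp
          qed
        qed
      qed
      finally show ?thesis using i by simp
    qed
    show "\<exists>G. G \<in> borel_measurable (F a) \<and> (\<forall>s\<in>{a<..b}. \<forall>\<omega>\<in>space M. simple_process n \<tau> H s \<omega> = G \<omega>) \<and>
         (\<forall>s\<in>{a..b}. \<forall>\<omega>\<in>space M. simple_integral W n \<tau> H s \<omega> - simple_integral W n \<tau> H a \<omega> = G \<omega> \<bullet> (W s \<omega> - W a \<omega>))"
      using HF' z J by blast
  qed
  then show thesis by (rule that)
qed

end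

section \<open>Restricting processes to shorter time intervals\<close>

context prob_space
begin

text \<open>The space-time measure of a subinterval is a product measure of its own, so
  integrability is transferred through the iterated integrals.\<close>

lemma integrable_time_space_mono:
  fixes f :: "real \<Rightarrow> 'a \<Rightarrow> real"
  assumes f: "integrable (time_space M a b) (case_prod f)" and cd: "a \<le> c" "d \<le> b"
  shows "integrable (time_space M c d) (case_prod f)"
proof -
  interpret P: pair_sigma_finite "lborel_Icc c d" M by (rule pair_sigma_finite_time)
  have m: "case_prod f \<in> borel_measurable (time_space M c d)"
    by (rule measurable_time_space_mono[OF borel_measurable_integrable[OF f] cd])
  have n: "integrable (time_space M a b) (case_prod (\<lambda>s \<omega>. norm (f s \<omega>)))"
    using integrable_norm[OF f] by (simp add: case_prod_beta')
  have "set_integrable lborel {c..d} (\<lambda>s. \<integral>\<omega>. norm (f s \<omega>) \<partial>M)"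
    using cd by (intro set_integrable_subset[OF time_space_Fubini(2)[OF n]]) auto
  moreover have "AE s in lborel_Icc c d. integrable M (f s)"
    using time_space_Fubini(1)[OF f] cd by (auto simp: AE_lborel_Icc elim!: eventually_mono)
  ultimately have "integrable (lborel_Icc c d \<Otimes>\<^sub>M M) (case_prod f)"
    using m by (intro P.Fubini_integrable) (auto simp: integrable_lborel_Icc time_space_def)
  then show ?thesis by (simp add: time_space_def)
qed

lemma square_integrable_time_space_mono:
  assumes f: "square_integrable (time_space M a b) (case_prod f)" and cd: "a \<le> c" "d \<le> b"
  shows "square_integrable (time_space M c d) (case_prod f)"
proof -
  have "integrable (time_space M a b) (case_prod (\<lambda>s \<omega>. (f s \<omega>)\<^sup>2))"
    using square_integrableD[OF f] by (simp add: case_prod_beta')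
  from integrable_time_space_mono[OF this cd]
  have "integrable (time_space M c d) (\<lambda>x. (case_prod f x)\<^sup>2)" by (simp add: case_prod_beta')
  moreover have "case_prod f \<in> borel_measurable (time_space M c d)"
    by (rule measurable_time_space_mono[OF _ cd]) (use f in measurable)
  ultimately show ?thesis by (simp add: square_integrable_def)
qed

lemma time_space_integral_mono_time:
  fixes f :: "real \<Rightarrow> 'a \<Rightarrow> real"
  assumes f: "integrable (time_space M a b) (case_prod f)" and c: "a \<le> c" "c \<le> b"
    and pos: "\<And>s \<omega>. 0 \<le> f s \<omega>"
  shows "integral\<^sup>L (time_space M c b) (case_prod f) \<le> integral\<^sup>L (time_space M a b) (case_prod f)"
proof -
  have nn: "0 \<le> (LINT s:{a..c}|lborel. (\<integral>\<omega>. f s \<omega> \<partial>M))"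
    unfolding set_lebesgue_integral_def using pos by (intro Bochner_Integration.integral_nonneg) auto
  show ?thesis
    using set_integral_Icc_split[OF time_space_Fubini(2)[OF f] c] nn
      time_space_Fubini(3)[OF f] time_space_Fubini(3)[OF integrable_time_space_mono[OF f c(1) order_refl]]
    by simp
qed

lemma L2_tendsto_time_space_mono:
  assumes f: "L2_tendsto (time_space M a b) (\<lambda>k. case_prod (fs k)) (case_prod f)" and c: "a \<le> c" "c \<le> b"
  shows "L2_tendsto (time_space M c b) (\<lambda>k. case_prod (fs k)) (case_prod f)"
proof -
  have s: "square_integrable (time_space M a b) (case_prod (fs k))" "square_integrable (time_space M a b) (case_prod f)" for k
    using f by (auto simp: L2_tendsto_def)
  define g where "g k s \<omega> = (fs k s \<omega> - f s \<omega>)\<^sup>2" for k s \<omega>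
  have g: "integrable (time_space M a b) (case_prod (g k))" for k
    using square_integrableD[OF square_integrable_diff[OF s(1)[of k] s(2)]] by (simp add: g_def case_prod_beta')
  have lim: "(\<lambda>k. integral\<^sup>L (time_space M a b) (case_prod (g k))) \<longlonglongrightarrow> 0"
    using f by (simp add: L2_tendsto_def g_def case_prod_beta')
  have "(\<lambda>k. integral\<^sup>L (time_space M c b) (case_prod (g k))) \<longlonglongrightarrow> 0"
  proof (rule tendsto_sandwich[OF _ _ tendsto_const lim])
    show "\<forall>\<^sub>F k in sequentially. integral\<^sup>L (time_space M c b) (case_prod (g k)) \<le> integral\<^sup>L (time_space M a b) (case_prod (g k))"
      by (intro eventuallyI time_space_integral_mono_time[OF g c]) (simp add: g_def)
    show "\<forall>\<^sub>F k in sequentially. 0 \<le> integral\<^sup>L (time_space M c b) (case_prod (g k))"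
      by (intro eventuallyI Bochner_Integration.integral_nonneg) (simp add: g_def case_prod_beta')
  qed
  moreover have "square_integrable (time_space M c b) (case_prod (fs k))" "square_integrable (time_space M c b) (case_prod f)" for k
    by (rule square_integrable_time_space_mono[OF s(1) c(1) order_refl],
        rule square_integrable_time_space_mono[OF s(2) c(1) order_refl])
  ultimately show ?thesis by (simp add: L2_tendsto_def g_def case_prod_beta')
qed

text \<open>The variable upper limit becomes a factor under an integral over the fixed interval,
  which is then a parameter integral in (s, \<omega>).\<close>

lemma running_integral_joint_measurable:
  assumes h: "case_prod h \<in> borel_measurable (time_space M a b)"
  shows "(\<lambda>(s, \<omega>). LINT u:{a..s}|lborel. h u \<omega> :: real) \<in> borel_measurable (time_space M a b)"
proof -
  interpret L: finite_measure "lborel_Icc a b" by (rule finite_measure_lborel_Icc)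
  let ?N = "time_space M a b"
  have 1: "(\<lambda>y :: (real \<times> 'a) \<times> real. (snd y, snd (fst y))) \<in> measurable (?N \<Otimes>\<^sub>M lborel_Icc a b) (time_space M a b)"
    unfolding time_space_def by measurable
  have hm: "(\<lambda>y. h (snd y) (snd (fst y))) \<in> borel_measurable (?N \<Otimes>\<^sub>M lborel_Icc a b)"
    using measurable_compose[OF 1 h] by simp
  have id: "(\<lambda>s. s) \<in> borel_measurable (lborel_Icc a b)"
    by (rule measurable_restrict_space1) simp
  have f: "(\<lambda>y. fst (fst y)) \<in> borel_measurable (?N \<Otimes>\<^sub>M lborel_Icc a b)"
    unfolding time_space_def by (intro measurable_compose[OF measurable_fst] measurable_compose[OF measurable_fst id])
  have s: "(\<lambda>y. snd y) \<in> borel_measurable (?N \<Otimes>\<^sub>M lborel_Icc a b)"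
    by (rule measurable_compose[OF measurable_snd id])
  have "(\<lambda>y. (if snd y \<le> fst (fst y) then 1 else 0) * h (snd y) (snd (fst y))) \<in> borel_measurable (?N \<Otimes>\<^sub>M lborel_Icc a b)"
    using f s hm by (intro borel_measurable_times measurable_If) (auto intro!: borel_measurable_le)
  then have "(\<lambda>x. \<integral>u. (if u \<le> fst x then 1 else 0) * h u (snd x) \<partial>lborel_Icc a b) \<in> borel_measurable ?N"
    by (intro L.borel_measurable_lebesgue_integral) (simp add: case_prod_beta')
  also have "?this \<longleftrightarrow> (\<lambda>(s, \<omega>). LINT u:{a..s}|lborel. h u \<omega>) \<in> borel_measurable ?N"
  proof (rule measurable_cong)
    fix x assume "x \<in> space ?N"
    then have "fst x \<in> {a..b}" by (auto simp: space_time_space)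
    then show "(\<integral>u. (if u \<le> fst x then 1 else 0) * h u (snd x) \<partial>lborel_Icc a b) = (case x of (s, \<omega>) \<Rightarrow> LINT u:{a..s}|lborel. h u \<omega>)"
      unfolding integral_lborel_Icc set_lebesgue_integral_def case_prod_beta'
      by (intro Bochner_Integration.integral_cong) (auto split: split_indicator)
  qed
  finally show ?thesis .
qed

end

section \<open>The Ito inequality for step integrands and its limit\<close>

context brownian_basis
begin

text \<open>The claim says that \<Phi>, the expected penalty minus the time integral of E \<psi>,
  does not decrease from t to T. Monotonicity can be checked cell by cell, and inside a cell
  \<open>pen_step\<close> gives it on short intervals up to an error that subdivision
  removes.\<close>

lemma step_ito_inequality:
  assumes T: "0 < T" and J: "step_integral T P N z J"
    and h: "square_integrable (time_space M 0 T) (case_prod h)"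
    and XF: "\<And>s. s \<in> {0..T} \<Longrightarrow> X s \<in> borel_measurable (F s)"
    and Xm: "case_prod X \<in> borel_measurable (time_space M 0 T)"
    and Xs: "square_integrable (time_space M 0 T) (case_prod X)"
    and X0: "square_integrable M (X 0)"
    and X: "\<And>s. s \<in> {0..T} \<Longrightarrow> AE \<omega> in M. X s \<omega> = X 0 \<omega> - (LINT u:{0..s}|lborel. h u \<omega>) + J s \<omega>"
    and t: "t \<in> {0..T}"
  shows "(\<integral>\<omega>. pen (X t \<omega>) \<partial>M)
      + (\<integral>(s, \<omega>). pen1 (X s \<omega>) * (C * norm (z s \<omega>) - h s \<omega>) - C\<^sup>2 * pen (X s \<omega>) \<partial>time_space M t T)
    \<le> (\<integral>\<omega>. pen (X T \<omega>) \<partial>M)"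
proof -
  interpret N: finite_measure "time_space M 0 T" by (rule finite_measure_time_space)
  define \<psi> where "\<psi> s \<omega> = pen1 (X s \<omega>) * (C * norm (z s \<omega>) - h s \<omega>) - C\<^sup>2 * pen (X s \<omega>)" for s \<omega>
  have znorm: "square_integrable (time_space M 0 T) (\<lambda>x. norm (z (fst x) (snd x)))"
  proof (rule N.square_integrable_bounded)
    show "(\<lambda>x. norm (z (fst x) (snd x))) \<in> borel_measurable (time_space M 0 T)"
      using step_integralD(3)[OF J] by (simp add: case_prod_beta')
    show "AE x in time_space M 0 T. \<bar>norm (z (fst x) (snd x))\<bar> \<le> N"
      using step_integralD(6)[OF J] by (intro AE_I2) (auto simp: space_time_space)
  qed
  have \<psi>: "integrable (time_space M 0 T) (case_prod \<psi>)"
    unfolding \<psi>_def case_prod_beta' using Xs h znorm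
    by (intro Bochner_Integration.integrable_diff integrable_mult_square_integrable square_integrable_pen1
        square_integrable_diff square_integrable_cmult integrable_mult_right integrable_pen)
       (simp_all add: case_prod_beta')
  have h1: "integrable (time_space M 0 T) (case_prod h)"
    by (rule N.square_integrable_integrable[OF h])
  define g where "g s \<omega> = (h s \<omega>)\<^sup>2 + 1" for s \<omega>
  have g: "integrable (time_space M 0 T) (case_prod g)"
    unfolding g_def case_prod_beta'
    using square_integrableD[OF h] by (intro Bochner_Integration.integrable_add) (simp_all add: case_prod_beta')
  have Xsq: "square_integrable M (X s)" if s: "s \<in> {0..T}" for s
  proof (rule square_integrable_bound)
    show "square_integrable M (\<lambda>\<omega>. X 0 \<omega> - (LINT u:{0..s}|lborel. h u \<omega>) + J s \<omega>)"
      using s by (intro square_integrable_add square_integrable_diff X0 running_integral_square(1)[OF h s]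
          step_integral_square(1)[OF J]) auto
    show "X s \<in> borel_measurable M" using s by (intro from_F[OF _ XF]) auto
    show "AE \<omega> in M. \<bar>X s \<omega>\<bar> \<le> \<bar>X 0 \<omega> - (LINT u:{0..s}|lborel. h u \<omega>) + J s \<omega>\<bar>"
      using X[OF s] by eventually_elim simp
  qed
  define \<Phi> where "\<Phi> s = (\<integral>\<omega>. pen (X s \<omega>) \<partial>M) - (LINT u:{0..s}|lborel. (\<integral>\<omega>. \<psi> u \<omega> \<partial>M))" for s
  define \<Gamma> where "\<Gamma> s = (LINT u:{0..s}|lborel. (\<integral>\<omega>. g u \<omega> \<partial>M))" for s
  have split: "(LINT u:{0..d}|lborel. (\<integral>\<omega>. f u \<omega> \<partial>M)) - (LINT u:{0..c}|lborel. (\<integral>\<omega>. f u \<omega> \<partial>M))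
      = integral\<^sup>L (time_space M c d) (case_prod f)"
    if f: "integrable (time_space M 0 T) (case_prod f)" and cd: "0 \<le> c" "c \<le> d" "d \<le> T"
    for f :: "real \<Rightarrow> 'a \<Rightarrow> real" and c d
  proof -
    have "set_integrable lborel {0..d} (\<lambda>u. \<integral>\<omega>. f u \<omega> \<partial>M)"
      using cd by (intro set_integrable_subset[OF time_space_Fubini(2)[OF f]]) auto
    from set_integral_Icc_split[OF this cd(1,2)] show ?thesis
      using time_space_Fubini(3)[OF integrable_time_space_mono[OF f cd(1,3)]] by simp
  qed
  have "\<Phi> t \<le> \<Phi> T"
  proof (rule mono_through_breakpoints[where \<Phi> = \<Phi>, OF step_integralD(1)[OF J]])
    show "t \<le> T" using t by simp
    fix a b assume "t \<le> a" and ab: "a < b" "b \<le> T" "P \<inter> {a<..<b} = {}"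
    then have a0: "0 \<le> a" using t by simp
    obtain H where HF: "H \<in> borel_measurable (F a)" and HN: "\<And>\<omega>. \<omega> \<in> space M \<Longrightarrow> norm (H \<omega>) \<le> N"
      and Hz: "\<And>s \<omega>. s \<in> {a<..b} \<Longrightarrow> \<omega> \<in> space M \<Longrightarrow> z s \<omega> = H \<omega>"
      and HJ: "\<And>s \<omega>. s \<in> {a..b} \<Longrightarrow> \<omega> \<in> space M \<Longrightarrow> J s \<omega> - J a \<omega> = H \<omega> \<bullet> (W s \<omega> - W a \<omega>)"
      by (rule step_integral_piece[OF J a0 ab], rule that)
    obtain \<omega>0 where "\<omega>0 \<in> space M" using not_empty by auto
    then have N0: "0 \<le> N" using HN[of \<omega>0] norm_ge_zero order_trans by blast
    \<comment> \<open>One constant for both moment bounds: N^2 for the variance of an increment,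
      which also bounds q, and 3 d^2 N^4 for its fourth moment.\<close>
    define n where "n = N\<^sup>2 + 3 * (real CARD('d))\<^sup>2 * N ^ 4"
    have n0: "0 \<le> n" and nN: "N\<^sup>2 \<le> n" "3 * (real CARD('d))\<^sup>2 * N ^ 4 \<le> n"
      using N0 by (auto simp: n_def)
    show "\<Phi> a \<le> \<Phi> b"
    proof (rule mono_of_small_error[where C = "33 + 38 * n + 8 * n\<^sup>2" and \<Gamma> = \<Gamma> and \<Phi> = \<Phi>])
      fix c d assume cd: "a \<le> c" "c < d" "d \<le> b" "d - c \<le> 1"
      have c0: "0 \<le> c" "d \<le> T" "c \<in> {0..T}" using cd a0 ab by auto
      have HFc: "H \<in> borel_measurable (F c)" by (rule F_le[OF a0 cd(1) HF])
      have HN': "\<forall>\<omega>\<in>space M. norm (H \<omega>) \<le> N" using HN by blast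
      define B where "B s \<omega> = H \<omega> \<bullet> (W s \<omega> - W c \<omega>)" for s \<omega>
      define q where "q \<omega> = (norm (H \<omega>))\<^sup>2" for \<omega>
      have JB: "J s \<omega> = J c \<omega> + B s \<omega>" if "s \<in> {c..d}" "\<omega> \<in> space M" for s \<omega>
        using HJ[of s \<omega>] HJ[of c \<omega>] that cd by (simp add: B_def inner_diff_right)
      have incs: "square_integrable M (B s) \<and> (\<integral>\<omega>. (B s \<omega>)\<^sup>2 \<partial>M) \<le> n * (d - c)" if s: "s \<in> {c..d}" for s
      proof (cases "s = c")
        case True
        then have "B s = (\<lambda>\<omega>. 0)" by (simp add: B_def fun_eq_iff)
        then show ?thesis using n0 cd by simp
      next
        case False
        then have "c < s" using s by simp
        note inc = increment_product[OF c0(1) this HFc HN']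
        have "N\<^sup>2 * (s - c) \<le> n * (d - c)" using nN n0 s by (intro mult_mono) auto
        then show ?thesis using inc(5,6) by (simp add: B_def[abs_def])
      qed
      note inc = increment_product[OF c0(1) cd(2) HFc HN']
      have pm1: "square_integrable M (\<lambda>\<omega>. pen1 (X c \<omega>))" by (intro square_integrable_pen1 Xsq c0)
      have pF1: "(\<lambda>\<omega>. pen1 (X c \<omega>)) \<in> borel_measurable (F c)" "(\<lambda>\<omega>. pen2 (X c \<omega>)) \<in> borel_measurable (F c)"
        using XF[OF c0(3)] by (auto intro: measurable_compose)
      have p6: "\<bar>pen2 (X c \<omega>)\<bar> \<le> 6" for \<omega> using pen2_bounds[of "X c \<omega>"] by simp
      have hcd: "square_integrable (time_space M c d) (case_prod h)"
        by (rule square_integrable_time_space_mono[OF h c0(1,2)])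
      have Xmcd: "case_prod X \<in> borel_measurable (time_space M c d)"
        by (rule measurable_time_space_mono[OF Xm c0(1,2)])
      have Xeq: "AE \<omega> in M. X s \<omega> = X c \<omega> - (LINT u:{c..s}|lborel. h u \<omega>) + B s \<omega>" if s: "s \<in> {c..d}" for s
      proof -
        have s0: "s \<in> {0..T}" using s c0 by auto
        show ?thesis
          using X[OF s0] X[OF c0(3)] time_space_Fubini(4)[OF h1] AE_space
        proof eventually_elim
          case (elim \<omega>)
          have "set_integrable lborel {0..s} (\<lambda>u. h u \<omega>)"
            using s0 by (intro set_integrable_subset[OF elim(3)]) auto
          from set_integral_Icc_split[OF this c0(1)] s
          have "(LINT u:{0..s}|lborel. h u \<omega>) = (LINT u:{0..c}|lborel. h u \<omega>) + (LINT u:{c..s}|lborel. h u \<omega>)"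
            by simp
          then show ?case using elim(1,2) JB[OF s elim(4)] by simp
        qed
      qed
      have qM: "q \<in> borel_measurable M"
        unfolding q_def[abs_def] using from_F[OF c0(1) HFc] by simp
      have qn: "0 \<le> q \<omega> \<and> q \<omega> \<le> n" if "\<omega> \<in> space M" for \<omega>
        using power_mono[OF HN[OF that] norm_ge_zero, of 2] nN by (simp add: q_def)
      have B4: "integrable M (\<lambda>\<omega>. (B d \<omega>) ^ 4)" "(\<integral>\<omega>. (B d \<omega>) ^ 4 \<partial>M) \<le> n * (d - c)\<^sup>2"
      proof -
        show "integrable M (\<lambda>\<omega>. (B d \<omega>) ^ 4)" using inc(7) by (simp add: B_def)
        have "(\<integral>\<omega>. (B d \<omega>) ^ 4 \<partial>M) \<le> 3 * (real CARD('d))\<^sup>2 * N ^ 4 * (d - c)\<^sup>2"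
          using inc(8) by (simp add: B_def)
        also have "\<dots> \<le> n * (d - c)\<^sup>2" using nN by (intro mult_right_mono) auto
        finally show "(\<integral>\<omega>. (B d \<omega>) ^ 4 \<partial>M) \<le> n * (d - c)\<^sup>2" .
      qed
      have m1: "(\<integral>\<omega>. pen1 (X c \<omega>) * B d \<omega> \<partial>M) = 0"
        using inc(2)[OF pm1 pF1(1)] by (simp add: B_def)
      have m2: "(\<integral>\<omega>. pen2 (X c \<omega>) * (B d \<omega>)\<^sup>2 \<partial>M) = (d - c) * (\<integral>\<omega>. pen2 (X c \<omega>) * q \<omega> \<partial>M)"
        using inc(4)[OF pF1(2) p6] by (simp add: B_def q_def)
      note step = pen_step[OF cd(2,4) n0 hcd Xmcd Xsq[OF c0(3)] Xeq conjunct1[OF incs] conjunct2[OF incs] B4 qM qn m1 m2]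
      have "(\<integral>x. case_prod \<psi> x \<partial>time_space M c d)
        \<le> (\<integral>(s, \<omega>). pen2 (X s \<omega>) / 2 * q \<omega> - pen1 (X s \<omega>) * h s \<omega> \<partial>time_space M c d)"
      proof (rule integral_mono_AE)
        show "integrable (time_space M c d) (case_prod \<psi>)"
          by (rule integrable_time_space_mono[OF \<psi> c0(1,2)])
        interpret PP: pair_sigma_finite "lborel_Icc c d" M by (rule pair_sigma_finite_time)
        have id: "(\<lambda>s. s) \<in> borel_measurable (lborel_Icc c d)"
          by (rule measurable_restrict_space1) simp
        \<comment> \<open>z equals H only on the half-open interval {a<..b}, and c may be equal to
          a; a single time is negligible.\<close>
        have "AE x in time_space M c d. fst x \<noteq> c"
          unfolding time_space_def
        proof (rule PP.AE_pair_measure)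
          have "fst \<in> borel_measurable (lborel_Icc c d \<Otimes>\<^sub>M M)"
            by (rule measurable_compose[OF measurable_fst id])
          then show "{x \<in> space (lborel_Icc c d \<Otimes>\<^sub>M M). fst x \<noteq> c} \<in> sets (lborel_Icc c d \<Otimes>\<^sub>M M)"
            by measurable
          show "AE x in lborel_Icc c d. AE y in M. fst (x, y) \<noteq> c"
            using AE_lborel_singleton[of c] by (auto simp: AE_lborel_Icc elim!: eventually_mono)
        qed
        then show "AE x in time_space M c d. case_prod \<psi> x \<le> (case x of (s, \<omega>) \<Rightarrow> pen2 (X s \<omega>) / 2 * q \<omega> - pen1 (X s \<omega>) * h s \<omega>)"
          using AE_space
        proof eventually_elim
          case (elim x)
          obtain s \<omega> where x: "x = (s, \<omega>)" by (cases x)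
          have "s \<in> {a<..b}" "\<omega> \<in> space M" using elim x cd by (auto simp: space_time_space)
          then have "z s \<omega> = H \<omega>" by (rule Hz)
          \<comment> \<open>Here the second-order term pen2 |H|^2 / 2 is traded for the term linear
            in |z|, at the cost of C^2 pen.\<close>
          then show ?case
            using pen_young[of C "X s \<omega>" "norm (z s \<omega>)"] by (simp add: x \<psi>_def q_def algebra_simps)
        qed
      qed (rule step(3), assumption+)
      moreover have "(\<integral>\<omega>. pen (X c \<omega>) \<partial>M) + (\<integral>(s, \<omega>). pen2 (X s \<omega>) / 2 * q \<omega> - pen1 (X s \<omega>) * h s \<omega> \<partial>time_space M c d)
          - (33 + 38 * n + 8 * n\<^sup>2) * sqrt (d - c) * (\<integral>(s, \<omega>). (h s \<omega>)\<^sup>2 + 1 \<partial>time_space M c d)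
          \<le> (\<integral>\<omega>. pen (X d \<omega>) \<partial>M)"
        by (rule step(1))
      moreover have \<Gamma>: "\<Gamma> d - \<Gamma> c = (\<integral>(s, \<omega>). (h s \<omega>)\<^sup>2 + 1 \<partial>time_space M c d)"
        unfolding \<Gamma>_def split[OF g c0(1) less_imp_le[OF cd(2)] c0(2)] by (simp add: g_def[abs_def])
      moreover have "\<Phi> d - \<Phi> c = (\<integral>\<omega>. pen (X d \<omega>) \<partial>M) - (\<integral>\<omega>. pen (X c \<omega>) \<partial>M)
          - (\<integral>x. case_prod \<psi> x \<partial>time_space M c d)"
        unfolding \<Phi>_def split[OF \<psi> c0(1) less_imp_le[OF cd(2)] c0(2), symmetric] by simp
      ultimately show "- ((33 + 38 * n + 8 * n\<^sup>2) * sqrt (d - c) * (\<Gamma> d - \<Gamma> c)) \<le> \<Phi> d - \<Phi> c"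
        unfolding \<Gamma> by linarith
    qed (rule ab)
  qed
  then have "(\<integral>\<omega>. pen (X t \<omega>) \<partial>M) + integral\<^sup>L (time_space M t T) (case_prod \<psi>) \<le> (\<integral>\<omega>. pen (X T \<omega>) \<partial>M)"
    using t by (simp add: \<Phi>_def flip: split[OF \<psi>])
  then show ?thesis by (simp add: \<psi>_def[abs_def])
qed

text \<open>The approximants Y k keep the initial value and the drift of X and replace I by the step
  integral J k. The step inequality holds for them, and every integrand in it is either
  \<open>pen\<close> of a convergent sequence or a product of two factors that converge in
  L^2.\<close>

lemma ito_inequality:
  fixes X h :: "real \<Rightarrow> 'a \<Rightarrow> real" and Z :: "real \<Rightarrow> 'a \<Rightarrow> real ^ 'd"
  assumes T: "0 < T" and J: "\<And>k. step_integral T (P k) (N k) (z k) (J k)"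
    and Z: "case_prod Z \<in> borel_measurable (time_space M 0 T)"
    and Zs: "square_integrable (time_space M 0 T) (\<lambda>(s, \<omega>). norm (Z s \<omega>))"
    and zZ: "L2_tendsto (time_space M 0 T) (\<lambda>k (s, \<omega>). norm (z k s \<omega> - Z s \<omega>)) (\<lambda>(s, \<omega>). 0)"
    and I: "\<And>s. s \<in> {0..T} \<Longrightarrow> I s \<in> borel_measurable (F s)"
    and JI: "\<And>s. s \<in> {0..T} \<Longrightarrow> L2_tendsto M (\<lambda>k. J k s) (I s)"
    and h: "square_integrable (time_space M 0 T) (case_prod h)"
    and XF: "\<And>s. s \<in> {0..T} \<Longrightarrow> X s \<in> borel_measurable (F s)"
    and Xs: "square_integrable (time_space M 0 T) (case_prod X)"
    and Xsq: "\<And>s. s \<in> {0..T} \<Longrightarrow> square_integrable M (X s)"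
    and X: "\<And>s. s \<in> {0..T} \<Longrightarrow> AE \<omega> in M. X s \<omega> = X 0 \<omega> - (LINT u:{0..s}|lborel. h u \<omega>) + I s \<omega>"
    and t: "t \<in> {0..T}"
  shows "(\<integral>\<omega>. pen (X t \<omega>) \<partial>M)
      + (\<integral>(s, \<omega>). pen1 (X s \<omega>) * (C * norm (Z s \<omega>) - h s \<omega>) - C\<^sup>2 * pen (X s \<omega>) \<partial>time_space M t T)
    \<le> (\<integral>\<omega>. pen (X T \<omega>) \<partial>M)"
proof -
  have T0: "0 \<in> {0..T}" "T \<in> {0..T}" using T by auto
  define Y where "Y k s \<omega> = X 0 \<omega> - (LINT u:{0..s}|lborel. h u \<omega>) + J k s \<omega>" for k s \<omega>
  have hm: "case_prod h \<in> borel_measurable (time_space M 0 T)" using h by measurable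
  have X0m: "(\<lambda>(s, \<omega>). X 0 \<omega>) \<in> borel_measurable (time_space M 0 T)"
    using square_integrable_time_space_const[OF Xsq[OF T0(1)], of 0 T] by measurable
  have Ym: "case_prod (Y k) \<in> borel_measurable (time_space M 0 T)" for k
    using X0m running_integral_joint_measurable[OF hm] step_integralD(2)[OF J[of k]]
    unfolding Y_def case_prod_beta' by (intro borel_measurable_add borel_measurable_diff)
  have YX: "AE \<omega> in M. Y k s \<omega> = X s \<omega> - I s \<omega> + J k s \<omega>" if "s \<in> {0..T}" for k s
    using X[OF that] by eventually_elim (simp add: Y_def)
  \<comment> \<open>Adaptedness is read off from X - I + J k, with which Y k agrees almost surely,
    and not from the drift integral.\<close>
  have YF: "Y k s \<in> borel_measurable (F s)" if s: "s \<in> {0..T}" for k s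
    using s XF[OF s] I[OF s] step_integralD(4)[OF J[of k] s]
    by (intro F_AE_eq[OF _ _ YX[OF s]] borel_measurable_add borel_measurable_diff) auto
  have Ysq: "square_integrable M (Y k s)" if s: "s \<in> {0..T}" for k s
    unfolding Y_def[abs_def] using s
    by (intro square_integrable_add square_integrable_diff Xsq T0 running_integral_square(1)[OF h s]
        step_integral_square(1)[OF J]) auto
  have JT: "(\<integral>\<omega>. (J k s \<omega>)\<^sup>2 \<partial>M) \<le> (\<integral>\<omega>. (J k T \<omega>)\<^sup>2 \<partial>M)" if "s \<in> {0..T}" for k s
    using step_integral_square(2)[OF J] that by auto
  obtain B where B: "\<And>k. (\<integral>\<omega>. (J k T \<omega>)\<^sup>2 \<partial>M) \<le> B" using L2_tendsto_bounded[OF JI[OF T0(2)]] by blast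
  have sqJ: "square_integrable M (J k s)" and sqI: "square_integrable M (I s)" if "s \<in> {0..T}" for k s
    using JI[OF that] by (auto simp: L2_tendsto_def)
  \<comment> \<open>The bound of J k s by J k T passes to the limit, so J k and I are bounded in L^2
    uniformly in time. This provides the dominating constant for the convergence in time.\<close>
  have IB: "(\<integral>\<omega>. (I s \<omega>)\<^sup>2 \<partial>M) \<le> B" if s: "s \<in> {0..T}" for s
  proof -
    have "(\<lambda>k. \<integral>\<omega>. J k s \<omega> * J k s \<omega> \<partial>M) \<longlonglongrightarrow> (\<integral>\<omega>. I s \<omega> * I s \<omega> \<partial>M)"
      by (intro integral_mult_tendsto JI s)
    moreover have "(\<integral>\<omega>. J k s \<omega> * J k s \<omega> \<partial>M) \<le> B" for k
      using order_trans[OF JT[OF s] B, of k] by (simp add: power2_eq_square)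
    ultimately have "(\<integral>\<omega>. I s \<omega> * I s \<omega> \<partial>M) \<le> B" by (intro LIMSEQ_le_const2[of _ _ B]) auto
    then show ?thesis by (simp add: power2_eq_square)
  qed
  define D where "D k s = (\<integral>\<omega>. (Y k s \<omega> - X s \<omega>)\<^sup>2 \<partial>M)" for k s
  have DJ: "D k s = (\<integral>\<omega>. (J k s \<omega> - I s \<omega>)\<^sup>2 \<partial>M)" if s: "s \<in> {0..T}" for k s
    unfolding D_def
  proof (rule integral_cong_AE)
    show "AE \<omega> in M. (Y k s \<omega> - X s \<omega>)\<^sup>2 = (J k s \<omega> - I s \<omega>)\<^sup>2"
      using YX[OF s, of k] by eventually_elim simp
  qed (use Ysq[OF s, of k] Xsq[OF s] sqJ[OF s, of k] sqI[OF s] in measurable)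
  have Dlim: "(\<lambda>k. D k s) \<longlonglongrightarrow> 0" if s: "s \<in> {0..T}" for s
    using JI[OF s] by (simp add: DJ[OF s] L2_tendsto_def)
  have DB: "D k s \<le> 4 * B" if s: "s \<in> {0..T}" for k s
  proof -
    have i: "integrable M (\<lambda>\<omega>. (J k s \<omega>)\<^sup>2)" "integrable M (\<lambda>\<omega>. (I s \<omega>)\<^sup>2)"
      using sqJ[OF s, of k] sqI[OF s] by (auto dest: square_integrableD)
    have "D k s \<le> (\<integral>\<omega>. 2 * (J k s \<omega>)\<^sup>2 + 2 * (I s \<omega>)\<^sup>2 \<partial>M)"
      unfolding DJ[OF s]
    proof (rule integral_mono)
      fix \<omega>
      have "0 \<le> (J k s \<omega> + I s \<omega>)\<^sup>2" by simp
      then show "(J k s \<omega> - I s \<omega>)\<^sup>2 \<le> 2 * (J k s \<omega>)\<^sup>2 + 2 * (I s \<omega>)\<^sup>2"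
        by (simp add: power2_eq_square algebra_simps)
    qed (use i square_integrableD[OF square_integrable_diff[OF sqJ[OF s, of k] sqI[OF s]]] in auto)
    also have "\<dots> = 2 * (\<integral>\<omega>. (J k s \<omega>)\<^sup>2 \<partial>M) + 2 * (\<integral>\<omega>. (I s \<omega>)\<^sup>2 \<partial>M)" using i by simp
    finally show ?thesis using JT[OF s, of k] B[of k] IB[OF s] by simp
  qed
  have Xm: "case_prod X \<in> borel_measurable (time_space M 0 T)" using Xs by measurable
  have YXm: "case_prod (\<lambda>s \<omega>. Y k s \<omega> - X s \<omega>) \<in> borel_measurable (time_space M 0 T)" for k
    using borel_measurable_diff[OF Ym[of k] Xm] by (simp add: case_prod_beta')
  have YXs: "square_integrable (time_space M 0 T) (case_prod (\<lambda>s \<omega>. Y k s \<omega> - X s \<omega>))" for k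
    by (rule square_integrable_time_space(1)[OF YXm, where B = "4 * B"])
       (use T DB Ysq Xsq in \<open>auto simp: D_def intro!: square_integrable_diff\<close>)
  have Ys: "square_integrable (time_space M 0 T) (case_prod (Y k))" for k
    using square_integrable_add[OF YXs[of k] Xs] by (simp add: case_prod_beta')
  have Ylim0: "L2_tendsto (time_space M 0 T) (\<lambda>k. case_prod (Y k)) (case_prod X)"
  proof -
    have D2: "integrable (time_space M 0 T) (case_prod (\<lambda>s \<omega>. (Y k s \<omega> - X s \<omega>)\<^sup>2))" for k
      using square_integrableD[OF YXs[of k]] by (simp add: case_prod_beta')
    interpret L: finite_measure "lborel_Icc 0 T" by (rule finite_measure_lborel_Icc)
    \<comment> \<open>Mean-square convergence is known at each fixed time; dominated convergence
      over time lifts it to space-time.\<close>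
    have "(\<lambda>k. \<integral>s. D k s \<partial>lborel_Icc 0 T) \<longlonglongrightarrow> (\<integral>s. 0 \<partial>lborel_Icc 0 T)"
    proof (rule integral_dominated_convergence[where w = "\<lambda>_. 4 * B"])
      show "D k \<in> borel_measurable (lborel_Icc 0 T)" for k
        using borel_measurable_integrable[of "lborel_Icc 0 T" "D k"] time_space_Fubini(2)[OF D2[of k]]
        by (simp add: integrable_lborel_Icc D_def[abs_def])
      show "AE s in lborel_Icc 0 T. (\<lambda>k. D k s) \<longlonglongrightarrow> 0"
        using Dlim by (intro AE_I2) (simp add: space_restrict_space)
      show "AE s in lborel_Icc 0 T. norm (D k s) \<le> 4 * B" for k
        using DB[of _ k] by (intro AE_I2) (simp add: space_restrict_space D_def)
    qed auto
    then have "(\<lambda>k. \<integral>x. (case_prod (\<lambda>s \<omega>. (Y k s \<omega> - X s \<omega>)\<^sup>2)) x \<partial>time_space M 0 T) \<longlonglongrightarrow> 0"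
      using time_space_Fubini(3)[OF D2] by (simp add: integral_lborel_Icc D_def)
    then show ?thesis using Ys Xs by (simp add: L2_tendsto_def case_prod_beta')
  qed
  have t0: "0 \<le> t" "t \<le> T" using t by auto
  have Ylim: "L2_tendsto (time_space M t T) (\<lambda>k. case_prod (Y k)) (case_prod X)"
    by (rule L2_tendsto_time_space_mono[OF Ylim0 t0])
  have zm: "case_prod (z k) \<in> borel_measurable (time_space M 0 T)" for k by (rule step_integralD(3)[OF J])
  have "L2_tendsto (time_space M 0 T) (\<lambda>k. case_prod (\<lambda>s \<omega>. C * norm (z k s \<omega>) - h s \<omega>)) (case_prod (\<lambda>s \<omega>. C * norm (Z s \<omega>) - h s \<omega>))"
  proof (rule L2_tendsto_dominated[OF zZ, where c = "\<bar>C\<bar>"])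
    show "square_integrable (time_space M 0 T) (\<lambda>(s, \<omega>). C * norm (Z s \<omega>) - h s \<omega>)"
      using square_integrable_diff[OF square_integrable_cmult[OF Zs, of C] h] by (simp add: case_prod_beta')
    show "(\<lambda>(s, \<omega>). C * norm (z k s \<omega>) - h s \<omega>) \<in> borel_measurable (time_space M 0 T)" for k
      using zm[of k] hm by (simp add: case_prod_beta')
    fix k
    show "AE x in time_space M 0 T. \<bar>(case x of (s, \<omega>) \<Rightarrow> C * norm (z k s \<omega>) - h s \<omega>) - (case x of (s, \<omega>) \<Rightarrow> C * norm (Z s \<omega>) - h s \<omega>)\<bar>
        \<le> \<bar>C\<bar> * \<bar>(case x of (s, \<omega>) \<Rightarrow> norm (z k s \<omega> - Z s \<omega>)) - (case x of (s, \<omega>) \<Rightarrow> 0)\<bar>"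
    proof (rule AE_I2)
      fix x :: "real \<times> 'a"
      have "\<bar>C\<bar> * \<bar>norm (z k (fst x) (snd x)) - norm (Z (fst x) (snd x))\<bar> \<le> \<bar>C\<bar> * norm (z k (fst x) (snd x) - Z (fst x) (snd x))"
        by (intro mult_left_mono norm_triangle_ineq3) auto
      then show "\<bar>(case x of (s, \<omega>) \<Rightarrow> C * norm (z k s \<omega>) - h s \<omega>) - (case x of (s, \<omega>) \<Rightarrow> C * norm (Z s \<omega>) - h s \<omega>)\<bar>
        \<le> \<bar>C\<bar> * \<bar>(case x of (s, \<omega>) \<Rightarrow> norm (z k s \<omega> - Z s \<omega>)) - (case x of (s, \<omega>) \<Rightarrow> 0)\<bar>"
        by (simp add: case_prod_beta' abs_mult flip: right_diff_distrib)
    qed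
  qed
  from L2_tendsto_time_space_mono[OF this t0]
  have zlim: "L2_tendsto (time_space M t T) (\<lambda>k. case_prod (\<lambda>s \<omega>. C * norm (z k s \<omega>) - h s \<omega>)) (case_prod (\<lambda>s \<omega>. C * norm (Z s \<omega>) - h s \<omega>))" .
  have lim_s: "(\<lambda>k. \<integral>\<omega>. pen (Y k s \<omega>) \<partial>M) \<longlonglongrightarrow> (\<integral>\<omega>. pen (X s \<omega>) \<partial>M)" if s: "s \<in> {0..T}" for s
    by (rule integral_pen_tendsto) (use Ysq[OF s] Xsq[OF s] Dlim[OF s] in \<open>simp add: L2_tendsto_def D_def\<close>)
  have lim_int: "(\<lambda>k. (\<integral>y. pen1 (case_prod (Y k) y) * (case_prod (\<lambda>s \<omega>. C * norm (z k s \<omega>) - h s \<omega>) y) \<partial>time_space M t T)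
        - C\<^sup>2 * (\<integral>y. pen (case_prod (Y k) y) \<partial>time_space M t T))
      \<longlonglongrightarrow> (\<integral>y. pen1 (case_prod X y) * (case_prod (\<lambda>s \<omega>. C * norm (Z s \<omega>) - h s \<omega>) y) \<partial>time_space M t T)
        - C\<^sup>2 * (\<integral>y. pen (case_prod X y) \<partial>time_space M t T)"
    by (intro tendsto_intros integral_mult_tendsto L2_tendsto_pen1 integral_pen_tendsto Ylim zlim)
  have ineq: "(\<integral>\<omega>. pen (Y k t \<omega>) \<partial>M)
      + ((\<integral>y. pen1 (case_prod (Y k) y) * (case_prod (\<lambda>s \<omega>. C * norm (z k s \<omega>) - h s \<omega>) y) \<partial>time_space M t T)
        - C\<^sup>2 * (\<integral>y. pen (case_prod (Y k) y) \<partial>time_space M t T))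
    \<le> (\<integral>\<omega>. pen (Y k T \<omega>) \<partial>M)" for k
  proof -
    \<comment> \<open>At time 0 the drift integral runs over a single point and J k vanishes, so Y k
      starts at X 0 and the equation holds with its own initial value.\<close>
    have Y0: "Y k s \<omega> = Y k 0 \<omega> - (LINT u:{0..s}|lborel. h u \<omega>) + J k s \<omega>" if "\<omega> \<in> space M" for s \<omega>
    proof -
      have "(LINT u:{0..0}|lborel. h u \<omega>) = 0"
        unfolding set_lebesgue_integral_def
        by (rule integral_eq_zero_AE) (use AE_lborel_singleton[of "0::real"] in \<open>auto elim!: eventually_mono\<close>)
      then show ?thesis using step_integralD(5)[OF J[of k] that] by (simp add: Y_def)
    qed
    have sq: "square_integrable (time_space M t T) (case_prod (Y k))"
      "square_integrable (time_space M t T) (case_prod (\<lambda>s \<omega>. C * norm (z k s \<omega>) - h s \<omega>))"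
      using Ylim zlim by (auto simp: L2_tendsto_def)
    have "(\<integral>\<omega>. pen (Y k t \<omega>) \<partial>M)
      + (\<integral>(s, \<omega>). pen1 (Y k s \<omega>) * (C * norm (z k s \<omega>) - h s \<omega>) - C\<^sup>2 * pen (Y k s \<omega>) \<partial>time_space M t T)
      \<le> (\<integral>\<omega>. pen (Y k T \<omega>) \<partial>M)"
      by (rule step_ito_inequality[OF T J h YF Ym Ys Ysq[OF T0(1)] AE_I2[OF Y0] t])
    also have "(\<integral>(s, \<omega>). pen1 (Y k s \<omega>) * (C * norm (z k s \<omega>) - h s \<omega>) - C\<^sup>2 * pen (Y k s \<omega>) \<partial>time_space M t T)
      = (\<integral>y. pen1 (case_prod (Y k) y) * (case_prod (\<lambda>s \<omega>. C * norm (z k s \<omega>) - h s \<omega>) y) - C\<^sup>2 * pen (case_prod (Y k) y) \<partial>time_space M t T)"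
      by (simp add: case_prod_beta')
    also have "\<dots> = (\<integral>y. pen1 (case_prod (Y k) y) * (case_prod (\<lambda>s \<omega>. C * norm (z k s \<omega>) - h s \<omega>) y) \<partial>time_space M t T)
        - C\<^sup>2 * (\<integral>y. pen (case_prod (Y k) y) \<partial>time_space M t T)"
      using integrable_mult_square_integrable[OF square_integrable_pen1[OF sq(1)] sq(2)] integrable_pen[OF sq(1)] by simp
    finally show ?thesis .
  qed
  have fin: "(\<integral>\<omega>. pen (X t \<omega>) \<partial>M)
      + ((\<integral>y. pen1 (case_prod X y) * (case_prod (\<lambda>s \<omega>. C * norm (Z s \<omega>) - h s \<omega>) y) \<partial>time_space M t T)
        - C\<^sup>2 * (\<integral>y. pen (case_prod X y) \<partial>time_space M t T))
    \<le> (\<integral>\<omega>. pen (X T \<omega>) \<partial>M)"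
    by (rule LIMSEQ_le[OF tendsto_add[OF lim_s[OF t] lim_int] lim_s[OF T0(2)]]) (use ineq in blast)
  have sq: "square_integrable (time_space M t T) (case_prod X)"
    "square_integrable (time_space M t T) (case_prod (\<lambda>s \<omega>. C * norm (Z s \<omega>) - h s \<omega>))"
    using Ylim zlim by (auto simp: L2_tendsto_def)
  have "(\<integral>(s, \<omega>). pen1 (X s \<omega>) * (C * norm (Z s \<omega>) - h s \<omega>) - C\<^sup>2 * pen (X s \<omega>) \<partial>time_space M t T)
      = (\<integral>y. pen1 (case_prod X y) * (case_prod (\<lambda>s \<omega>. C * norm (Z s \<omega>) - h s \<omega>) y) - C\<^sup>2 * pen (case_prod X y) \<partial>time_space M t T)"
      by (simp add: case_prod_beta')
  also have "\<dots> = (\<integral>y. pen1 (case_prod X y) * (case_prod (\<lambda>s \<omega>. C * norm (Z s \<omega>) - h s \<omega>) y) \<partial>time_space M t T)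
        - C\<^sup>2 * (\<integral>y. pen (case_prod X y) \<partial>time_space M t T)"
      using integrable_mult_square_integrable[OF square_integrable_pen1[OF sq(1)] sq(2)] integrable_pen[OF sq(1)] by simp
  finally show ?thesis using fin by simp
qed

end

section \<open>From the definitions of processes and Ito integrals to convergence in L^2\<close>

lemma L2_tendsto_of_nn_integral:
  assumes fs: "\<And>k. square_integrable N (fs k)" and f: "f \<in> borel_measurable N"
    and lim: "(\<lambda>k. \<integral>\<^sup>+x. ennreal ((fs k x - f x)\<^sup>2) \<partial>N) \<longlonglongrightarrow> 0"
  shows "L2_tendsto N fs f"
proof -
  have [measurable]: "fs k \<in> borel_measurable N" for k using fs by measurable
  note [measurable] = f
  \<comment> \<open>Square integrability of the limit is a consequence: it lies at finite L^2
    distance from some fs k.\<close>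
  have "\<forall>\<^sub>F k in sequentially. (\<integral>\<^sup>+x. ennreal ((fs k x - f x)\<^sup>2) \<partial>N) < 1"
    by (rule order_tendstoD(2)[OF lim]) simp
  then obtain k where "(\<integral>\<^sup>+x. ennreal ((fs k x - f x)\<^sup>2) \<partial>N) < 1"
    using eventually_happens[of _ sequentially] by auto
  then have "integrable N (\<lambda>x. (fs k x - f x)\<^sup>2)"
    by (intro integrableI_nonneg) (auto elim: order.strict_trans)
  then have "square_integrable N (\<lambda>x. fs k x - f x)" by (simp add: square_integrable_def)
  from square_integrable_diff[OF fs[of k] this] have sf: "square_integrable N f" by simp
  have i: "integrable N (\<lambda>x. (fs k x - f x)\<^sup>2)" for k
    by (intro square_integrableD square_integrable_diff fs sf)
  have "(\<integral>\<^sup>+x. ennreal ((fs k x - f x)\<^sup>2) \<partial>N) = ennreal (\<integral>x. (fs k x - f x)\<^sup>2 \<partial>N)" for k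
    by (rule nn_integral_eq_integral[OF i]) simp
  then have "(\<lambda>k. \<integral>x. (fs k x - f x)\<^sup>2 \<partial>N) \<longlonglongrightarrow> 0"
    using lim by (simp add: ennreal_tendsto_0_iff)
  then show ?thesis using fs sf by (simp add: L2_tendsto_def)
qed

context prob_space
begin

lemma nn_integral_time_space:
  assumes f: "case_prod f \<in> borel_measurable (time_space M a b)"
  shows "(\<integral>\<^sup>+\<omega>. (\<integral>\<^sup>+t\<in>{a..b}. f t \<omega> \<partial>lborel) \<partial>M) = integral\<^sup>N (time_space M a b) (case_prod f)"
    and "(\<integral>\<^sup>+t\<in>{a..b}. (\<integral>\<^sup>+\<omega>. f t \<omega> \<partial>M) \<partial>lborel) = integral\<^sup>N (time_space M a b) (case_prod f)"
proof -
  interpret P: pair_sigma_finite "lborel_Icc a b" M by (rule pair_sigma_finite_time)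
  show "(\<integral>\<^sup>+\<omega>. (\<integral>\<^sup>+t\<in>{a..b}. f t \<omega> \<partial>lborel) \<partial>M) = integral\<^sup>N (time_space M a b) (case_prod f)"
    using P.nn_integral_snd[OF f[unfolded time_space_def]]
    by (simp add: nn_integral_restrict_space time_space_def)
  show "(\<integral>\<^sup>+t\<in>{a..b}. (\<integral>\<^sup>+\<omega>. f t \<omega> \<partial>M) \<partial>lborel) = integral\<^sup>N (time_space M a b) (case_prod f)"
    using nn_integral_fst[OF f[unfolded time_space_def]]
    by (simp add: nn_integral_restrict_space time_space_def)
qed

lemma measurable_process_iff:
  "measurable_process M a b \<phi> \<longleftrightarrow> case_prod \<phi> \<in> borel_measurable (time_space M a b)"
  unfolding measurable_process_def measurable_cong_sets[OF sets_time_space refl] ..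

lemma L2_process_square_integrable:
  assumes \<phi>: "\<phi> \<in> L2_process M F a b"
  shows "square_integrable (time_space M a b) (\<lambda>(t, \<omega>). norm (\<phi> t \<omega>))"
proof -
  have m: "case_prod \<phi> \<in> borel_measurable (time_space M a b)"
    using \<phi> by (simp add: L2_process_def measurable_process_iff)
  then have mn: "(\<lambda>(t, \<omega>). norm (\<phi> t \<omega>)) \<in> borel_measurable (time_space M a b)" by (simp add: case_prod_beta')
  have m2: "case_prod (\<lambda>t \<omega>. ennreal ((norm (\<phi> t \<omega>))\<^sup>2)) \<in> borel_measurable (time_space M a b)"
    using m by (simp add: case_prod_beta')
  have "integral\<^sup>N (time_space M a b) (case_prod (\<lambda>t \<omega>. ennreal ((norm (\<phi> t \<omega>))\<^sup>2))) < \<infinity>"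
    using \<phi> nn_integral_time_space(1)[OF m2] by (simp add: L2_process_def)
  then have "integrable (time_space M a b) (\<lambda>x. (case x of (t, \<omega>) \<Rightarrow> norm (\<phi> t \<omega>))\<^sup>2)"
    using mn by (intro integrableI_nonneg) (simp_all add: case_prod_beta')
  then show ?thesis using mn by (simp add: square_integrable_def)
qed

end

context brownian_basis
begin

text \<open>The supremum stands inside the expectation, so a single constant bounds the second
  moments at all fixed times.\<close>

lemma S2_process_square_integrable:
  fixes \<phi> :: "real \<Rightarrow> 'a \<Rightarrow> real"
  assumes \<phi>: "\<phi> \<in> S2_process M F a b" and a: "0 \<le> a"
  obtains B where "\<And>s. s \<in> {a..b} \<Longrightarrow> square_integrable M (\<phi> s)" "\<And>s. s \<in> {a..b} \<Longrightarrow> (\<integral>\<omega>. (\<phi> s \<omega>)\<^sup>2 \<partial>M) \<le> B"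
proof -
  define S where "S = (\<integral>\<^sup>+\<omega>. (SUP t\<in>{a..b}. ennreal ((norm (\<phi> t \<omega>))\<^sup>2)) \<partial>M)"
  have S: "S < \<infinity>" using \<phi> by (simp add: S2_process_def S_def)
  have nn: "(\<integral>\<^sup>+\<omega>. ennreal ((\<phi> s \<omega>)\<^sup>2) \<partial>M) \<le> S" if "s \<in> {a..b}" for s
    unfolding S_def by (intro nn_integral_mono SUP_upper2[OF that]) simp
  have m: "\<phi> s \<in> borel_measurable M" if s: "s \<in> {a..b}" for s
    using \<phi> s a by (intro from_F[of s]) (auto simp: S2_process_def L2_process_def adapted_process_def)
  have i: "integrable M (\<lambda>\<omega>. (\<phi> s \<omega>)\<^sup>2)" if s: "s \<in> {a..b}" for s
    using nn[OF s] S m[OF s] by (intro integrableI_nonneg) auto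
  show thesis
  proof (rule that)
    fix s assume s: "s \<in> {a..b}"
    show "square_integrable M (\<phi> s)" using i[OF s] m[OF s] by (simp add: square_integrable_def)
    have "ennreal (\<integral>\<omega>. (\<phi> s \<omega>)\<^sup>2 \<partial>M) \<le> S"
      using nn[OF s] nn_integral_eq_integral[OF i[OF s]] by simp
    also have "S = ennreal (enn2real S)" using S by (simp add: less_top)
    finally show "(\<integral>\<omega>. (\<phi> s \<omega>)\<^sup>2 \<partial>M) \<le> enn2real S" by (simp add: ennreal_le_iff)
  qed
qed

lemma L2_rv_square_integrable:
  assumes "0 \<le> r" "\<theta> \<in> L2_rv M (F r)" shows "square_integrable M \<theta>"
  unfolding square_integrable_def using assms(2) by (intro conjI from_F[OF assms(1)]) (simp_all add: L2_rv_def)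

text \<open>The supremum bound supplies square integrability at the single time r, which membership
  in \<open>L2_process\<close> alone does not give.\<close>

lemma S2_process_anticipated_args:
  fixes \<phi> :: "real \<Rightarrow> 'a \<Rightarrow> real"
  assumes \<phi>: "\<phi> \<in> S2_process M F 0 U" and s: "0 \<le> s" "s \<le> r" "r \<le> U"
  shows "\<phi> \<in> anticipated_args M F s r U"
proof -
  have L2: "\<phi> \<in> L2_process M F 0 U" using \<phi> by (simp add: S2_process_def)
  have "(\<integral>\<^sup>+\<omega>. (\<integral>\<^sup>+t\<in>{s..U}. ennreal ((norm (\<phi> t \<omega>))\<^sup>2) \<partial>lborel) \<partial>M)
      \<le> (\<integral>\<^sup>+\<omega>. (\<integral>\<^sup>+t\<in>{0..U}. ennreal ((norm (\<phi> t \<omega>))\<^sup>2) \<partial>lborel) \<partial>M)"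
    using s by (intro nn_integral_mono) (auto split: split_indicator)
  also have "\<dots> < \<infinity>" using L2 by (simp add: L2_process_def)
  finally have "(\<integral>\<^sup>+\<omega>. (\<integral>\<^sup>+t\<in>{s..U}. ennreal ((norm (\<phi> t \<omega>))\<^sup>2) \<partial>lborel) \<partial>M) < \<infinity>" .
  moreover have "case_prod \<phi> \<in> borel_measurable (time_space M 0 U)"
    using L2 by (simp add: L2_process_def measurable_process_iff)
  then have "measurable_process M s U \<phi>"
    unfolding measurable_process_iff by (rule measurable_time_space_mono) (use s in auto)
  moreover have "adapted_process F s U \<phi>" "\<phi> r \<in> borel_measurable (F r)"
    using L2 s by (simp_all add: L2_process_def adapted_process_def)
  moreover have "square_integrable M (\<phi> r)"
  proof -
    obtain B where "\<And>s. s \<in> {0..U} \<Longrightarrow> square_integrable M (\<phi> s)"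
      "\<And>s. s \<in> {0..U} \<Longrightarrow> (\<integral>\<omega>. (\<phi> s \<omega>)\<^sup>2 \<partial>M) \<le> B"
      by (rule S2_process_square_integrable[OF \<phi> order_refl], rule that)
    then show ?thesis using s by simp
  qed
  ultimately show ?thesis
    by (simp add: anticipated_args_def L2_process_def L2_rv_def square_integrable_def)
qed

text \<open>Provides an admissible argument above both solutions, at which the monotonicity of the
  generator can be applied.\<close>

lemma anticipated_args_max:
  fixes \<phi> \<psi> :: "real \<Rightarrow> 'a \<Rightarrow> real"
  assumes \<phi>: "\<phi> \<in> anticipated_args M F s r U" and \<psi>: "\<psi> \<in> anticipated_args M F s r U" and r: "0 \<le> r"
  shows "(\<lambda>t \<omega>. max (\<phi> t \<omega>) (\<psi> t \<omega>)) \<in> anticipated_args M F s r U"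
proof -
  have m: "case_prod \<phi> \<in> borel_measurable (time_space M s U)" "case_prod \<psi> \<in> borel_measurable (time_space M s U)"
    using \<phi> \<psi> by (simp_all add: anticipated_args_def L2_process_def measurable_process_iff)
  have mm: "case_prod (\<lambda>t \<omega>. max (\<phi> t \<omega>) (\<psi> t \<omega>)) \<in> borel_measurable (time_space M s U)"
    using m by (simp add: case_prod_beta')
  have max2: "\<bar>max x y\<bar> \<le> \<bar>\<bar>x\<bar> + \<bar>y\<bar>\<bar>" for x y :: real by simp
  have "\<phi> \<in> L2_process M F s U" "\<psi> \<in> L2_process M F s U" using \<phi> \<psi> by (auto simp: anticipated_args_def)
  from square_integrable_add[OF this[THEN L2_process_square_integrable]]
  have "square_integrable (time_space M s U) (\<lambda>x. \<bar>\<phi> (fst x) (snd x)\<bar> + \<bar>\<psi> (fst x) (snd x)\<bar>)"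
    by (simp add: case_prod_beta')
  then have "square_integrable (time_space M s U) (case_prod (\<lambda>t \<omega>. max (\<phi> t \<omega>) (\<psi> t \<omega>)))"
    by (rule square_integrable_bound[OF _ mm]) (simp add: case_prod_beta' max2)
  then have "integrable (time_space M s U) (\<lambda>(t, \<omega>). (norm (max (\<phi> t \<omega>) (\<psi> t \<omega>)))\<^sup>2)"
    by (simp add: square_integrable_def case_prod_beta')
  then have fin: "(\<integral>\<^sup>+\<omega>. (\<integral>\<^sup>+t\<in>{s..U}. ennreal ((norm (max (\<phi> t \<omega>) (\<psi> t \<omega>)))\<^sup>2) \<partial>lborel) \<partial>M) < \<infinity>"
    using mm by (subst nn_integral_time_space(1))
      (simp_all add: case_prod_beta' integrable_iff_bounded)
  have sr: "square_integrable M (\<phi> r)" "square_integrable M (\<psi> r)"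
    using \<phi> \<psi> by (simp_all add: anticipated_args_def L2_rv_square_integrable[OF r])
  have "square_integrable M (\<lambda>\<omega>. max (\<phi> r \<omega>) (\<psi> r \<omega>))"
  proof (rule square_integrable_bound)
    show "square_integrable M (\<lambda>\<omega>. \<bar>\<phi> r \<omega>\<bar> + \<bar>\<psi> r \<omega>\<bar>)"
      by (intro square_integrable_add square_integrable_abs sr)
    show "(\<lambda>\<omega>. max (\<phi> r \<omega>) (\<psi> r \<omega>)) \<in> borel_measurable M"
      by (intro borel_measurable_max square_integrable_measurable sr)
  qed (simp add: max2)
  then have "integrable M (\<lambda>\<omega>. (max (\<phi> r \<omega>) (\<psi> r \<omega>))\<^sup>2)" by (rule square_integrableD)
  moreover have "(\<lambda>\<omega>. max (\<phi> t \<omega>) (\<psi> t \<omega>)) \<in> borel_measurable (F t)" if "t \<in> {s..U}" for t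
  proof -
    have "\<phi> t \<in> borel_measurable (F t)" "\<psi> t \<in> borel_measurable (F t)"
      using \<phi> \<psi> that by (simp_all add: anticipated_args_def L2_process_def adapted_process_def)
    then show ?thesis by (intro borel_measurable_max)
  qed
  moreover have "(\<lambda>\<omega>. max (\<phi> r \<omega>) (\<psi> r \<omega>)) \<in> borel_measurable (F r)"
  proof -
    have "\<phi> r \<in> borel_measurable (F r)" "\<psi> r \<in> borel_measurable (F r)"
      using \<phi> \<psi> by (simp_all add: anticipated_args_def L2_rv_def)
    then show ?thesis by (intro borel_measurable_max)
  qed
  ultimately show ?thesis
    using fin mm by (simp add: anticipated_args_def L2_process_def L2_rv_def adapted_process_def measurable_process_iff)
qed

lemma anticipated_args_zero: "(\<lambda>_ _. 0) \<in> anticipated_args M F s r U"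
  by (simp add: anticipated_args_def L2_process_def L2_rv_def adapted_process_def measurable_process_def split_def)

text \<open>Here \<open>V\<close> is the original Brownian motion and \<open>W\<close> its modification.\<close>

lemma is_ito_integral_approximation:
  assumes T: "0 < T" and V: "\<And>t. 0 \<le> t \<Longrightarrow> AE \<omega> in M. W t \<omega> = V t \<omega>"
    and Z: "Z \<in> L2_process M F 0 T" and I: "is_ito_integral M F V T Z I"
  obtains P N z J where "\<And>k. step_integral T (P k) (N k) (z k) (J k)"
    and "L2_tendsto (time_space M 0 T) (\<lambda>k (s, \<omega>). norm (z k s \<omega> - Z s \<omega>)) (\<lambda>(s, \<omega>). 0)"
    and "\<And>s. s \<in> {0..T} \<Longrightarrow> L2_tendsto M (\<lambda>k. J k s) (I s)"
proof -
  obtain n \<tau> H where simple: "\<And>k. simple_integrand M F T (n k) (\<tau> k) (H k)"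
    and limZ: "(\<lambda>k. \<integral>\<^sup>+\<omega>. (\<integral>\<^sup>+t\<in>{0..T}. ennreal ((norm (Z t \<omega> - simple_process (n k) (\<tau> k) (H k) t \<omega>))\<^sup>2)
                \<partial>lborel) \<partial>M) \<longlonglongrightarrow> 0"
    and limI: "\<And>t. t \<in> {0..T} \<Longrightarrow> (\<lambda>k. \<integral>\<^sup>+\<omega>. ennreal ((I t \<omega> - simple_integral V (n k) (\<tau> k) (H k) t \<omega>)\<^sup>2) \<partial>M) \<longlonglongrightarrow> 0"
    using I unfolding is_ito_integral_def by blast
  define z where "z k = simple_process (n k) (\<tau> k) (H k)" for k
  define J where "J k = simple_integral W (n k) (\<tau> k) (H k)" for k
  have "\<exists>P N. step_integral T P N (z k) (J k)" for k
    unfolding z_def J_def by (rule simple_integral_step[OF T simple[of k]]) blast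
  then obtain P N where st: "\<And>k. step_integral T (P k) (N k) (z k) (J k)" by metis
  have Zm: "case_prod Z \<in> borel_measurable (time_space M 0 T)"
    using Z by (simp add: L2_process_def measurable_process_iff)
  have zm: "case_prod (z k) \<in> borel_measurable (time_space M 0 T)" for k by (rule step_integralD(3)[OF st])
  have zZm: "(\<lambda>x. z k (fst x) (snd x) - Z (fst x) (snd x)) \<in> borel_measurable (time_space M 0 T)" for k
    using borel_measurable_diff[OF zm[of k] Zm] by (simp add: case_prod_beta')
  interpret TS: finite_measure "time_space M 0 T" by (rule finite_measure_time_space)
  have "L2_tendsto (time_space M 0 T) (\<lambda>k (s, \<omega>). norm (z k s \<omega> - Z s \<omega>)) (\<lambda>(s, \<omega>). 0)"
  proof (rule L2_tendsto_of_nn_integral)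
    fix k
    have "square_integrable (time_space M 0 T) (\<lambda>x. N k + norm (Z (fst x) (snd x)))"
      using L2_process_square_integrable[OF Z]
      by (intro square_integrable_add TS.square_integrable_const) (simp add: case_prod_beta')
    then show "square_integrable (time_space M 0 T) (\<lambda>(s, \<omega>). norm (z k s \<omega> - Z s \<omega>))"
    proof (rule square_integrable_bound)
      show "(\<lambda>(s, \<omega>). norm (z k s \<omega> - Z s \<omega>)) \<in> borel_measurable (time_space M 0 T)"
        using zZm[of k] by (simp add: case_prod_beta')
      show "AE x in time_space M 0 T. \<bar>case x of (s, \<omega>) \<Rightarrow> norm (z k s \<omega> - Z s \<omega>)\<bar> \<le> \<bar>N k + norm (Z (fst x) (snd x))\<bar>"
      proof (rule AE_I2)
        fix x assume "x \<in> space (time_space M 0 T)"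
        then have "norm (z k (fst x) (snd x)) \<le> N k"
          using step_integralD(6)[OF st] by (auto simp: space_time_space)
        then have "norm (z k (fst x) (snd x) - Z (fst x) (snd x)) \<le> N k + norm (Z (fst x) (snd x))"
          using norm_triangle_ineq4[of "z k (fst x) (snd x)" "Z (fst x) (snd x)"] by linarith
        then show "\<bar>case x of (s, \<omega>) \<Rightarrow> norm (z k s \<omega> - Z s \<omega>)\<bar> \<le> \<bar>N k + norm (Z (fst x) (snd x))\<bar>"
          by (simp add: case_prod_beta')
      qed
    qed
  next
    have m: "case_prod (\<lambda>t \<omega>. ennreal ((norm (Z t \<omega> - z k t \<omega>))\<^sup>2)) \<in> borel_measurable (time_space M 0 T)" for k
      using borel_measurable_diff[OF Zm zm[of k]] by (simp add: case_prod_beta')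
    show "(\<lambda>k. \<integral>\<^sup>+x. ennreal (((case x of (s, \<omega>) \<Rightarrow> norm (z k s \<omega> - Z s \<omega>)) - (case x of (s, \<omega>) \<Rightarrow> 0))\<^sup>2) \<partial>time_space M 0 T) \<longlonglongrightarrow> 0"
      using limZ by (simp add: nn_integral_time_space(1)[OF m, unfolded z_def] z_def case_prod_beta' norm_minus_commute)
  qed simp
  moreover have "L2_tendsto M (\<lambda>k. J k s) (I s)" if s: "s \<in> {0..T}" for s
  proof (rule L2_tendsto_of_nn_integral)
    show "square_integrable M (J k s)" for k using step_integral_square(1)[OF st, of 0 s] s by auto
    have "I s \<in> borel_measurable (F s)"
      using I s by (auto simp: is_ito_integral_def adapted_process_def)
    then show "I s \<in> borel_measurable M" using s by (intro from_F[of s]) auto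
    have nonneg: "0 \<le> \<tau> k i" if "i \<le> n k" for k i
      using that
    proof (induction i)
      case (Suc i)
      then have "0 \<le> \<tau> k i" "\<tau> k i < \<tau> k (Suc i)"
        using simple[of k] by (simp_all add: simple_integrand_def)
      then show ?case by simp
    qed (use simple[of k] in \<open>simp add: simple_integrand_def\<close>)
    \<comment> \<open>W and V agree almost surely at each fixed time; a simple integral involves
      finitely many times, so one null set suffices.\<close>
    have ae: "AE \<omega> in M. J k s \<omega> = simple_integral V (n k) (\<tau> k) (H k) s \<omega>" for k
    proof -
      have "AE \<omega> in M. \<forall>i\<in>{..n k}. W (min s (\<tau> k i)) \<omega> = V (min s (\<tau> k i)) \<omega>"
        using nonneg s by (subst AE_ball_countable) (auto intro!: V)
      then show ?thesis
        by eventually_elim (simp add: J_def simple_integral_def)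
    qed
    have "(\<integral>\<^sup>+\<omega>. ennreal ((J k s \<omega> - I s \<omega>)\<^sup>2) \<partial>M) = (\<integral>\<^sup>+\<omega>. ennreal ((I s \<omega> - simple_integral V (n k) (\<tau> k) (H k) s \<omega>)\<^sup>2) \<partial>M)" for k
      by (rule nn_integral_cong_AE) (use ae[of k] in eventually_elim, simp add: power2_commute)
    then show "(\<lambda>k. \<integral>\<^sup>+\<omega>. ennreal ((J k s \<omega> - I s \<omega>)\<^sup>2) \<partial>M) \<longlonglongrightarrow> 0"
      using limI[OF s] by simp
  qed
  ultimately show thesis using st by (intro that)
qed

end

section \<open>Generators\<close>

text \<open>The order holds for each fixed y and z off its own null set. A countable dense set of
  points needs only one null set, and off it the Lipschitz bounds extend the order to all y and z.
  This is what permits inserting the random values of a solution.\<close>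

lemma AE_Lipschitz_le_all:
  fixes f g :: "real \<Rightarrow> 'c :: {second_countable_topology, real_normed_vector} \<Rightarrow> 'a \<Rightarrow> real"
  assumes f: "AE \<omega> in M. \<forall>y y' z z'. \<bar>f y z \<omega> - f y' z' \<omega>\<bar> \<le> C * (\<bar>y - y'\<bar> + norm (z - z'))"
    and g: "AE \<omega> in M. \<forall>y y' z z'. \<bar>g y z \<omega> - g y' z' \<omega>\<bar> \<le> C' * (\<bar>y - y'\<bar> + norm (z - z'))"
    and le: "\<And>y z. AE \<omega> in M. g y z \<omega> \<le> f y z \<omega>" and C: "0 < C" "0 < C'"
  shows "AE \<omega> in M. \<forall>y z. g y z \<omega> \<le> f y z \<omega>"
proof -
  obtain D :: "(real \<times> 'c) set" where D: "countable D" "\<And>X. open X \<Longrightarrow> X \<noteq> {} \<Longrightarrow> \<exists>d\<in>D. d \<in> X"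
    by (rule countable_dense_setE, rule that)
  have "AE \<omega> in M. \<forall>d\<in>D. g (fst d) (snd d) \<omega> \<le> f (fst d) (snd d) \<omega>"
    using le D(1) by (simp add: AE_ball_countable)
  with f g show ?thesis
  proof eventually_elim
    case (elim \<omega>)
    show ?case
    proof (rule allI, rule allI, rule field_le_epsilon)
      fix y :: real and z :: 'c and e :: real assume e: "0 < e"
      \<comment> \<open>A dense point within \<eta> costs C * 2 \<eta> for f and C' * 2 \<eta> for
        g, together exactly e.\<close>
      define \<eta> where "\<eta> = e / (2 * (C + C'))"
      have \<eta>: "0 < \<eta>" "2 * (C + C') * \<eta> = e" using e C by (auto simp: \<eta>_def)
      have "open (ball (y, z) \<eta>)" "ball (y, z) \<eta> \<noteq> {}" using \<eta> by auto
      from D(2)[OF this] obtain d where d: "d \<in> D" "dist (y, z) d < \<eta>" by (auto simp: mem_ball)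
      have "\<bar>y - fst d\<bar> < \<eta>" "norm (z - snd d) < \<eta>"
        using d(2) dist_fst_le[of "(y, z)" d] dist_snd_le[of "(y, z)" d] by (auto simp: dist_norm)
      then have near: "\<bar>y - fst d\<bar> + norm (z - snd d) \<le> 2 * \<eta>" by simp
      have "\<bar>f y z \<omega> - f (fst d) (snd d) \<omega>\<bar> \<le> C * (2 * \<eta>)"
        using elim(1) mult_left_mono[OF near, of C] C by (meson less_imp_le order_trans)
      moreover have "\<bar>g y z \<omega> - g (fst d) (snd d) \<omega>\<bar> \<le> C' * (2 * \<eta>)"
        using elim(2) mult_left_mono[OF near, of C'] C by (meson less_imp_le order_trans)
      moreover have "g (fst d) (snd d) \<omega> \<le> f (fst d) (snd d) \<omega>" using elim(3) d by blast
      moreover have "C * (2 * \<eta>) + C' * (2 * \<eta>) = e" using \<eta>(2) by (simp add: algebra_simps)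
      ultimately show "g y z \<omega> \<le> f y z \<omega> + e" by linarith
    qed
  qed
qed

context brownian_basis
begin

lemma cond_exp_subalgebra: "0 \<le> s \<Longrightarrow> finite_measure_subalgebra M (F s)"
  by (simp add: finite_measure_subalgebra_def finite_measure_subalgebra_axioms_def F_subalgebra finite_measure_axioms)

lemma generator_lipschitz_same:
  assumes f: "\<And>\<theta> \<theta>'. \<theta> \<in> anticipated_args M F s r U \<Longrightarrow> \<theta>' \<in> anticipated_args M F s r U \<Longrightarrow>
      AE \<omega> in M. \<forall>y y' z z'. \<bar>f s y z (\<theta> r) \<omega> - f s y' z' (\<theta>' r) \<omega>\<bar>
        \<le> C * (\<bar>y - y'\<bar> + norm (z - z') + real_cond_exp M (F s) (\<lambda>\<omega>. \<bar>\<theta> r \<omega> - \<theta>' r \<omega>\<bar>) \<omega>)"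
    and s: "0 \<le> s" and \<theta>: "\<theta> \<in> anticipated_args M F s r U"
  shows "AE \<omega> in M. \<forall>y y' z z'. \<bar>f s y z (\<theta> r) \<omega> - f s y' z' (\<theta> r) \<omega>\<bar> \<le> C * (\<bar>y - y'\<bar> + norm (z - z'))"
proof -
  interpret S: finite_measure_subalgebra M "F s" by (rule cond_exp_subalgebra[OF s])
  have "AE \<omega> in M. real_cond_exp M (F s) (\<lambda>\<omega>. 0) \<omega> = 0"
    by (rule S.real_cond_exp_F_meas) auto
  with f[OF \<theta> \<theta>] show ?thesis by eventually_elim simp
qed

text \<open>Conditional Jensen for the square, followed by taking expectations.\<close>

lemma cond_exp_square_le:
  assumes s: "0 \<le> s" and V: "square_integrable M V"
  shows "square_integrable M (real_cond_exp M (F s) V)"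
    and "(\<integral>\<omega>. (real_cond_exp M (F s) V \<omega>)\<^sup>2 \<partial>M) \<le> (\<integral>\<omega>. (V \<omega>)\<^sup>2 \<partial>M)"
proof -
  interpret S: finite_measure_subalgebra M "F s" by (rule cond_exp_subalgebra[OF s])
  have VI: "integrable M V" by (rule square_integrable_integrable[OF V])
  have V2: "integrable M (\<lambda>\<omega>. (V \<omega>)\<^sup>2)" by (rule square_integrableD[OF V])
  have cvx: "convex_on UNIV (\<lambda>x :: real. x\<^sup>2)" by (rule convex_power2)
  have i: "integrable M (\<lambda>\<omega>. (real_cond_exp M (F s) V \<omega>)\<^sup>2)"
    by (rule S.integrable_convex_cond_exp[OF VI, of UNIV _ _ "\<lambda>x. x\<^sup>2"]) (use V2 cvx in auto)
  then show "square_integrable M (real_cond_exp M (F s) V)"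
    by (simp add: square_integrable_def)
  have "AE \<omega> in M. (real_cond_exp M (F s) V \<omega>)\<^sup>2 \<le> real_cond_exp M (F s) (\<lambda>\<omega>. (V \<omega>)\<^sup>2) \<omega>"
    by (rule S.real_cond_exp_jensens_inequality(2)[OF VI, of UNIV _ _ "\<lambda>x. x\<^sup>2"]) (use V2 cvx in auto)
  then have "(\<integral>\<omega>. (real_cond_exp M (F s) V \<omega>)\<^sup>2 \<partial>M) \<le> (\<integral>\<omega>. real_cond_exp M (F s) (\<lambda>\<omega>. (V \<omega>)\<^sup>2) \<omega> \<partial>M)"
    by (intro integral_mono_AE i S.real_cond_exp_int V2)
  also have "\<dots> = (\<integral>\<omega>. (V \<omega>)\<^sup>2 \<partial>M)" by (rule S.real_cond_exp_int[OF V2])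
  finally show "(\<integral>\<omega>. (real_cond_exp M (F s) V \<omega>)\<^sup>2 \<partial>M) \<le> (\<integral>\<omega>. (V \<omega>)\<^sup>2 \<partial>M)" .
qed

end

section \<open>Estimates on the drift and the forward form of a solution\<close>

context brownian_basis
begin

text \<open>The definition of a solution grants integrable paths, while the Taylor errors involve E
  h^2. Comparison with f(s, 0, 0, 0) bounds the drift by v plus C times a conditional
  expectation.\<close>

lemma drift_square_integrable:
  assumes T: "0 < T" and \<delta>: "\<And>s. s \<in> {0..T} \<Longrightarrow> 0 \<le> \<delta> s \<and> s + \<delta> s \<le> T + K"
    and lip: "generator_lipschitz M F T K f" and f0: "generator_square_integrable M F T f"
    and Y: "Y \<in> S2_process M F 0 (T + K)" and Z: "Z \<in> L2_process M F 0 T"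
    and m: "measurable_process M 0 T (absde_drift f \<delta> Y Z)"
  shows "square_integrable (time_space M 0 T) (case_prod (absde_drift f \<delta> Y Z))"
proof -
  let ?N = "time_space M 0 T"
  obtain C where C: "0 < C" and lipC: "\<And>s r \<theta> \<theta>'. s \<in> {0..T} \<Longrightarrow> r \<in> {s..T + K} \<Longrightarrow>
      \<theta> \<in> anticipated_args M F s r (T + K) \<Longrightarrow> \<theta>' \<in> anticipated_args M F s r (T + K) \<Longrightarrow>
      AE \<omega> in M. \<forall>y y' z z'. \<bar>f s y z (\<theta> r) \<omega> - f s y' z' (\<theta>' r) \<omega>\<bar>
        \<le> C * (\<bar>y - y'\<bar> + norm (z - z') + real_cond_exp M (F s) (\<lambda>\<omega>. \<bar>\<theta> r \<omega> - \<theta>' r \<omega>\<bar>) \<omega>)"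
    using lip unfolding generator_lipschitz_def by blast
  obtain B where B: "\<And>s. s \<in> {0..T + K} \<Longrightarrow> square_integrable M (Y s)"
      "\<And>s. s \<in> {0..T + K} \<Longrightarrow> (\<integral>\<omega>. (Y s \<omega>)\<^sup>2 \<partial>M) \<le> B"
    by (rule S2_process_square_integrable[OF Y order_refl], rule that)
  define v where "v s \<omega> = \<bar>f s 0 0 (\<lambda>_. 0) \<omega>\<bar> + C * \<bar>Y s \<omega>\<bar> + C * norm (Z s \<omega>)" for s \<omega>
  have K0: "0 \<le> K" using \<delta>[of T] T by simp
  have "square_integrable (time_space M 0 (T + K)) (case_prod (\<lambda>s \<omega>. \<bar>Y s \<omega>\<bar>))"
    using Y L2_process_square_integrable[of Y F 0 "T + K"] by (simp add: S2_process_def)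
  from square_integrable_time_space_mono[OF this order_refl, of T] K0
  have YN: "square_integrable ?N (\<lambda>x. \<bar>Y (fst x) (snd x)\<bar>)" by (simp add: case_prod_beta')
  have ZN: "square_integrable ?N (\<lambda>x. norm (Z (fst x) (snd x)))"
    using L2_process_square_integrable[OF Z] by (simp add: case_prod_beta')
  have fN: "square_integrable ?N (\<lambda>x. \<bar>f (fst x) 0 0 (\<lambda>_. 0) (snd x)\<bar>)"
    using L2_process_square_integrable[OF f0[unfolded generator_square_integrable_def]] by (simp add: case_prod_beta')
  have v: "square_integrable ?N (case_prod v)"
    unfolding v_def case_prod_beta' by (intro square_integrable_add square_integrable_cmult YN ZN fN)
  have vm: "case_prod v \<in> borel_measurable ?N" using v by measurable
  have dm: "case_prod (absde_drift f \<delta> Y Z) \<in> borel_measurable ?N" using m by (simp add: measurable_process_iff)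
  have d2: "case_prod (\<lambda>s \<omega>. ennreal ((absde_drift f \<delta> Y Z s \<omega>)\<^sup>2)) \<in> borel_measurable ?N"
    using dm by (simp add: case_prod_beta')
  have v2: "case_prod (\<lambda>s \<omega>. ennreal ((v s \<omega>)\<^sup>2)) \<in> borel_measurable ?N"
    using vm by (simp add: case_prod_beta')
  \<comment> \<open>The conditional expectation is chosen separately for each s, and nothing is
    known about its joint measurability. It is therefore replaced by a constant at fixed s, through
    the contraction in L^2, before time is integrated out.\<close>
  have bound: "(\<integral>\<^sup>+\<omega>. ennreal ((absde_drift f \<delta> Y Z s \<omega>)\<^sup>2) \<partial>M)
      \<le> 2 * (\<integral>\<^sup>+\<omega>. ennreal ((v s \<omega>)\<^sup>2) \<partial>M) + ennreal (2 * C\<^sup>2 * B)" if s: "s \<in> {0..T}" for s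
  proof -
    define r where "r = s + \<delta> s"
    have r: "s \<le> r" "r \<le> T + K" "0 \<le> s" "r \<in> {s..T + K}" "r \<in> {0..T + K}" using \<delta>[OF s] s by (auto simp: r_def)
    define E where "E = real_cond_exp M (F s) (\<lambda>\<omega>. \<bar>Y r \<omega>\<bar>)"
    have absY: "square_integrable M (\<lambda>\<omega>. \<bar>Y r \<omega>\<bar>)" by (intro square_integrable_abs B r)
    have E: "square_integrable M E" "(\<integral>\<omega>. (E \<omega>)\<^sup>2 \<partial>M) \<le> B"
      using cond_exp_square_le[OF r(3) absY] B(2)[OF r(5)] by (simp_all add: E_def)
    have Em: "E \<in> borel_measurable M" using E(1) by measurable
    have vs: "v s \<in> borel_measurable M" by (rule time_space_section_measurable[OF vm s])
    have "AE \<omega> in M. ennreal ((absde_drift f \<delta> Y Z s \<omega>)\<^sup>2) \<le> 2 * ennreal ((v s \<omega>)\<^sup>2) + ennreal (2 * C\<^sup>2 * (E \<omega>)\<^sup>2)"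
      using lipC[OF s r(4) S2_process_anticipated_args[OF Y r(3,1,2)] anticipated_args_zero]
    proof eventually_elim
      case (elim \<omega>)
      have d0: "\<bar>absde_drift f \<delta> Y Z s \<omega> - f s 0 0 (\<lambda>_. 0) \<omega>\<bar> \<le> C * (\<bar>Y s \<omega> - 0\<bar> + norm (Z s \<omega> - 0) + E \<omega>)"
        using elim[rule_format, of "Y s \<omega>" "Z s \<omega>" 0 0] unfolding absde_drift_def r_def[symmetric] E_def by simp
      have d: "\<bar>absde_drift f \<delta> Y Z s \<omega>\<bar> \<le> v s \<omega> + C * \<bar>E \<omega>\<bar>"
      proof -
        have "C * E \<omega> \<le> C * \<bar>E \<omega>\<bar>" using C by (intro mult_left_mono) auto
        moreover have "C * (\<bar>Y s \<omega> - 0\<bar> + norm (Z s \<omega> - 0) + E \<omega>) = C * \<bar>Y s \<omega>\<bar> + C * norm (Z s \<omega>) + C * E \<omega>"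
          by (simp add: algebra_simps)
        ultimately show ?thesis using d0 unfolding v_def by linarith
      qed
      have "(absde_drift f \<delta> Y Z s \<omega>)\<^sup>2 \<le> (v s \<omega> + C * \<bar>E \<omega>\<bar>)\<^sup>2"
        using power_mono[OF d, of 2] by simp
      also have "\<dots> \<le> 2 * (v s \<omega>)\<^sup>2 + 2 * C\<^sup>2 * (E \<omega>)\<^sup>2"
      proof -
        have "0 \<le> (v s \<omega> - C * \<bar>E \<omega>\<bar>)\<^sup>2" by simp
        then show ?thesis by (simp add: power2_sum power2_diff power_mult_distrib)
      qed
      finally have "ennreal ((absde_drift f \<delta> Y Z s \<omega>)\<^sup>2) \<le> ennreal (2 * (v s \<omega>)\<^sup>2 + 2 * C\<^sup>2 * (E \<omega>)\<^sup>2)"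
        by (rule ennreal_leI)
      also have "\<dots> = 2 * ennreal ((v s \<omega>)\<^sup>2) + ennreal (2 * C\<^sup>2 * (E \<omega>)\<^sup>2)"
        by (simp add: ennreal_plus ennreal_mult')
      finally show ?case .
    qed
    then have "(\<integral>\<^sup>+\<omega>. ennreal ((absde_drift f \<delta> Y Z s \<omega>)\<^sup>2) \<partial>M)
        \<le> (\<integral>\<^sup>+\<omega>. 2 * ennreal ((v s \<omega>)\<^sup>2) + ennreal (2 * C\<^sup>2 * (E \<omega>)\<^sup>2) \<partial>M)"
      by (rule nn_integral_mono_AE)
    also have "\<dots> = 2 * (\<integral>\<^sup>+\<omega>. ennreal ((v s \<omega>)\<^sup>2) \<partial>M) + (\<integral>\<^sup>+\<omega>. ennreal (2 * C\<^sup>2 * (E \<omega>)\<^sup>2) \<partial>M)"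
      using vs Em by (simp add: nn_integral_add nn_integral_cmult)
    also have "(\<integral>\<^sup>+\<omega>. ennreal (2 * C\<^sup>2 * (E \<omega>)\<^sup>2) \<partial>M) = ennreal (2 * C\<^sup>2 * (\<integral>\<omega>. (E \<omega>)\<^sup>2 \<partial>M))"
      using square_integrableD[OF E(1)] by (subst nn_integral_eq_integral) auto
    also have "\<dots> \<le> ennreal (2 * C\<^sup>2 * B)" using E(2) by (intro ennreal_leI mult_left_mono) auto
    finally show ?thesis by (simp add: add_left_mono)
  qed
  have "integral\<^sup>N ?N (case_prod (\<lambda>s \<omega>. ennreal ((absde_drift f \<delta> Y Z s \<omega>)\<^sup>2)))
      = (\<integral>\<^sup>+s\<in>{0..T}. (\<integral>\<^sup>+\<omega>. ennreal ((absde_drift f \<delta> Y Z s \<omega>)\<^sup>2) \<partial>M) \<partial>lborel)"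
    by (rule nn_integral_time_space(2)[OF d2, symmetric])
  also have "\<dots> = (\<integral>\<^sup>+s. (\<integral>\<^sup>+\<omega>. ennreal ((absde_drift f \<delta> Y Z s \<omega>)\<^sup>2) \<partial>M) \<partial>lborel_Icc 0 T)"
    by (simp add: nn_integral_restrict_space)
  also have "\<dots> \<le> (\<integral>\<^sup>+s. 2 * (\<integral>\<^sup>+\<omega>. ennreal ((v s \<omega>)\<^sup>2) \<partial>M) + ennreal (2 * C\<^sup>2 * B) \<partial>lborel_Icc 0 T)"
    by (rule nn_integral_mono) (simp add: space_restrict_space bound)
  also have "\<dots> = 2 * (\<integral>\<^sup>+s. (\<integral>\<^sup>+\<omega>. ennreal ((v s \<omega>)\<^sup>2) \<partial>M) \<partial>lborel_Icc 0 T) + (\<integral>\<^sup>+s. ennreal (2 * C\<^sup>2 * B) \<partial>lborel_Icc 0 T)"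
  proof -
    have "(\<lambda>s. \<integral>\<^sup>+\<omega>. ennreal ((v s \<omega>)\<^sup>2) \<partial>M) \<in> borel_measurable (lborel_Icc 0 T)"
      using borel_measurable_nn_integral_fst[OF v2[unfolded time_space_def]] by simp
    then show ?thesis by (simp add: nn_integral_add nn_integral_cmult)
  qed
  also have "(\<integral>\<^sup>+s. (\<integral>\<^sup>+\<omega>. ennreal ((v s \<omega>)\<^sup>2) \<partial>M) \<partial>lborel_Icc 0 T) = integral\<^sup>N ?N (\<lambda>x. ennreal ((case_prod v x)\<^sup>2))"
    using nn_integral_time_space(2)[OF v2] by (simp add: nn_integral_restrict_space case_prod_beta')
  also have "\<dots> = ennreal (\<integral>x. (case_prod v x)\<^sup>2 \<partial>?N)"
    by (rule nn_integral_eq_integral[OF square_integrableD[OF v]]) simp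
  also have "2 * \<dots> + (\<integral>\<^sup>+s. ennreal (2 * C\<^sup>2 * B) \<partial>lborel_Icc 0 T) < \<infinity>"
    using T by (simp add: space_restrict_space emeasure_restrict_space ennreal_mult_less_top)
  finally have "integral\<^sup>N ?N (\<lambda>x. ennreal ((case_prod (absde_drift f \<delta> Y Z) x)\<^sup>2)) < \<infinity>"
    by (simp add: case_prod_beta')
  then have "integrable ?N (\<lambda>x. (case_prod (absde_drift f \<delta> Y Z) x)\<^sup>2)"
    using dm by (intro integrableI_nonneg) auto
  then show ?thesis using dm by (simp add: square_integrable_def)
qed

text \<open>Two intermediate values are inserted: \<open>f\<^sub>2\<close> at the data of the second
  solution with the maximum m as future value, and \<open>f\<^sub>2\<close> at the data of the first
  solution. The outer differences have a sign and the middle one is Lipschitz. The constant is that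
  of \<open>f\<^sub>2\<close>; that of \<open>f\<^sub>1\<close> is used to obtain the order for all
  y and z at once.\<close>

lemma drift_difference_bound:
  assumes lip1: "generator_lipschitz M F T K f\<^sub>1" and lip2: "generator_lipschitz M F T K f\<^sub>2"
    and inc: "generator_increasing M F T K f\<^sub>2"
    and le: "\<forall>t\<in>{0..T}. \<forall>r\<in>{t..T + K}. \<forall>\<theta>\<in>anticipated_args M F t r (T + K). \<forall>y z.
      AE \<omega> in M. f\<^sub>1 t y z (\<theta> r) \<omega> \<ge> f\<^sub>2 t y z (\<theta> r) \<omega>"
  obtains C where "0 < C"
    "\<And>s r Y1 Y2. s \<in> {0..T} \<Longrightarrow> r \<in> {s..T + K} \<Longrightarrow> Y1 \<in> anticipated_args M F s r (T + K) \<Longrightarrow>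
      Y2 \<in> anticipated_args M F s r (T + K) \<Longrightarrow>
      AE \<omega> in M. \<forall>y1 y2 z1 z2. f\<^sub>2 s y2 z2 (Y2 r) \<omega> - f\<^sub>1 s y1 z1 (Y1 r) \<omega>
        \<le> C * (\<bar>y2 - y1\<bar> + norm (z2 - z1) + real_cond_exp M (F s) (\<lambda>\<omega>. max (Y2 r \<omega> - Y1 r \<omega>) 0) \<omega>)"
proof -
  obtain C1 where C1: "0 < C1" and lipC1: "\<And>s r \<theta> \<theta>'. s \<in> {0..T} \<Longrightarrow> r \<in> {s..T + K} \<Longrightarrow>
      \<theta> \<in> anticipated_args M F s r (T + K) \<Longrightarrow> \<theta>' \<in> anticipated_args M F s r (T + K) \<Longrightarrow>
      AE \<omega> in M. \<forall>y y' z z'. \<bar>f\<^sub>1 s y z (\<theta> r) \<omega> - f\<^sub>1 s y' z' (\<theta>' r) \<omega>\<bar>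
        \<le> C1 * (\<bar>y - y'\<bar> + norm (z - z') + real_cond_exp M (F s) (\<lambda>\<omega>. \<bar>\<theta> r \<omega> - \<theta>' r \<omega>\<bar>) \<omega>)"
    using lip1 unfolding generator_lipschitz_def by blast
  obtain C2 where C2: "0 < C2" and lipC2: "\<And>s r \<theta> \<theta>'. s \<in> {0..T} \<Longrightarrow> r \<in> {s..T + K} \<Longrightarrow>
      \<theta> \<in> anticipated_args M F s r (T + K) \<Longrightarrow> \<theta>' \<in> anticipated_args M F s r (T + K) \<Longrightarrow>
      AE \<omega> in M. \<forall>y y' z z'. \<bar>f\<^sub>2 s y z (\<theta> r) \<omega> - f\<^sub>2 s y' z' (\<theta>' r) \<omega>\<bar>
        \<le> C2 * (\<bar>y - y'\<bar> + norm (z - z') + real_cond_exp M (F s) (\<lambda>\<omega>. \<bar>\<theta> r \<omega> - \<theta>' r \<omega>\<bar>) \<omega>)"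
    using lip2 unfolding generator_lipschitz_def by blast
  show thesis
  proof (rule that[OF C2])
    fix s r Y1 Y2 assume s: "s \<in> {0..T}" and r: "r \<in> {s..T + K}"
      and Y1: "Y1 \<in> anticipated_args M F s r (T + K)" and Y2: "Y2 \<in> anticipated_args M F s r (T + K)"
    have s0: "0 \<le> s" "0 \<le> r" using s r by auto
    define m where "m t \<omega> = max (Y1 t \<omega>) (Y2 t \<omega>)" for t \<omega>
    have m: "m \<in> anticipated_args M F s r (T + K)"
      unfolding m_def[abs_def] by (rule anticipated_args_max[OF Y1 Y2 s0(2)])
    have same1: "AE \<omega> in M. \<forall>y y' z z'. \<bar>f\<^sub>1 s y z (\<theta> r) \<omega> - f\<^sub>1 s y' z' (\<theta> r) \<omega>\<bar> \<le> C1 * (\<bar>y - y'\<bar> + norm (z - z'))"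
      if "\<theta> \<in> anticipated_args M F s r (T + K)" for \<theta>
      using lipC1[OF s r] s0(1) that by (rule generator_lipschitz_same)
    have same2: "AE \<omega> in M. \<forall>y y' z z'. \<bar>f\<^sub>2 s y z (\<theta> r) \<omega> - f\<^sub>2 s y' z' (\<theta> r) \<omega>\<bar> \<le> C2 * (\<bar>y - y'\<bar> + norm (z - z'))"
      if "\<theta> \<in> anticipated_args M F s r (T + K)" for \<theta>
      using lipC2[OF s r] s0(1) that by (rule generator_lipschitz_same)
    have f12: "AE \<omega> in M. \<forall>y z. f\<^sub>2 s y z (Y1 r) \<omega> \<le> f\<^sub>1 s y z (Y1 r) \<omega>"
      by (rule AE_Lipschitz_le_all[OF same1[OF Y1] same2[OF Y1] le[rule_format, OF s r Y1] C1 C2])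
    have "AE \<omega> in M. f\<^sub>2 s y z (Y2 r) \<omega> \<le> f\<^sub>2 s y z (m r) \<omega>" for y z
    proof -
      have "AE \<omega> in M. m r \<omega> \<ge> Y2 r \<omega>" by (simp add: m_def)
      then show ?thesis using inc s r m Y2 unfolding generator_increasing_def by blast
    qed
    then have f2m: "AE \<omega> in M. \<forall>y z. f\<^sub>2 s y z (Y2 r) \<omega> \<le> f\<^sub>2 s y z (m r) \<omega>"
      by (rule AE_Lipschitz_le_all[OF same2[OF m] same2[OF Y2] _ C2 C2])
    \<comment> \<open>The reason for choosing the maximum: it exceeds Y1 by exactly the positive
      part of Y2 - Y1, and the penalty controls positive parts.\<close>
    have pos: "(\<lambda>\<omega>. \<bar>m r \<omega> - Y1 r \<omega>\<bar>) = (\<lambda>\<omega>. max (Y2 r \<omega> - Y1 r \<omega>) 0)"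
      by (auto simp: m_def fun_eq_iff max_def)
    show "AE \<omega> in M. \<forall>y1 y2 z1 z2. f\<^sub>2 s y2 z2 (Y2 r) \<omega> - f\<^sub>1 s y1 z1 (Y1 r) \<omega>
        \<le> C2 * (\<bar>y2 - y1\<bar> + norm (z2 - z1) + real_cond_exp M (F s) (\<lambda>\<omega>. max (Y2 r \<omega> - Y1 r \<omega>) 0) \<omega>)"
      using f12 f2m lipC2[OF s r m Y1, unfolded pos]
    proof eventually_elim
      case (elim \<omega>)
      show ?case
      proof (intro allI)
        fix y1 y2 z1 z2
        have "f\<^sub>2 s y1 z1 (Y1 r) \<omega> \<le> f\<^sub>1 s y1 z1 (Y1 r) \<omega>" using elim(1) by blast
        moreover have "f\<^sub>2 s y2 z2 (Y2 r) \<omega> \<le> f\<^sub>2 s y2 z2 (m r) \<omega>" using elim(2) by blast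
        moreover have "\<bar>f\<^sub>2 s y2 z2 (m r) \<omega> - f\<^sub>2 s y1 z1 (Y1 r) \<omega>\<bar>
          \<le> C2 * (\<bar>y2 - y1\<bar> + norm (z2 - z1) + real_cond_exp M (F s) (\<lambda>\<omega>. max (Y2 r \<omega> - Y1 r \<omega>) 0) \<omega>)"
          using elim(3) by blast
        ultimately show "f\<^sub>2 s y2 z2 (Y2 r) \<omega> - f\<^sub>1 s y1 z1 (Y1 r) \<omega>
          \<le> C2 * (\<bar>y2 - y1\<bar> + norm (z2 - z1) + real_cond_exp M (F s) (\<lambda>\<omega>. max (Y2 r \<omega> - Y1 r \<omega>) 0) \<omega>)"
          by linarith
      qed
    qed
  qed
qed

text \<open>Comparing the backward equation at s with the one at 0 cancels the terminal value and
  leaves a forward equation, together with step approximations of its martingale part.\<close>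

lemma absde_solution_forward:
  assumes T: "0 < T" and sol: "absde_solution M F V T K \<delta> f \<xi> Y Z" and V: "\<And>t. 0 \<le> t \<Longrightarrow> AE \<omega> in M. W t \<omega> = V t \<omega>"
  obtains I P N z J where "\<And>s. s \<in> {0..T} \<Longrightarrow> I s \<in> borel_measurable (F s)"
    and "\<And>k. step_integral T (P k) (N k) (z k) (J k)"
    and "L2_tendsto (time_space M 0 T) (\<lambda>k (s, \<omega>). norm (z k s \<omega> - Z s \<omega>)) (\<lambda>(s, \<omega>). 0)"
    and "\<And>s. s \<in> {0..T} \<Longrightarrow> L2_tendsto M (\<lambda>k. J k s) (I s)"
    and "\<And>s. s \<in> {0..T} \<Longrightarrow> AE \<omega> in M. Y s \<omega> = Y 0 \<omega> - (LINT u:{0..s}|lborel. absde_drift f \<delta> Y Z u \<omega>) + I s \<omega>"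
proof -
  obtain I where I: "is_ito_integral M F V T Z I"
    and eq: "AE \<omega> in M. \<forall>t\<in>{0..T}.
           Y t \<omega> = \<xi> T \<omega> + (LINT s:{t..T}|lborel. absde_drift f \<delta> Y Z s \<omega>) - (I T \<omega> - I t \<omega>)"
    using sol unfolding absde_solution_def by blast
  have Z: "Z \<in> L2_process M F 0 T"
    and int: "AE \<omega> in M. set_integrable lborel {0..T} (\<lambda>s. absde_drift f \<delta> Y Z s \<omega>)"
    using sol unfolding absde_solution_def by blast+
  obtain P N z J where st: "\<And>k. step_integral T (P k) (N k) (z k) (J k)"
    and zZ: "L2_tendsto (time_space M 0 T) (\<lambda>k (s, \<omega>). norm (z k s \<omega> - Z s \<omega>)) (\<lambda>(s, \<omega>). 0)"
    and JI: "\<And>s. s \<in> {0..T} \<Longrightarrow> L2_tendsto M (\<lambda>k. J k s) (I s)"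
    by (rule is_ito_integral_approximation[OF T V Z I], assumption, rule that)
  have IF: "I s \<in> borel_measurable (F s)" if "s \<in> {0..T}" for s
    using I that by (simp add: is_ito_integral_def adapted_process_def)
  \<comment> \<open>The integral starts at 0 because it is the mean-square limit of step integrals
    that do.\<close>
  have I0: "AE \<omega> in M. I 0 \<omega> = 0"
  proof -
    have L: "L2_tendsto M (\<lambda>k. J k 0) (I 0)" using JI[of 0] T by simp
    have "(\<integral>\<omega>. (J k 0 \<omega> - I 0 \<omega>)\<^sup>2 \<partial>M) = (\<integral>\<omega>. (I 0 \<omega>)\<^sup>2 \<partial>M)" for k
      by (rule Bochner_Integration.integral_cong) (simp_all add: step_integralD(5)[OF st])
    then have "(\<lambda>k :: nat. \<integral>\<omega>. (I 0 \<omega>)\<^sup>2 \<partial>M) \<longlonglongrightarrow> 0" using L by (simp add: L2_tendsto_def)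
    then have "(\<integral>\<omega>. (I 0 \<omega>)\<^sup>2 \<partial>M) = 0" by (simp add: LIMSEQ_const_iff)
    moreover have "integrable M (\<lambda>\<omega>. (I 0 \<omega>)\<^sup>2)" using L by (simp add: L2_tendsto_def square_integrable_def)
    ultimately have "AE \<omega> in M. (I 0 \<omega>)\<^sup>2 = 0" by (subst (asm) integral_nonneg_eq_0_iff_AE) auto
    then show ?thesis by simp
  qed
  have "AE \<omega> in M. Y s \<omega> = Y 0 \<omega> - (LINT u:{0..s}|lborel. absde_drift f \<delta> Y Z u \<omega>) + I s \<omega>"
    if s: "s \<in> {0..T}" for s
    using eq int I0
  proof eventually_elim
    case (elim \<omega>)
    have "(LINT u:{0..T}|lborel. absde_drift f \<delta> Y Z u \<omega>)
        = (LINT u:{0..s}|lborel. absde_drift f \<delta> Y Z u \<omega>) + (LINT u:{s..T}|lborel. absde_drift f \<delta> Y Z u \<omega>)"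
      by (rule set_integral_Icc_split[OF elim(2)]) (use s in auto)
    moreover have "Y s \<omega> = \<xi> T \<omega> + (LINT u:{s..T}|lborel. absde_drift f \<delta> Y Z u \<omega>) - (I T \<omega> - I s \<omega>)"
      using elim(1) s by blast
    moreover have "Y 0 \<omega> = \<xi> T \<omega> + (LINT u:{0..T}|lborel. absde_drift f \<delta> Y Z u \<omega>) - (I T \<omega> - I 0 \<omega>)"
      using elim(1) T by simp
    ultimately show ?case using elim(3) by simp
  qed
  then show thesis using IF st zZ JI by (intro that)
qed

end

section \<open>The estimate for the expected penalty and the comparison\<close>

lemma pen_max_0: "pen (max x 0) = pen x"
  by (simp add: pen_def)

lemma ennreal_integral_le_nn_integral:
  fixes f :: "'b \<Rightarrow> real"
  assumes f: "integrable N f"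
  shows "ennreal (\<integral>x. f x \<partial>N) \<le> (\<integral>\<^sup>+x. ennreal (f x) \<partial>N)"
proof -
  have m: "integrable N (\<lambda>x. max (f x) 0)" using f by (intro Bochner_Integration.integrable_max) auto
  have "ennreal (\<integral>x. f x \<partial>N) \<le> ennreal (\<integral>x. max (f x) 0 \<partial>N)"
    by (intro ennreal_leI integral_mono f m) auto
  also have "\<dots> = (\<integral>\<^sup>+x. ennreal (max (f x) 0) \<partial>N)"
    by (rule nn_integral_eq_integral[OF m, symmetric]) auto
  also have "\<dots> = (\<integral>\<^sup>+x. ennreal (f x) \<partial>N)"
    by (intro nn_integral_cong) (auto simp: max_def ennreal_neg)
  finally show ?thesis .
qed

context brownian_basis
begin

text \<open>The term C \<zeta> supplied by the Ito inequality cancels the one in the bound on h.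
  What remains is \<open>pen1\<close> times |X|, controlled by \<open>pen\<close>, and
  \<open>pen1\<close> times the conditional expectation, which may be replaced by V under the
  integral.\<close>

lemma pen_generator_estimate:
  assumes s: "0 \<le> s" and C: "0 < C"
    and XF: "X \<in> borel_measurable (F s)" and Xsq: "square_integrable M X" and Xr: "square_integrable M X'"
    and h: "AE \<omega> in M. h \<omega> \<le> C * (\<bar>X \<omega>\<bar> + \<zeta> \<omega> + real_cond_exp M (F s) (\<lambda>\<omega>. max (X' \<omega>) 0) \<omega>)"
    and i: "integrable M (\<lambda>\<omega>. pen1 (X \<omega>) * (C * \<zeta> \<omega> - h \<omega>) - C\<^sup>2 * pen (X \<omega>))"
  shows "- (\<integral>\<omega>. pen1 (X \<omega>) * (C * \<zeta> \<omega> - h \<omega>) - C\<^sup>2 * pen (X \<omega>) \<partial>M)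
    \<le> (6 * C + C\<^sup>2) * ((\<integral>\<omega>. pen (X \<omega>) \<partial>M) + (\<integral>\<omega>. pen (X' \<omega>) \<partial>M))"
proof -
  interpret S: finite_measure_subalgebra M "F s" by (rule cond_exp_subalgebra[OF s])
  define V where "V \<omega> = max (X' \<omega>) 0" for \<omega>
  define E where "E = real_cond_exp M (F s) V"
  have X'm: "X' \<in> borel_measurable M" using Xr by measurable
  have V: "square_integrable M V"
    by (rule square_integrable_bound[OF Xr]) (use X'm in \<open>auto simp: V_def[abs_def]\<close>)
  have Vm: "V \<in> borel_measurable M" using V by measurable
  have p1: "square_integrable M (\<lambda>\<omega>. pen1 (X \<omega>))" by (rule square_integrable_pen1[OF Xsq])
  have p1F: "(\<lambda>\<omega>. pen1 (X \<omega>)) \<in> borel_measurable (F s)" using XF by simp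
  have p1V: "integrable M (\<lambda>\<omega>. pen1 (X \<omega>) * V \<omega>)" by (rule integrable_mult_square_integrable[OF p1 V])
  have p1E: "integrable M (\<lambda>\<omega>. pen1 (X \<omega>) * E \<omega>)" "(\<integral>\<omega>. pen1 (X \<omega>) * E \<omega> \<partial>M) = (\<integral>\<omega>. pen1 (X \<omega>) * V \<omega> \<partial>M)"
    unfolding E_def by (rule S.real_cond_exp_intg[OF p1V p1F Vm])+
  have penX: "integrable M (\<lambda>\<omega>. pen (X \<omega>))" "integrable M (\<lambda>\<omega>. pen (X' \<omega>))"
    by (rule integrable_pen[OF Xsq], rule integrable_pen[OF Xr])
  have u0: "0 \<le> (\<integral>\<omega>. pen (X' \<omega>) \<partial>M)" by (simp add: pen_nonneg)
  have "- (\<integral>\<omega>. pen1 (X \<omega>) * (C * \<zeta> \<omega> - h \<omega>) - C\<^sup>2 * pen (X \<omega>) \<partial>M)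
      = (\<integral>\<omega>. - (pen1 (X \<omega>) * (C * \<zeta> \<omega> - h \<omega>) - C\<^sup>2 * pen (X \<omega>)) \<partial>M)"
    by (rule Bochner_Integration.integral_minus[symmetric])
  also have "\<dots> \<le> (\<integral>\<omega>. (3 * C + C\<^sup>2) * pen (X \<omega>) + C * (pen1 (X \<omega>) * E \<omega>) \<partial>M)"
  proof (rule integral_mono_AE)
    show "AE \<omega> in M. - (pen1 (X \<omega>) * (C * \<zeta> \<omega> - h \<omega>) - C\<^sup>2 * pen (X \<omega>))
        \<le> (3 * C + C\<^sup>2) * pen (X \<omega>) + C * (pen1 (X \<omega>) * E \<omega>)"
      using h
    proof eventually_elim
      case (elim \<omega>)
      have "h \<omega> - C * \<zeta> \<omega> \<le> C * (\<bar>X \<omega>\<bar> + E \<omega>)"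
        using elim by (simp add: E_def V_def[abs_def] algebra_simps)
      then have "pen1 (X \<omega>) * (h \<omega> - C * \<zeta> \<omega>) \<le> pen1 (X \<omega>) * (C * (\<bar>X \<omega>\<bar> + E \<omega>))"
        by (rule mult_left_mono) (rule pen1_nonneg)
      also have "\<dots> = C * (pen1 (X \<omega>) * \<bar>X \<omega>\<bar>) + C * (pen1 (X \<omega>) * E \<omega>)" by (simp add: algebra_simps)
      also have "\<dots> \<le> C * (3 * pen (X \<omega>)) + C * (pen1 (X \<omega>) * E \<omega>)"
        using C pen1_mult_abs[of "X \<omega>"] by (intro add_right_mono mult_left_mono) auto
      finally show ?case by (simp add: algebra_simps)
    qed
    show "integrable M (\<lambda>\<omega>. - (pen1 (X \<omega>) * (C * \<zeta> \<omega> - h \<omega>) - C\<^sup>2 * pen (X \<omega>)))"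
      using i by (rule Bochner_Integration.integrable_minus)
  qed (use p1E penX in auto)
  also have "\<dots> = (3 * C + C\<^sup>2) * (\<integral>\<omega>. pen (X \<omega>) \<partial>M) + C * (\<integral>\<omega>. pen1 (X \<omega>) * V \<omega> \<partial>M)"
    using p1E penX by simp
  also have "(\<integral>\<omega>. pen1 (X \<omega>) * V \<omega> \<partial>M) \<le> (\<integral>\<omega>. 3 * pen (X \<omega>) + 3 * pen (X' \<omega>) \<partial>M)"
  proof (rule integral_mono)
    fix \<omega>
    show "pen1 (X \<omega>) * V \<omega> \<le> 3 * pen (X \<omega>) + 3 * pen (X' \<omega>)"
      using pen1_mult[of "V \<omega>" "X \<omega>"] by (simp add: V_def pen_max_0)
  qed (use p1V penX in auto)
  also have "\<dots> = 3 * (\<integral>\<omega>. pen (X \<omega>) \<partial>M) + 3 * (\<integral>\<omega>. pen (X' \<omega>) \<partial>M)"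
    using penX by simp
  finally have "- (\<integral>\<omega>. pen1 (X \<omega>) * (C * \<zeta> \<omega> - h \<omega>) - C\<^sup>2 * pen (X \<omega>) \<partial>M)
      \<le> (3 * C + C\<^sup>2) * (\<integral>\<omega>. pen (X \<omega>) \<partial>M) + C * (3 * (\<integral>\<omega>. pen (X \<omega>) \<partial>M) + 3 * (\<integral>\<omega>. pen (X' \<omega>) \<partial>M))"
    using C by simp
  \<comment> \<open>The coefficient of E pen(X) is 3 C + C^2 + 3 C; that of E pen(X'), which is 3 C,
    is raised to the same value.\<close>
  also have "\<dots> \<le> (6 * C + C\<^sup>2) * ((\<integral>\<omega>. pen (X \<omega>) \<partial>M) + (\<integral>\<omega>. pen (X' \<omega>) \<partial>M))"
  proof -
    have "0 \<le> (3 * C + C\<^sup>2) * (\<integral>\<omega>. pen (X' \<omega>) \<partial>M)" using C u0 by simp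
    then show ?thesis by (simp add: algebra_simps)
  qed
  finally show ?thesis .
qed

text \<open>The order is obtained at each fixed t, with a null set that may depend on t:
  \<open>u t = 0\<close> forces \<open>pen (X t)\<close> to vanish almost surely.\<close>

lemma absde_comparison:
  assumes T: "0 < T" and K: "0 \<le> K" and ant: "anticipation_time T K \<delta>"
    and lip: "generator_lipschitz M F T K f\<^sub>1" "generator_lipschitz M F T K f\<^sub>2"
    and sqf: "generator_square_integrable M F T f\<^sub>1" "generator_square_integrable M F T f\<^sub>2"
    and V: "\<And>t. 0 \<le> t \<Longrightarrow> AE \<omega> in M. W t \<omega> = V t \<omega>"
    and sol1: "absde_solution M F V T K \<delta> f\<^sub>1 \<xi>\<^sub>1 Y\<^sub>1 Z\<^sub>1"
    and sol2: "absde_solution M F V T K \<delta> f\<^sub>2 \<xi>\<^sub>2 Y\<^sub>2 Z\<^sub>2"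
    and inc: "generator_increasing M F T K f\<^sub>2"
    and \<xi>: "\<And>s. s \<in> {T..T + K} \<Longrightarrow> AE \<omega> in M. \<xi>\<^sub>1 s \<omega> \<ge> \<xi>\<^sub>2 s \<omega>"
    and le: "\<And>t y z r \<theta>. t \<in> {0..T} \<Longrightarrow> r \<in> {t..T + K} \<Longrightarrow> \<theta> \<in> anticipated_args M F t r (T + K) \<Longrightarrow>
           AE \<omega> in M. f\<^sub>1 t y z (\<theta> r) \<omega> \<ge> f\<^sub>2 t y z (\<theta> r) \<omega>"
    and t: "t \<in> {0..T + K}"
  shows "AE \<omega> in M. Y\<^sub>1 t \<omega> \<ge> Y\<^sub>2 t \<omega>"
proof -
  let ?U = "T + K"
  have \<delta>: "0 \<le> \<delta> s \<and> s + \<delta> s \<le> ?U" if "s \<in> {0..T}" for s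
    using ant that by (auto simp: anticipation_time_def)
  have \<delta>c: "continuous_on {0..T} \<delta>" using ant by (simp add: anticipation_time_def)
  obtain L where L: "0 \<le> L" and ant_le: "\<And>t g. t \<in> {0..T} \<Longrightarrow> (\<forall>s\<in>{0..?U}. 0 \<le> g s) \<Longrightarrow>
      set_integrable lborel {0..?U} g \<Longrightarrow>
      (\<integral>\<^sup>+s\<in>{t..T}. ennreal (g (s + \<delta> s)) \<partial>lborel) \<le> ennreal L * (\<integral>\<^sup>+s\<in>{t..?U}. ennreal (g s) \<partial>lborel)"
    using ant unfolding anticipation_time_def by blast
  have Y: "Y\<^sub>1 \<in> S2_process M F 0 ?U" "Y\<^sub>2 \<in> S2_process M F 0 ?U"
    and Z: "Z\<^sub>1 \<in> L2_process M F 0 T" "Z\<^sub>2 \<in> L2_process M F 0 T"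
    and dm: "measurable_process M 0 T (absde_drift f\<^sub>1 \<delta> Y\<^sub>1 Z\<^sub>1)" "measurable_process M 0 T (absde_drift f\<^sub>2 \<delta> Y\<^sub>2 Z\<^sub>2)"
    and di: "AE \<omega> in M. set_integrable lborel {0..T} (\<lambda>s. absde_drift f\<^sub>1 \<delta> Y\<^sub>1 Z\<^sub>1 s \<omega>)"
      "AE \<omega> in M. set_integrable lborel {0..T} (\<lambda>s. absde_drift f\<^sub>2 \<delta> Y\<^sub>2 Z\<^sub>2 s \<omega>)"
    and Y\<xi>: "AE \<omega> in M. \<forall>t\<in>{T..?U}. Y\<^sub>1 t \<omega> = \<xi>\<^sub>1 t \<omega>" "AE \<omega> in M. \<forall>t\<in>{T..?U}. Y\<^sub>2 t \<omega> = \<xi>\<^sub>2 t \<omega>"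
    using sol1 sol2 unfolding absde_solution_def by blast+
  define X where "X s \<omega> = Y\<^sub>2 s \<omega> - Y\<^sub>1 s \<omega>" for s \<omega>
  define h where "h s \<omega> = absde_drift f\<^sub>2 \<delta> Y\<^sub>2 Z\<^sub>2 s \<omega> - absde_drift f\<^sub>1 \<delta> Y\<^sub>1 Z\<^sub>1 s \<omega>" for s \<omega>
  define Zd where "Zd s \<omega> = Z\<^sub>2 s \<omega> - Z\<^sub>1 s \<omega>" for s \<omega>
  define u where "u s = (\<integral>\<omega>. pen (X s \<omega>) \<partial>M)" for s
  obtain B1 where B1: "\<And>s. s \<in> {0..?U} \<Longrightarrow> square_integrable M (Y\<^sub>1 s)"
      "\<And>s. s \<in> {0..?U} \<Longrightarrow> (\<integral>\<omega>. (Y\<^sub>1 s \<omega>)\<^sup>2 \<partial>M) \<le> B1"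
    by (rule S2_process_square_integrable[OF Y(1) order_refl], rule that)
  obtain B2 where B2: "\<And>s. s \<in> {0..?U} \<Longrightarrow> square_integrable M (Y\<^sub>2 s)"
      "\<And>s. s \<in> {0..?U} \<Longrightarrow> (\<integral>\<omega>. (Y\<^sub>2 s \<omega>)\<^sup>2 \<partial>M) \<le> B2"
    by (rule S2_process_square_integrable[OF Y(2) order_refl], rule that)
  have Xsq: "square_integrable M (X s)" if "s \<in> {0..?U}" for s
    unfolding X_def[abs_def] by (intro square_integrable_diff B1 B2 that)
  have u0: "0 \<le> u s" for s by (simp add: u_def pen_nonneg)
  have uB: "u s \<le> 3 * (2 * B2 + 2 * B1)" if s: "s \<in> {0..?U}" for s
  proof -
    note i = square_integrableD[OF B1(1)[OF s]] square_integrableD[OF B2(1)[OF s]]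
    have "u s \<le> (\<integral>\<omega>. 3 * (2 * (Y\<^sub>2 s \<omega>)\<^sup>2 + 2 * (Y\<^sub>1 s \<omega>)\<^sup>2) \<partial>M)"
      unfolding u_def
    proof (rule integral_mono)
      fix \<omega>
      have "0 \<le> (Y\<^sub>2 s \<omega> + Y\<^sub>1 s \<omega>)\<^sup>2" by simp
      then have "(X s \<omega>)\<^sup>2 \<le> 2 * (Y\<^sub>2 s \<omega>)\<^sup>2 + 2 * (Y\<^sub>1 s \<omega>)\<^sup>2"
        by (simp add: X_def power2_sum power2_diff)
      then show "pen (X s \<omega>) \<le> 3 * (2 * (Y\<^sub>2 s \<omega>)\<^sup>2 + 2 * (Y\<^sub>1 s \<omega>)\<^sup>2)"
        using pen_le[of "X s \<omega>"] by simp
    qed (use i integrable_pen[OF Xsq[OF s]] in auto)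
    also have "\<dots> = 3 * (2 * (\<integral>\<omega>. (Y\<^sub>2 s \<omega>)\<^sup>2 \<partial>M) + 2 * (\<integral>\<omega>. (Y\<^sub>1 s \<omega>)\<^sup>2 \<partial>M))" using i by simp
    finally show ?thesis using B1(2)[OF s] B2(2)[OF s] by simp
  qed
  have X_terminal: "AE \<omega> in M. X s \<omega> \<le> 0" if s: "s \<in> {T..?U}" for s
    using Y\<xi> \<xi>[OF s] by eventually_elim (use s in \<open>simp add: X_def\<close>)
  \<comment> \<open>The ordered terminal data enter here. They give \<open>u T = 0\<close> in the
    Ito inequality and cut the integral over {t..T + K} in condition (ii) down to {t..T}.\<close>
  have uT: "u s = 0" if s: "s \<in> {T..?U}" for s
  proof -
    have "AE \<omega> in M. pen (X s \<omega>) = 0" using X_terminal[OF s] by eventually_elim (simp add: pen_eq_0_iff)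
    then show ?thesis unfolding u_def by (rule integral_eq_zero_AE)
  qed
  have XN: "square_integrable (time_space M 0 ?U) (case_prod X)"
  proof -
    have m: "case_prod Y\<^sub>1 \<in> borel_measurable (time_space M 0 ?U)" "case_prod Y\<^sub>2 \<in> borel_measurable (time_space M 0 ?U)"
      using Y by (simp_all add: S2_process_def L2_process_def measurable_process_iff)
    have U0: "0 \<le> ?U" using T K by simp
    have "square_integrable (time_space M 0 ?U) (case_prod Y\<^sub>1)"
      by (rule square_integrable_time_space(1)[OF m(1) U0 B1])
    moreover have "square_integrable (time_space M 0 ?U) (case_prod Y\<^sub>2)"
      by (rule square_integrable_time_space(1)[OF m(2) U0 B2])
    ultimately have "square_integrable (time_space M 0 ?U) (\<lambda>x. case_prod Y\<^sub>2 x - case_prod Y\<^sub>1 x)"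
      by (intro square_integrable_diff)
    then show ?thesis by (simp add: X_def[abs_def] case_prod_beta')
  qed
  have XT: "square_integrable (time_space M 0 T) (case_prod X)"
    by (rule square_integrable_time_space_mono[OF XN order_refl]) (use K in simp)
  have usi: "set_integrable lborel {0..?U} u"
    using time_space_Fubini(2)[of 0 ?U "\<lambda>s \<omega>. pen (X s \<omega>)"] integrable_pen[OF XN]
    by (simp add: u_def[abs_def] case_prod_beta')
  have hN: "square_integrable (time_space M 0 T) (case_prod h)"
    using square_integrable_diff[OF drift_square_integrable[OF T \<delta> lip(2) sqf(2) Y(2) Z(2) dm(2)]
        drift_square_integrable[OF T \<delta> lip(1) sqf(1) Y(1) Z(1) dm(1)]]
    by (simp add: h_def[abs_def] case_prod_beta')
  have XF: "X s \<in> borel_measurable (F s)" if s: "s \<in> {0..?U}" for s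
    using Y s unfolding X_def[abs_def]
    by (intro borel_measurable_diff) (simp_all add: S2_process_def L2_process_def adapted_process_def)
  have le': "\<forall>t\<in>{0..T}. \<forall>r\<in>{t..?U}. \<forall>\<theta>\<in>anticipated_args M F t r ?U. \<forall>y z.
      AE \<omega> in M. f\<^sub>1 t y z (\<theta> r) \<omega> \<ge> f\<^sub>2 t y z (\<theta> r) \<omega>"
    by (intro ballI allI le)
  obtain C where C: "0 < C" and gen: "\<And>s r Y1 Y2. s \<in> {0..T} \<Longrightarrow> r \<in> {s..?U} \<Longrightarrow> Y1 \<in> anticipated_args M F s r ?U \<Longrightarrow>
      Y2 \<in> anticipated_args M F s r ?U \<Longrightarrow>
      AE \<omega> in M. \<forall>y1 y2 z1 z2. f\<^sub>2 s y2 z2 (Y2 r) \<omega> - f\<^sub>1 s y1 z1 (Y1 r) \<omega>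
        \<le> C * (\<bar>y2 - y1\<bar> + norm (z2 - z1) + real_cond_exp M (F s) (\<lambda>\<omega>. max (Y2 r \<omega> - Y1 r \<omega>) 0) \<omega>)"
    by (rule drift_difference_bound[OF lip inc le'], rule that)
  define \<psi> where "\<psi> s \<omega> = pen1 (X s \<omega>) * (C * norm (Zd s \<omega>) - h s \<omega>) - C\<^sup>2 * pen (X s \<omega>)" for s \<omega>
  have Zdm: "case_prod Zd \<in> borel_measurable (time_space M 0 T)"
  proof -
    have "case_prod Z\<^sub>1 \<in> borel_measurable (time_space M 0 T)" "case_prod Z\<^sub>2 \<in> borel_measurable (time_space M 0 T)"
      using Z by (simp_all add: L2_process_def measurable_process_iff)
    from borel_measurable_diff[OF this(2,1)] show ?thesis by (simp add: Zd_def[abs_def] case_prod_beta')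
  qed
  have ZdN: "square_integrable (time_space M 0 T) (\<lambda>(s, \<omega>). norm (Zd s \<omega>))"
  proof (rule square_integrable_bound)
    show "square_integrable (time_space M 0 T) (\<lambda>x. norm (Z\<^sub>2 (fst x) (snd x)) + norm (Z\<^sub>1 (fst x) (snd x)))"
      using square_integrable_add[OF L2_process_square_integrable[OF Z(2)] L2_process_square_integrable[OF Z(1)]]
      by (simp add: case_prod_beta')
    show "(\<lambda>(s, \<omega>). norm (Zd s \<omega>)) \<in> borel_measurable (time_space M 0 T)"
      using Zdm by (simp add: case_prod_beta')
    show "AE x in time_space M 0 T. \<bar>case x of (s, \<omega>) \<Rightarrow> norm (Zd s \<omega>)\<bar> \<le> \<bar>norm (Z\<^sub>2 (fst x) (snd x)) + norm (Z\<^sub>1 (fst x) (snd x))\<bar>"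
      by (rule AE_I2) (simp add: Zd_def case_prod_beta' norm_triangle_ineq4)
  qed
  have \<psi>N: "integrable (time_space M 0 T) (case_prod \<psi>)"
    unfolding \<psi>_def case_prod_beta' using XT hN ZdN
    by (intro Bochner_Integration.integrable_diff integrable_mult_square_integrable square_integrable_pen1
        square_integrable_diff square_integrable_cmult integrable_mult_right integrable_pen)
       (simp_all add: case_prod_beta')
  obtain I1 P1 N1 z1 J1 where I1: "\<And>s. s \<in> {0..T} \<Longrightarrow> I1 s \<in> borel_measurable (F s)"
    and st1: "\<And>k. step_integral T (P1 k) (N1 k) (z1 k) (J1 k)"
    and zZ1: "L2_tendsto (time_space M 0 T) (\<lambda>k (s, \<omega>). norm (z1 k s \<omega> - Z\<^sub>1 s \<omega>)) (\<lambda>(s, \<omega>). 0)"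
    and JI1: "\<And>s. s \<in> {0..T} \<Longrightarrow> L2_tendsto M (\<lambda>k. J1 k s) (I1 s)"
    and eq1: "\<And>s. s \<in> {0..T} \<Longrightarrow> AE \<omega> in M. Y\<^sub>1 s \<omega> = Y\<^sub>1 0 \<omega> - (LINT u:{0..s}|lborel. absde_drift f\<^sub>1 \<delta> Y\<^sub>1 Z\<^sub>1 u \<omega>) + I1 s \<omega>"
    by (rule absde_solution_forward[OF T sol1 V], assumption, rule that)
  obtain I2 P2 N2 z2 J2 where I2: "\<And>s. s \<in> {0..T} \<Longrightarrow> I2 s \<in> borel_measurable (F s)"
    and st2: "\<And>k. step_integral T (P2 k) (N2 k) (z2 k) (J2 k)"
    and zZ2: "L2_tendsto (time_space M 0 T) (\<lambda>k (s, \<omega>). norm (z2 k s \<omega> - Z\<^sub>2 s \<omega>)) (\<lambda>(s, \<omega>). 0)"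
    and JI2: "\<And>s. s \<in> {0..T} \<Longrightarrow> L2_tendsto M (\<lambda>k. J2 k s) (I2 s)"
    and eq2: "\<And>s. s \<in> {0..T} \<Longrightarrow> AE \<omega> in M. Y\<^sub>2 s \<omega> = Y\<^sub>2 0 \<omega> - (LINT u:{0..s}|lborel. absde_drift f\<^sub>2 \<delta> Y\<^sub>2 Z\<^sub>2 u \<omega>) + I2 s \<omega>"
    by (rule absde_solution_forward[OF T sol2 V], assumption, rule that)
  have zd: "L2_tendsto (time_space M 0 T) (\<lambda>k (s, \<omega>). norm (z2 k s \<omega> - z1 k s \<omega> - Zd s \<omega>)) (\<lambda>(s, \<omega>). 0)"
  proof -
    have "L2_tendsto (time_space M 0 T) (\<lambda>k x. norm (z2 k (fst x) (snd x) - Z\<^sub>2 (fst x) (snd x))) (\<lambda>x. 0)"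
      using zZ2 by (simp add: case_prod_beta')
    moreover have "L2_tendsto (time_space M 0 T) (\<lambda>k x. - norm (z1 k (fst x) (snd x) - Z\<^sub>1 (fst x) (snd x))) (\<lambda>x. 0)"
      using zZ1 by (auto simp: L2_tendsto_def case_prod_beta' intro!: square_integrable_uminus)
    ultimately have sum: "L2_tendsto (time_space M 0 T)
        (\<lambda>k x. norm (z2 k (fst x) (snd x) - Z\<^sub>2 (fst x) (snd x)) - (- norm (z1 k (fst x) (snd x) - Z\<^sub>1 (fst x) (snd x)))) (\<lambda>x. 0 - 0)"
      by (rule L2_tendsto_diff)
    show ?thesis
    proof (rule L2_tendsto_dominated[OF sum, where c = 1])
      fix k
      show "(\<lambda>(s, \<omega>). norm (z2 k s \<omega> - z1 k s \<omega> - Zd s \<omega>)) \<in> borel_measurable (time_space M 0 T)"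
        using step_integralD(3)[OF st1[of k]] step_integralD(3)[OF st2[of k]] Zdm by (simp add: case_prod_beta')
      show "AE x in time_space M 0 T. \<bar>(case x of (s, \<omega>) \<Rightarrow> norm (z2 k s \<omega> - z1 k s \<omega> - Zd s \<omega>)) - (case x of (s, \<omega>) \<Rightarrow> 0)\<bar>
        \<le> 1 * \<bar>norm (z2 k (fst x) (snd x) - Z\<^sub>2 (fst x) (snd x)) - (- norm (z1 k (fst x) (snd x) - Z\<^sub>1 (fst x) (snd x))) - (0 - 0)\<bar>"
      proof (rule AE_I2)
        fix x :: "real \<times> 'a"
        have "norm ((z2 k (fst x) (snd x) - Z\<^sub>2 (fst x) (snd x)) - (z1 k (fst x) (snd x) - Z\<^sub>1 (fst x) (snd x)))
          \<le> norm (z2 k (fst x) (snd x) - Z\<^sub>2 (fst x) (snd x)) + norm (z1 k (fst x) (snd x) - Z\<^sub>1 (fst x) (snd x))"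
          by (rule norm_triangle_ineq4)
        then show "\<bar>(case x of (s, \<omega>) \<Rightarrow> norm (z2 k s \<omega> - z1 k s \<omega> - Zd s \<omega>)) - (case x of (s, \<omega>) \<Rightarrow> 0)\<bar>
        \<le> 1 * \<bar>norm (z2 k (fst x) (snd x) - Z\<^sub>2 (fst x) (snd x)) - (- norm (z1 k (fst x) (snd x) - Z\<^sub>1 (fst x) (snd x))) - (0 - 0)\<bar>"
          by (simp add: Zd_def case_prod_beta' algebra_simps)
      qed
    qed (simp add: case_prod_beta')
  qed
  have Xeq: "AE \<omega> in M. X s \<omega> = X 0 \<omega> - (LINT u:{0..s}|lborel. h u \<omega>) + (I2 s \<omega> - I1 s \<omega>)" if s: "s \<in> {0..T}" for s
    using eq1[OF s] eq2[OF s] di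
  proof eventually_elim
    case (elim \<omega>)
    have "(LINT u:{0..s}|lborel. h u \<omega>)
      = (LINT u:{0..s}|lborel. absde_drift f\<^sub>2 \<delta> Y\<^sub>2 Z\<^sub>2 u \<omega>) - (LINT u:{0..s}|lborel. absde_drift f\<^sub>1 \<delta> Y\<^sub>1 Z\<^sub>1 u \<omega>)"
      unfolding h_def
      by (intro set_integral_diff set_integrable_subset[OF elim(4)] set_integrable_subset[OF elim(3)]) (use s in auto)
    then show ?case using elim(1,2) by (simp add: X_def)
  qed
  have UT: "s \<in> {0..?U}" if "s \<in> {0..T}" for s using that K by auto
  \<comment> \<open>The difference of the two step approximations is again a step integral, with
    breakpoints united and bounds added; it approximates the martingale part of X.\<close>
  have ito: "u t + integral\<^sup>L (time_space M t T) (case_prod \<psi>) \<le> u T" if t: "t \<in> {0..T}" for t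
    unfolding u_def \<psi>_def[abs_def]
    by (rule ito_inequality[where z = "\<lambda>k s \<omega>. z2 k s \<omega> - z1 k s \<omega>" and J = "\<lambda>k s \<omega>. J2 k s \<omega> - J1 k s \<omega>"
          and I = "\<lambda>s \<omega>. I2 s \<omega> - I1 s \<omega>" and P = "\<lambda>k. P2 k \<union> P1 k" and N = "\<lambda>k. N2 k + N1 k", OF T _ Zdm ZdN zd _ _ hN _ XT _ Xeq t])
       (intro step_integral_diff st1 st2 borel_measurable_diff I1 I2 L2_tendsto_diff JI1 JI2 XF Xsq UT; assumption)+
  define c where "c = 6 * C + C\<^sup>2"
  have c0: "0 \<le> c" using C by (simp add: c_def)
  \<comment> \<open>Integrability of \<psi> s comes from Fubini for almost every s only, so it stays
    a premise.\<close>
  have key: "- (\<integral>\<omega>. \<psi> s \<omega> \<partial>M) \<le> c * (u s + u (s + \<delta> s))" if s: "s \<in> {0..T}" and i: "integrable M (\<psi> s)" for s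
  proof -
    have r: "0 \<le> s" "s \<le> s + \<delta> s" "s + \<delta> s \<le> ?U" "s + \<delta> s \<in> {s..?U}" "s + \<delta> s \<in> {0..?U}"
      using \<delta>[OF s] s by auto
    have "AE \<omega> in M. h s \<omega> \<le> C * (\<bar>X s \<omega>\<bar> + norm (Zd s \<omega>) + real_cond_exp M (F s) (\<lambda>\<omega>. max (X (s + \<delta> s) \<omega>) 0) \<omega>)"
      using gen[OF s r(4) S2_process_anticipated_args[OF Y(1) r(1-3)] S2_process_anticipated_args[OF Y(2) r(1-3)]]
      by eventually_elim (simp add: h_def X_def Zd_def absde_drift_def)
    from pen_generator_estimate[OF r(1) C XF[OF UT[OF s]] Xsq[OF UT[OF s]] Xsq[OF r(5)] this i[unfolded \<psi>_def]]
    show ?thesis by (simp add: \<psi>_def u_def c_def)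
  qed
  have main: "ennreal (u t) \<le> ennreal (c * (1 + L)) * (\<integral>\<^sup>+s\<in>{t..T}. ennreal (u s) \<partial>lborel)" if t: "t \<in> {0..T}" for t
  proof -
    have t': "0 \<le> t" "t \<le> T" using t by auto
    have \<psi>t: "integrable (time_space M t T) (case_prod \<psi>)"
      by (rule integrable_time_space_mono[OF \<psi>N t'(1) order_refl])
    define \<Psi> where "\<Psi> s = - (\<integral>\<omega>. \<psi> s \<omega> \<partial>M)" for s
    have \<Psi>i: "integrable lborel (\<lambda>s. indicator {t..T} s * \<Psi> s)"
      using time_space_Fubini(2)[OF \<psi>t] by (simp add: set_integrable_def \<Psi>_def)
    \<comment> \<open>D and \<open>u'\<close> extend by zero to the whole line. Continuity of
      \<delta> makes D measurable, and composing the two shows that u (s + \<delta> s) is measurable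
      on {t..T}.\<close>
    define D where "D s = indicator {0..T} s *\<^sub>R (s + \<delta> s)" for s
    define u' where "u' s = indicator {0..?U} s *\<^sub>R u s" for s
    have u'm: "u' \<in> borel_measurable borel"
      using usi borel_measurable_integrable[of lborel u'] by (simp add: set_integrable_def u'_def[abs_def])
    have Dm: "D \<in> borel_measurable borel"
      unfolding D_def[abs_def] by (intro borel_measurable_continuous_on_indicator continuous_intros \<delta>c) simp
    have fm: "(\<lambda>s. ennreal (u s) * indicator {t..T} s) \<in> borel_measurable lborel"
    proof -
      have "(\<lambda>s. ennreal (u s) * indicator {t..T} s) = (\<lambda>s. ennreal (u' s) * indicator {t..T} s)"
        using t K by (auto simp: u'_def fun_eq_iff split: split_indicator)
      then show ?thesis using u'm by simp
    qed
    have gm: "(\<lambda>s. ennreal (u (s + \<delta> s)) * indicator {t..T} s) \<in> borel_measurable lborel"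
    proof -
      have "(\<lambda>s. ennreal (u (s + \<delta> s)) * indicator {t..T} s) = (\<lambda>s. ennreal (u' (D s)) * indicator {t..T} s)"
      proof
        fix s
        show "ennreal (u (s + \<delta> s)) * indicator {t..T} s = ennreal (u' (D s)) * indicator {t..T} s"
        proof (cases "s \<in> {t..T}")
          case True
          then have "s \<in> {0..T}" using t by auto
          moreover from \<delta>[OF this] this have "s + \<delta> s \<in> {0..?U}" by auto
          ultimately show ?thesis by (simp add: u'_def D_def)
        qed simp
      qed
      then show ?thesis using measurable_compose[OF Dm u'm] by simp
    qed
    have "u t \<le> - integral\<^sup>L (time_space M t T) (case_prod \<psi>)"
      using ito[OF t] uT[of T] K by simp
    also have "\<dots> = (\<integral>s. indicator {t..T} s * \<Psi> s \<partial>lborel)"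
      using time_space_Fubini(3)[OF \<psi>t] by (simp add: \<Psi>_def set_lebesgue_integral_def)
    finally have "ennreal (u t) \<le> ennreal (\<integral>s. indicator {t..T} s * \<Psi> s \<partial>lborel)" by (rule ennreal_leI)
    \<comment> \<open>From here on integrals are extended nonnegative ones, as in condition (ii).
      \<Psi> may take negative values, hence an inequality.\<close>
    also have "\<dots> \<le> (\<integral>\<^sup>+s. ennreal (indicator {t..T} s * \<Psi> s) \<partial>lborel)"
      by (rule ennreal_integral_le_nn_integral[OF \<Psi>i])
    also have "\<dots> \<le> (\<integral>\<^sup>+s. ennreal c * (ennreal (u s) * indicator {t..T} s + ennreal (u (s + \<delta> s)) * indicator {t..T} s) \<partial>lborel)"
    proof (rule nn_integral_mono_AE)
      have "AE s in lborel. s \<in> {t..T} \<longrightarrow> integrable M (\<psi> s)"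
        using time_space_Fubini(1)[OF \<psi>t] by (simp only: AE_lborel_Icc)
      then show "AE s in lborel. ennreal (indicator {t..T} s * \<Psi> s)
          \<le> ennreal c * (ennreal (u s) * indicator {t..T} s + ennreal (u (s + \<delta> s)) * indicator {t..T} s)"
      proof eventually_elim
        case (elim s)
        show ?case
        proof (cases "s \<in> {t..T}")
          case True
          then have "s \<in> {0..T}" using t by auto
          from key[OF this] elim True have "ennreal (\<Psi> s) \<le> ennreal (c * (u s + u (s + \<delta> s)))"
            by (intro ennreal_leI) (simp add: \<Psi>_def)
          also have "\<dots> = ennreal c * (ennreal (u s) + ennreal (u (s + \<delta> s)))"
            using c0 u0 by (simp add: ennreal_mult' ennreal_plus)
          finally show ?thesis using True by simp
        qed simp
      qed
    qed
    also have "\<dots> = ennreal c * ((\<integral>\<^sup>+s\<in>{t..T}. ennreal (u s) \<partial>lborel) + (\<integral>\<^sup>+s\<in>{t..T}. ennreal (u (s + \<delta> s)) \<partial>lborel))"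
      using fm gm by (simp add: nn_integral_cmult nn_integral_add)
    also have "\<dots> \<le> ennreal c * ((\<integral>\<^sup>+s\<in>{t..T}. ennreal (u s) \<partial>lborel) + ennreal L * (\<integral>\<^sup>+s\<in>{t..T}. ennreal (u s) \<partial>lborel))"
    proof (intro mult_left_mono add_left_mono)
      have "(\<integral>\<^sup>+s\<in>{t..T}. ennreal (u (s + \<delta> s)) \<partial>lborel) \<le> ennreal L * (\<integral>\<^sup>+s\<in>{t..?U}. ennreal (u s) \<partial>lborel)"
        by (rule ant_le[OF t _ usi]) (simp add: u0)
      also have "\<dots> \<le> ennreal L * (\<integral>\<^sup>+s\<in>{t..T}. ennreal (u s) \<partial>lborel)"
      proof (rule mult_left_mono, rule nn_integral_mono)
        fix s
        show "ennreal (u s) * indicator {t..?U} s \<le> ennreal (u s) * indicator {t..T} s"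
          using uT[of s] by (auto split: split_indicator)
      qed simp
      finally show "(\<integral>\<^sup>+s\<in>{t..T}. ennreal (u (s + \<delta> s)) \<partial>lborel) \<le> ennreal L * (\<integral>\<^sup>+s\<in>{t..T}. ennreal (u s) \<partial>lborel)" .
    qed simp
    also have "\<dots> = ennreal c * ((1 + ennreal L) * (\<integral>\<^sup>+s\<in>{t..T}. ennreal (u s) \<partial>lborel))"
      by (simp add: distrib_right)
    also have "1 + ennreal L = ennreal (1 + L)" using L by (simp add: ennreal_plus)
    also have "ennreal c * (ennreal (1 + L) * (\<integral>\<^sup>+s\<in>{t..T}. ennreal (u s) \<partial>lborel))
        = ennreal (c * (1 + L)) * (\<integral>\<^sup>+s\<in>{t..T}. ennreal (u s) \<partial>lborel)"
      using c0 L by (simp add: ennreal_mult mult.assoc)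
    finally show ?thesis .
  qed
  have "AE \<omega> in M. X t \<omega> \<le> 0"
  proof (cases "t \<in> {0..T}")
    case True
    have "u t = 0"
      by (rule gronwall_zero[OF _ _ main True, where B = "3 * (2 * B2 + 2 * B1)"])
         (use u0 uB UT c0 L in auto)
    then have "AE \<omega> in M. pen (X t \<omega>) = 0"
      unfolding u_def using integrable_pen[OF Xsq[OF t]]
      by (subst (asm) integral_nonneg_eq_0_iff_AE) (auto simp: pen_nonneg)
    then show ?thesis by (simp add: pen_eq_0_iff)
  next
    case False
    then show ?thesis using t by (intro X_terminal) auto
  qed
  then show ?thesis by (simp add: X_def)
qed

end

theorem theorem5p1:
  fixes M :: "'a measure"
    and F :: "real \<Rightarrow> 'a measure"
    and W :: "real \<Rightarrow> 'a \<Rightarrow> real ^ 'd"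
    and T K :: real
    and \<delta> :: "real \<Rightarrow> real"
    and f\<^sub>1 f\<^sub>2 :: "('a, 'd) generator"
    and \<xi>\<^sub>1 \<xi>\<^sub>2 Y\<^sub>1 Y\<^sub>2 :: "real \<Rightarrow> 'a \<Rightarrow> real"
    and Z\<^sub>1 Z\<^sub>2 :: "real \<Rightarrow> 'a \<Rightarrow> real ^ 'd"
  assumes "prob_space M" and "complete_measure M"
    and "standard_brownian_motion M W"
    and "\<And>t. 0 \<le> t \<Longrightarrow> sets (F t) = sets (brownian_filtration M W t)"
    and "0 < T" and "0 \<le> K"
    and "anticipation_time T K \<delta>"
    and "generator_maps M F T K f\<^sub>1" and "generator_maps M F T K f\<^sub>2"
    and "generator_lipschitz M F T K f\<^sub>1" and "generator_lipschitz M F T K f\<^sub>2"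
    and "generator_square_integrable M F T f\<^sub>1" and "generator_square_integrable M F T f\<^sub>2"
    and "\<xi>\<^sub>1 \<in> S2_process M F T (T + K)" and "\<xi>\<^sub>2 \<in> S2_process M F T (T + K)"
    and "absde_solution M F W T K \<delta> f\<^sub>1 \<xi>\<^sub>1 Y\<^sub>1 Z\<^sub>1"
    and "absde_solution M F W T K \<delta> f\<^sub>2 \<xi>\<^sub>2 Y\<^sub>2 Z\<^sub>2"
    and "generator_increasing M F T K f\<^sub>2"
    and "\<And>s. s \<in> {T..T + K} \<Longrightarrow> AE \<omega> in M. \<xi>\<^sub>1 s \<omega> \<ge> \<xi>\<^sub>2 s \<omega>"
    and "\<And>t y z r \<theta>. t \<in> {0..T} \<Longrightarrow> r \<in> {t..T + K} \<Longrightarrow> \<theta> \<in> anticipated_args M F t r (T + K) \<Longrightarrow>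
           AE \<omega> in M. f\<^sub>1 t y z (\<theta> r) \<omega> \<ge> f\<^sub>2 t y z (\<theta> r) \<omega>"
  shows "AE t in lborel. t \<in> {0..T + K} \<longrightarrow> (AE \<omega> in M. Y\<^sub>1 t \<omega> \<ge> Y\<^sub>2 t \<omega>)"
proof -
  \<comment> \<open>Filtration and solutions remain those of W; the modification only serves as the
    Brownian motion of the basis, in which the estimates are carried out.\<close>
  obtain W' where W': "brownian_basis M F W'" "\<And>t. 0 \<le> t \<Longrightarrow> AE \<omega> in M. W' t \<omega> = W t \<omega>"
    by (rule brownian_basis_modification[OF assms(1-4)], assumption, rule that)
  have "AE \<omega> in M. Y\<^sub>1 t \<omega> \<ge> Y\<^sub>2 t \<omega>" if "t \<in> {0..T + K}" for t
    using W'(1) assms(5-7) assms(10-13) W'(2) assms(16-20) that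
    by (rule brownian_basis.absde_comparison)
  then show ?thesis by (intro AE_I2) blast
qed

end
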